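(* Let $R$ and $R'$ be finite commutative rings with identity, and let $P\subseteq R$ and $P'\subseteq R'$ be proper prime ideals with $|P|\geq 2$. Suppose that $|P|=|P'|$ and $|R/P|=|R'/P'|$. Let $k$ be a field and set $I=I(\Gamma_P(R))$ and $I'=I(\Gamma_{P'}(R'))$ (edge ideals over $k$). Then $\Gamma_P(R)$ and $\Gamma_{P'}(R')$ are isomorphic graphs. Consequently, after a relabeling of variables, the edge ideals $I$ and $I'$ are isomorphic monomial ideals. In particular, the following invariants agree for $I$ and $I'$: (1) the number of minimal vertex covers (of the underlying graphs); (2) the number and heights of the minimal primes; (3) the ordinary-power generator counts $\mu(I^n)$ and $\mu((I')^n)$ for all $n\geq 1$; (4) the Hilbert functions of the special fiber rings $\mathcal{F}(I)$ and $\mathcal{F}(I')$; (5) the analytic spreads $\ell(I)$ and $\ell(I')$; (6) the regularity sequences of ordinary powers. More precisely, $\mu(I^n)=\mu((I')^n)$ for all $n\geq 1$, $\operatorname{HF}_{\mathcal{F}(I)}(n)=\operatorname{HF}_{\mathcal{F}(I')}(n)$ for all $n\geq 0$, $\ell(I)=\ell(I')$, and $\operatorname{reg}(I^n)=\operatorname{reg}((I')^n)=2n$ for every $n\geq 1$.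
   Context: For a finite commutative ring $R$ with identity and a proper prime ideal $P$, the prime ideal graph $\Gamma_P(R)$ is the simple graph with vertex set $R\setminus\{0\}$ in which two distinct vertices $x,y$ are adjacent if and only if $xy\in P$. The edge ideal $I(\Gamma)$ of a finite simple graph $\Gamma$ on vertices $z_1,\ldots,z_r$ is the ideal $(z_iz_j : \{z_i,z_j\}\text{ an edge})$ of the standard graded polynomial ring $S=k[z_1,\ldots,z_r]$. "Isomorphic after a relabeling of variables" means that a bijection between the two sets of variables induces a $k$-algebra isomorphism of the polynomial rings carrying $I$ onto $I'$. For a monomial ideal $L$, $\mu(L)$ is its number of minimal monomial generators. With $\mathfrak m$ the homogeneous maximal ideal, the special fiber ring is $\mathcal{F}(I)=\bigoplus_{n\geq0}I^n/\mathfrak m I^n$ ($I^0=S$), $\operatorname{HF}_{\mathcal{F}(I)}(n)=\dim_k I^n/\mathfrak m I^n$, and the analytic spread $\ell(I)$ is the Krull dimension of $\mathcal{F}(I)$. $\operatorname{reg}$ is Castelnuovo–Mumford regularity (of the ideal as an $S$-module). *)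

theory Defs
  imports
    "HOL-Library.Poly_Mapping"
    "HOL-Library.Extended_Nat"
    "HOL-Algebra.Ideal_Product"
    "HOL-Algebra.QuotRing"
    "HOL-Algebra.Embedded_Algebras"
    "Jordan_Normal_Form.Matrix"
begin

section \<open>Finite simple graphs and prime ideal graphs\<close>

record 'v sgraph =
  vertices :: "'v set"
  edges :: "'v set set"

definition sgraph_iso :: "'v sgraph \<Rightarrow> 'w sgraph \<Rightarrow> ('v \<Rightarrow> 'w) \<Rightarrow> bool" where
  "sgraph_iso G H f \<longleftrightarrow> bij_betw f (vertices G) (vertices H) \<and>
     (\<forall>u\<in>vertices G. \<forall>v\<in>vertices G. {u, v} \<in> edges G \<longleftrightarrow> {f u, f v} \<in> edges H)"

definition vertex_cover :: "'v sgraph \<Rightarrow> 'v set \<Rightarrow> bool" where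
  "vertex_cover G C \<longleftrightarrow> C \<subseteq> vertices G \<and> (\<forall>e\<in>edges G. e \<inter> C \<noteq> {})"

definition min_vertex_covers :: "'v sgraph \<Rightarrow> 'v set set" where
  "min_vertex_covers G = {C. vertex_cover G C \<and> (\<forall>C'. C' \<subset> C \<longrightarrow> \<not> vertex_cover G C')}"

definition prime_ideal_graph :: "('a, 'm) ring_scheme \<Rightarrow> 'a set \<Rightarrow> 'a sgraph" where
  "prime_ideal_graph R P =
     \<lparr>vertices = carrier R - {\<zero>\<^bsub>R\<^esub>},
      edges = {{x, y} | x y. x \<in> carrier R - {\<zero>\<^bsub>R\<^esub>} \<and> y \<in> carrier R - {\<zero>\<^bsub>R\<^esub>} \<and>
                             x \<noteq> y \<and> x \<otimes>\<^bsub>R\<^esub> y \<in> P}\<rparr>"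


section \<open>Polynomial rings\<close>

text \<open>A monomial is a finitely supported exponent function, so that products of monomials are
  sums of exponent functions. The ring \<open>k[z\<^sub>v : v \<in> V]\<close> consists of those polynomials all of whose
  monomials involve only variables from \<open>V\<close>.\<close>

type_synonym ('v, 'k) mpol = "('v \<Rightarrow>\<^sub>0 nat) \<Rightarrow>\<^sub>0 'k"

definition polyring :: "'v set \<Rightarrow> ('v, 'k::field) mpol ring" where
  "polyring V = \<lparr>carrier = {p. \<forall>t\<in>Poly_Mapping.keys p. Poly_Mapping.keys t \<subseteq> V},
                 monoid.mult = (*), one = 1, zero = 0, add = (+)\<rparr>"

definition pconst :: "'k \<Rightarrow> ('v, 'k::field) mpol" where
  "pconst c = Poly_Mapping.single 0 c"

definition pvar :: "'v \<Rightarrow> ('v, 'k::field) mpol" where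
  "pvar v = Poly_Mapping.single (Poly_Mapping.single v 1) 1"

definition monomials :: "'v set \<Rightarrow> ('v, 'k::field) mpol set" where
  "monomials V = {Poly_Mapping.single t 1 | t. Poly_Mapping.keys t \<subseteq> V}"

definition mdeg :: "('v \<Rightarrow>\<^sub>0 nat) \<Rightarrow> nat" where
  "mdeg t = (\<Sum>v\<in>Poly_Mapping.keys t. Poly_Mapping.lookup t v)"

definition max_hom_ideal :: "'v set \<Rightarrow> ('v, 'k::field) mpol set" where
  "max_hom_ideal V = Idl\<^bsub>polyring V\<^esub> (pvar ` V)"

definition edge_ideal :: "'v sgraph \<Rightarrow> ('v, 'k::field) mpol set" where
  "edge_ideal G = Idl\<^bsub>polyring (vertices G)\<^esub> {pvar u * pvar v | u v. {u, v} \<in> edges G}"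

text \<open>The bijection \<open>\<sigma>\<close> of the variables induces an isomorphism of \<open>k\<close>-algebras carrying \<open>I\<close>
  onto \<open>I'\<close>.\<close>

definition relabeling_iso ::
  "'v set \<Rightarrow> ('v, 'k::field) mpol set \<Rightarrow> 'w set \<Rightarrow> ('w, 'k) mpol set \<Rightarrow> ('v \<Rightarrow> 'w) \<Rightarrow> bool" where
  "relabeling_iso V I W I' \<sigma> \<longleftrightarrow> bij_betw \<sigma> V W \<and>
     (\<exists>\<phi>\<in>ring_iso (polyring V) (polyring W).
        (\<forall>c. \<phi> (pconst c) = pconst c) \<and> (\<forall>v\<in>V. \<phi> (pvar v) = pvar (\<sigma> v)) \<and> \<phi> ` I = I')"


section \<open>Monomial ideals\<close>

definition monomial_ideal :: "'v set \<Rightarrow> ('v, 'k::field) mpol set \<Rightarrow> bool" where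
  "monomial_ideal V L \<longleftrightarrow> (\<exists>G\<subseteq>monomials V. L = Idl\<^bsub>polyring V\<^esub> G)"

definition min_mon_gens :: "'v set \<Rightarrow> ('v, 'k::field) mpol set \<Rightarrow> ('v, 'k) mpol set \<Rightarrow> bool" where
  "min_mon_gens V L G \<longleftrightarrow> G \<subseteq> monomials V \<and> Idl\<^bsub>polyring V\<^esub> G = L \<and>
     (\<forall>H. H \<subset> G \<longrightarrow> Idl\<^bsub>polyring V\<^esub> H \<noteq> L)"

text \<open>A monomial ideal has exactly one minimal set of monomial generators.\<close>

definition mu :: "'v set \<Rightarrow> ('v, 'k::field) mpol set \<Rightarrow> nat" where
  "mu V L = card (THE G. min_mon_gens V L G)"


section \<open>Heights, Krull dimension, powers of ideals\<close>

definition prime_chain :: "('a, 'm) ring_scheme \<Rightarrow> nat \<Rightarrow> (nat \<Rightarrow> 'a set) \<Rightarrow> bool" where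
  "prime_chain R n Q \<longleftrightarrow> (\<forall>i\<le>n. primeideal (Q i) R) \<and> (\<forall>i<n. Q i \<subset> Q (Suc i))"

definition krull_dim :: "('a, 'm) ring_scheme \<Rightarrow> enat" where
  "krull_dim R = (SUP n\<in>{n. \<exists>Q. prime_chain R n Q}. enat n)"

definition height :: "('a, 'm) ring_scheme \<Rightarrow> 'a set \<Rightarrow> enat" where
  "height R P = (SUP n\<in>{n. \<exists>Q. prime_chain R n Q \<and> Q n = P}. enat n)"

definition minimal_primes :: "('a, 'm) ring_scheme \<Rightarrow> 'a set \<Rightarrow> 'a set set" where
  "minimal_primes R I = {Q. primeideal Q R \<and> I \<subseteq> Q \<and>
     (\<forall>Q'. primeideal Q' R \<and> I \<subseteq> Q' \<and> Q' \<subseteq> Q \<longrightarrow> Q' = Q)}"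

definition ideal_power :: "('a, 'm) ring_scheme \<Rightarrow> 'a set \<Rightarrow> nat \<Rightarrow> 'a set" where
  "ideal_power R I n = I [^]\<^bsub>ideals_set R\<^esub> n"


section \<open>The special fiber ring\<close>

text \<open>An element of \<open>\<Oplus>\<^sub>n I\<^sup>n/MI\<^sup>n\<close> is a function \<open>f\<close> whose value at \<open>n\<close> is a coset of \<open>MI\<^sup>n\<close> in \<open>I\<^sup>n\<close>,
  for all but finitely many \<open>n\<close> the zero coset \<open>MI\<^sup>n\<close>. The degree \<open>n\<close> component of a product is
  the class of \<open>\<Sum>i\<le>n. a\<^sub>i b\<^sub>n\<^sub>-\<^sub>i\<close> for arbitrary representatives \<open>a\<^sub>i\<close>, \<open>b\<^sub>j\<close> of the components
  of the factors; as in \<^const>\<open>rcoset_mult\<close>, the union runs over all choices.\<close>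

definition fiber_zero :: "('a, 'm) ring_scheme \<Rightarrow> 'a set \<Rightarrow> 'a set \<Rightarrow> nat \<Rightarrow> 'a set" where
  "fiber_zero S M I = (\<lambda>n. M \<cdot>\<^bsub>S\<^esub> ideal_power S I n)"

definition fiber_scalar :: "('a, 'm) ring_scheme \<Rightarrow> 'a set \<Rightarrow> 'a set \<Rightarrow> 'a \<Rightarrow> nat \<Rightarrow> 'a set" where
  "fiber_scalar S M I a = (fiber_zero S M I)(0 := fiber_zero S M I 0 +>\<^bsub>S\<^esub> a)"

definition special_fiber_ring ::
  "('a, 'm) ring_scheme \<Rightarrow> 'a set \<Rightarrow> 'a set \<Rightarrow> (nat \<Rightarrow> 'a set) ring" where
  "special_fiber_ring S M I =
     \<lparr>carrier = {f. (\<forall>n. f n \<in> (\<lambda>a. fiber_zero S M I n +>\<^bsub>S\<^esub> a) ` ideal_power S I n) \<and>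
                    finite {n. f n \<noteq> fiber_zero S M I n}},
      monoid.mult = (\<lambda>f g n. \<Union>a\<in>(\<Pi> i\<in>{..n}. f i). \<Union>b\<in>(\<Pi> i\<in>{..n}. g i).
                fiber_zero S M I n +>\<^bsub>S\<^esub> (\<Oplus>\<^bsub>S\<^esub>i\<in>{..n}. a i \<otimes>\<^bsub>S\<^esub> b (n - i))),
      one = fiber_scalar S M I \<one>\<^bsub>S\<^esub>,
      zero = fiber_zero S M I,
      add = (\<lambda>f g n. f n <+>\<^bsub>S\<^esub> g n)\<rparr>"

definition fiber_ring :: "'v set \<Rightarrow> ('v, 'k::field) mpol set \<Rightarrow> (nat \<Rightarrow> ('v, 'k) mpol set) ring" where
  "fiber_ring V I = special_fiber_ring (polyring V) (max_hom_ideal V) I"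

definition fiber_field :: "'v set \<Rightarrow> ('v, 'k::field) mpol set \<Rightarrow> (nat \<Rightarrow> ('v, 'k) mpol set) set" where
  "fiber_field V I = range (\<lambda>c. fiber_scalar (polyring V) (max_hom_ideal V) I (pconst c))"

definition fiber_component ::
  "'v set \<Rightarrow> ('v, 'k::field) mpol set \<Rightarrow> nat \<Rightarrow> (nat \<Rightarrow> ('v, 'k) mpol set) set" where
  "fiber_component V I n =
     {f \<in> carrier (fiber_ring V I). \<forall>i. i \<noteq> n \<longrightarrow> f i = \<zero>\<^bsub>fiber_ring V I\<^esub> i}"

text \<open>The space \<open>I\<^sup>n/\<mm>I\<^sup>n\<close> is the degree \<open>n\<close> component of the special fiber ring, and \<open>k\<close> acts on it
  through its image in degree \<open>0\<close>.\<close>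

definition hilbert_function :: "'v set \<Rightarrow> ('v, 'k::field) mpol set \<Rightarrow> nat \<Rightarrow> nat" where
  "hilbert_function V I n = ring.dim (fiber_ring V I) (fiber_field V I) (fiber_component V I n)"

definition analytic_spread :: "'v set \<Rightarrow> ('v, 'k::field) mpol set \<Rightarrow> enat" where
  "analytic_spread V I = krull_dim (fiber_ring V I)"


section \<open>Castelnuovo--Mumford regularity\<close>

definition free_module :: "'v set \<Rightarrow> nat \<Rightarrow> ('v, 'k::field) mpol vec set" where
  "free_module V b = {x \<in> carrier_vec b. \<forall>i<b. x $ i \<in> carrier (polyring V)}"

definition homogeneous :: "'v set \<Rightarrow> nat \<Rightarrow> ('v, 'k::field) mpol \<Rightarrow> bool" where
  "homogeneous V d p \<longleftrightarrow> p \<in> carrier (polyring V) \<and> (\<forall>t\<in>Poly_Mapping.keys p. mdeg t = d)"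

text \<open>A minimal graded free resolution \<open>\<dots> \<rightarrow> F\<^sub>1 \<rightarrow> F\<^sub>0 \<rightarrow> J \<rightarrow> 0\<close> of a homogeneous ideal \<open>J\<close>, where
  \<open>F\<^sub>i\<close> has a basis of \<open>length (e i)\<close> elements, the \<open>c\<close>-th one of degree \<open>e i ! c\<close>. The matrix
  \<open>D 0\<close> has one row and represents the augmentation \<open>F\<^sub>0 \<rightarrow> J\<close>; \<open>D (Suc i)\<close> represents the
  differential \<open>F\<^sub>i\<^sub>+\<^sub>1 \<rightarrow> F\<^sub>i\<close>. All maps are homogeneous of degree \<open>0\<close>, so a nonzero entry in row
  \<open>r\<close> and column \<open>c\<close> has degree \<open>e (Suc i) ! c - e i ! r\<close>. For an ideal all the degrees of the basis
  elements are nonnegative.\<close>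

definition min_graded_free_resolution ::
  "'v set \<Rightarrow> ('v, 'k::field) mpol set \<Rightarrow> (nat \<Rightarrow> nat list) \<Rightarrow> (nat \<Rightarrow> ('v, 'k) mpol mat) \<Rightarrow> bool" where
  "min_graded_free_resolution V J e D \<longleftrightarrow>
     D 0 \<in> carrier_mat 1 (length (e 0)) \<and>
     (\<forall>i. D (Suc i) \<in> carrier_mat (length (e i)) (length (e (Suc i)))) \<and>
     (\<forall>c<length (e 0). homogeneous V (e 0 ! c) (D 0 $$ (0, c))) \<and>
     (\<forall>i. \<forall>r<length (e i). \<forall>c<length (e (Suc i)).
        D (Suc i) $$ (r, c) = 0 \<or>
        e i ! r \<le> e (Suc i) ! c \<and> homogeneous V (e (Suc i) ! c - e i ! r) (D (Suc i) $$ (r, c))) \<and>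
     (\<lambda>x. (D 0 *\<^sub>v x) $ 0) ` free_module V (length (e 0)) = J \<and>
     (\<forall>i. {x \<in> free_module V (length (e i)). D i *\<^sub>v x = 0\<^sub>v (dim_row (D i))}
          = (\<lambda>y. D (Suc i) *\<^sub>v y) ` free_module V (length (e (Suc i)))) \<and>
     (\<forall>i. \<forall>r<length (e i). \<forall>c<length (e (Suc i)). D (Suc i) $$ (r, c) \<in> max_hom_ideal V)"

text \<open>A nonzero homogeneous ideal is \<open>m\<close>-regular if in its minimal graded free resolution, which is
  unique up to isomorphism, the basis elements of \<open>F\<^sub>i\<close> have degree at most \<open>m + i\<close> for all \<open>i\<close>; its
  regularity is the least such \<open>m\<close>, which is the maximum of the numbers \<open>j - i\<close> such that \<open>F\<^sub>i\<close> has
  a basis element of degree \<open>j\<close>.\<close>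

definition m_regular :: "'v set \<Rightarrow> ('v, 'k::field) mpol set \<Rightarrow> nat \<Rightarrow> bool" where
  "m_regular V J m \<longleftrightarrow>
     (\<exists>e D. min_graded_free_resolution V J e D \<and> (\<forall>i. \<forall>d\<in>set (e i). d \<le> m + i))"

definition regularity :: "'v set \<Rightarrow> ('v, 'k::field) mpol set \<Rightarrow> nat" where
  "regularity V J = (LEAST m. m_regular V J m)"

end

theory Submission
  imports Defs "HOL-Library.List_Lexorder" "HOL-Computational_Algebra.Polynomial"
begin

text \<open>
  Outside \<open>P\<close> no product of two elements lies in \<open>P\<close>, and every product with a factor in \<open>P\<close> does.
  So two distinct nonzero elements are adjacent exactly if at least one of them lies in \<open>P\<close>, and the
  graph consists of a clique on \<open>P - {0}\<close>, an independent set \<open>R - P\<close>, and all edges between the two.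
  The sizes of the two pieces are \<open>|P| - 1\<close> and \<open>|R/P| |P| - |P|\<close>. Hence equal cardinalities
  of the ideals and of the quotients give isomorphic graphs
  (\<open>prime_ideal_graph_iso\<close>), the bijection of the vertices induces an isomorphism of polynomial rings
  that carries \<open>I\<close> onto \<open>I'\<close>, and everything that is defined by ring-theoretic means is
  transported along it. This yields all assertions except the value of the regularity.

  Two points need more than transport. A count of minimal monomial generators
  makes sense only because there is exactly one minimal set of them. As \<open>I\<^sup>n\<close> is generated in the
  single degree \<open>2n\<close>, this set consists of the monomials of that degree in \<open>I\<^sup>n\<close>
  (\<open>min_mon_gens_equigenerated\<close>). And prime ideals and dimensions in the special fiber ring can be
  compared only once it is known to be a commutative ring; it is the image of the Rees ring
  \<open>\<Oplus>\<^sub>n I\<^sup>n\<close> under the map that takes the coset of each component (\<open>rees_class_hom\<close>).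

  For the regularity, view the graph as complete multipartite: its parts are the single
  elements of \<open>P - {0}\<close> and the set \<open>R - P\<close>. The ideal \<open>I\<^sup>n\<close> is generated by those monomials of degree
  \<open>2n\<close> whose degree in the variables of each part is at most \<open>n\<close> (\<open>ideal_power_multipartite\<close>).
  These exponents satisfy an exchange property (\<open>power_exps_exchange\<close>), by which \<open>I\<^sup>n\<close> has linear
  quotients: in lexicographically decreasing order, the colon ideal of the earlier generators by the
  next one is generated by variables.

  An ideal generated in degree \<open>d\<close> with linear quotients has a linear resolution. The reason used here
  is that linear quotients pass to syzygies (\<open>syzygies_linear_quotients\<close>). If the colon ideal at the
  \<open>j\<close>-th generator is generated by the set of variables \<open>X\<^sub>j\<close>, then every \<open>x\<close> in \<open>X\<^sub>j\<close> gives a syzygy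
  with \<open>j\<close>-th coordinate \<open>x\<close> and with only linear forms at earlier positions and zeros at later ones.
  These syzygies generate the syzygy module. Ordered by \<open>j\<close> and then by \<open>x\<close>, they again have linear
  quotients: the colon ideal at \<open>(j, x)\<close> is generated by the earlier variables in \<open>X\<^sub>j\<close>, as a look at the
  \<open>j\<close>-th coordinate shows. Iteration produces a resolution all of whose differentials are matrices of
  linear forms, so it is minimal, and \<open>reg I\<^sup>n \<le> 2n\<close>. Conversely no nonzero ideal without elements in
  degrees below \<open>2n\<close> can have a smaller regularity (\<open>m_regular_lower\<close>).
\<close>

section \<open>Finitely supported functions as sums\<close>

lemma sum_single_keys:
  assumes "finite A" "Poly_Mapping.keys p \<subseteq> A"
  shows "(\<Sum>t\<in>A. Poly_Mapping.single t (Poly_Mapping.lookup p t)) = p"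
proof (rule poly_mapping_eqI)
  fix k
  have "Poly_Mapping.lookup (\<Sum>t\<in>A. Poly_Mapping.single t (Poly_Mapping.lookup p t)) k = (\<Sum>t\<in>A. if t = k then Poly_Mapping.lookup p t else 0)"
    unfolding lookup_sum by (rule sum.cong) (auto simp: lookup_single when_def)
  also have "\<dots> = Poly_Mapping.lookup p k"
    using assms by (auto simp: in_keys_iff)
  finally show "Poly_Mapping.lookup (\<Sum>t\<in>A. Poly_Mapping.single t (Poly_Mapping.lookup p t)) k = Poly_Mapping.lookup p k" .
qed

lemma poly_mapping_single_induct [case_names zero single add]:
  fixes p :: "'x \<Rightarrow>\<^sub>0 'c::comm_monoid_add"
  assumes "P 0" "\<And>t c. P (Poly_Mapping.single t c)" "\<And>p q. P p \<Longrightarrow> P q \<Longrightarrow> P (p + q)"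
  shows "P p"
proof -
  have "P (\<Sum>t\<in>A. Poly_Mapping.single t (Poly_Mapping.lookup p t))" if "finite A" for A
    using that by induction (auto intro: assms)
  from this[of "Poly_Mapping.keys p"] show ?thesis by (simp add: sum_single_keys)
qed

section \<open>Relabeling of exponents and polynomials\<close>

text \<open>The pushforward of a finitely supported function along \<open>h\<close>; values over the same point are added.
  It serves twice: along a map of variables it relabels exponents, and along such a relabeling of
  exponents it relabels polynomials.\<close>

definition push :: "('x \<Rightarrow> 'y) \<Rightarrow> ('x \<Rightarrow>\<^sub>0 'c::comm_monoid_add) \<Rightarrow> ('y \<Rightarrow>\<^sub>0 'c)" where
  "push h p = (\<Sum>t\<in>Poly_Mapping.keys p. Poly_Mapping.single (h t) (Poly_Mapping.lookup p t))"

lemma push_superset: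
  assumes "finite A" "Poly_Mapping.keys p \<subseteq> A"
  shows "push h p = (\<Sum>t\<in>A. Poly_Mapping.single (h t) (Poly_Mapping.lookup p t))"
  unfolding push_def using assms by (intro sum.mono_neutral_left) (auto simp: in_keys_iff)

lemma push_zero [simp]: "push h 0 = 0"
  by (simp add: push_def)

lemma push_single [simp]: "push h (Poly_Mapping.single t c) = Poly_Mapping.single (h t) c"
  by (subst push_superset[of "{t}"]) auto

lemma push_add: "push h (p + q) = push h p + push h q"
proof -
  let ?A = "Poly_Mapping.keys p \<union> Poly_Mapping.keys q"
  have "Poly_Mapping.keys (p + q) \<subseteq> ?A" by (rule keys_add)
  then show ?thesis
    by (simp add: push_superset[of ?A] lookup_add single_add sum.distrib)
qed

text \<open>By bilinearity this only has to be checked on monomials, where it is additivity of \<open>h\<close>.\<close>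

lemma push_mult:
  fixes p q :: "'x::monoid_add \<Rightarrow>\<^sub>0 'c::semiring_0"
  assumes "\<And>s t. h (s + t) = h s + (h t :: 'y::monoid_add)"
  shows "push h (p * q) = push h p * push h q"
proof (induction p rule: poly_mapping_single_induct)
  case (single s c)
  show ?case
    by (induction q rule: poly_mapping_single_induct)
      (auto simp: push_add distrib_left mult_single assms)
qed (auto simp: push_add distrib_right)

lemma push_push: "push g (push h p) = push (\<lambda>x. g (h x)) p"
  by (induction p rule: poly_mapping_single_induct) (auto simp: push_add)

lemma push_ident:
  assumes "\<And>t. t \<in> Poly_Mapping.keys p \<Longrightarrow> h t = t"
  shows "push h p = p"
  using sum_single_keys[of "Poly_Mapping.keys p" p] assms by (simp add: push_def)

lemma keys_push: "Poly_Mapping.keys (push h p) \<subseteq> h ` Poly_Mapping.keys p"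
  unfolding push_def by (rule order_trans[OF keys_sum]) (auto split: if_splits)

lemma mdeg_superset:
  assumes "finite A" "Poly_Mapping.keys t \<subseteq> A"
  shows "mdeg t = (\<Sum>v\<in>A. Poly_Mapping.lookup t v)"
  unfolding mdeg_def using assms by (intro sum.mono_neutral_left) (auto simp: in_keys_iff)

lemma mdeg_add [simp]: "mdeg (s + t) = mdeg s + mdeg t"
proof -
  let ?A = "Poly_Mapping.keys s \<union> Poly_Mapping.keys t"
  show ?thesis using keys_add[of s t]
    by (simp add: mdeg_superset[of ?A] lookup_add sum.distrib)
qed

lemma mdeg_zero [simp]: "mdeg 0 = 0" by (simp add: mdeg_def)

lemma mdeg_single [simp]: "mdeg (Poly_Mapping.single v n) = n"
  by (subst mdeg_superset[of "{v}"]) auto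

lemma mdeg_eq_0_iff [simp]: "mdeg t = 0 \<longleftrightarrow> t = 0"
proof
  assume "mdeg t = 0"
  then show "t = 0" by (intro poly_mapping_eqI) (auto simp: mdeg_def in_keys_iff)
qed simp

section \<open>Polynomial rings and their monomial ideals\<close>

text \<open>The ideal of \<open>k[V]\<close> generated by the monomials with exponents in \<open>E\<close> is described by its membership
  test: each monomial of a member is a multiple of a generator.\<close>

definition exps :: "'v set \<Rightarrow> ('v \<Rightarrow>\<^sub>0 nat) set" where
  "exps V = {t. Poly_Mapping.keys t \<subseteq> V}"

definition monid :: "'v set \<Rightarrow> ('v \<Rightarrow>\<^sub>0 nat) set \<Rightarrow> ('v, 'k::field) mpol set" where
  "monid V E = {p. Poly_Mapping.keys p \<subseteq> {e + s | e s. e \<in> E \<and> s \<in> exps V}}"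

lemma polyring_simps [simp]:
  "x \<otimes>\<^bsub>polyring V\<^esub> y = x * y" "x \<oplus>\<^bsub>polyring V\<^esub> y = x + y"
  "\<one>\<^bsub>polyring V\<^esub> = 1" "\<zero>\<^bsub>polyring V\<^esub> = 0"
  by (simp_all add: polyring_def)

lemma exps_add [simp, intro]: "s \<in> exps V \<Longrightarrow> t \<in> exps V \<Longrightarrow> s + t \<in> exps V"
  using keys_add[of s t] by (auto simp: exps_def)

lemma exps_zero [simp, intro]: "0 \<in> exps V" by (simp add: exps_def)

lemma exps_single [simp]: "Poly_Mapping.single v n \<in> exps V \<longleftrightarrow> n = 0 \<or> v \<in> V"
  by (auto simp: exps_def)

text \<open>Exponents cannot cancel, so a divisor of a monomial in the variables \<open>V\<close> involves only these
  variables.\<close>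

lemma exps_add_iff: "s + t \<in> exps V \<longleftrightarrow> s \<in> exps V \<and> t \<in> exps V"
  by (auto simp: exps_def in_keys_iff lookup_add subset_iff)

lemma in_polyring_iff: "p \<in> carrier (polyring V) \<longleftrightarrow> Poly_Mapping.keys p \<subseteq> exps V"
  by (auto simp: polyring_def exps_def)

lemma polyring_closed [simp, intro]:
  fixes p q :: "('v, 'k::field) mpol"
  shows
  "0 \<in> carrier (polyring V)" "1 \<in> carrier (polyring V)"
  "p \<in> carrier (polyring V) \<Longrightarrow> q \<in> carrier (polyring V) \<Longrightarrow> p + q \<in> carrier (polyring V)"
  "p \<in> carrier (polyring V) \<Longrightarrow> q \<in> carrier (polyring V) \<Longrightarrow> p * q \<in> carrier (polyring V)"
  "p \<in> carrier (polyring V) \<Longrightarrow> - p \<in> carrier (polyring V)"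
  "p \<in> carrier (polyring V) \<Longrightarrow> q \<in> carrier (polyring V) \<Longrightarrow> p - q \<in> carrier (polyring V)"
proof -
  note a = keys_add[of p q] keys_mult[of p q]
  show "p + q \<in> carrier (polyring V)" "p * q \<in> carrier (polyring V)"
    if "p \<in> carrier (polyring V)" "q \<in> carrier (polyring V)"
    using that a by (auto simp: in_polyring_iff subset_iff)
  show m: "- q \<in> carrier (polyring V)" if "q \<in> carrier (polyring V)" for q :: "('v, 'k) mpol"
    using that by (auto simp: in_polyring_iff in_keys_iff subset_iff)
  show "p - q \<in> carrier (polyring V)" if "p \<in> carrier (polyring V)" "q \<in> carrier (polyring V)"
    using that m[of q] keys_add[of p "-q"] by (auto simp: in_polyring_iff subset_iff)
qed (auto simp: in_polyring_iff)

lemma polyring_single [simp]: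
  "Poly_Mapping.single t c \<in> carrier (polyring V) \<longleftrightarrow> c = 0 \<or> t \<in> exps V"
  by (simp add: in_polyring_iff)

lemma polyring_sum:
  "(\<And>i. i \<in> A \<Longrightarrow> f i \<in> carrier (polyring V)) \<Longrightarrow> sum f A \<in> carrier (polyring V)"
  by (induction A rule: infinite_finite_induct) auto

lemma polyring_cring: "cring (polyring V :: ('v, 'k::field) mpol ring)"
proof (rule cringI)
  show "abelian_group (polyring V :: ('v, 'k) mpol ring)"
  proof (rule abelian_groupI)
    fix x :: "('v, 'k) mpol" assume "x \<in> carrier (polyring V)"
    then show "\<exists>y\<in>carrier (polyring V). y \<oplus>\<^bsub>polyring V\<^esub> x = \<zero>\<^bsub>polyring V\<^esub>"
      by (intro bexI[of _ "-x"]) auto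
  qed (auto simp: algebra_simps)
  show "comm_monoid (polyring V :: ('v, 'k) mpol ring)"
    by (rule comm_monoidI) (auto simp: algebra_simps)
qed (auto simp: algebra_simps)

lemma polyring_finsum:
  assumes "finite A" "\<And>i. i \<in> A \<Longrightarrow> f i \<in> carrier (polyring V)"
  shows "(\<Oplus>\<^bsub>polyring V\<^esub>i\<in>A. f i) = (\<Sum>i\<in>A. f i :: ('v, 'k::field) mpol)"
proof -
  interpret cring "polyring V :: ('v, 'k) mpol ring" by (rule polyring_cring)
  show ?thesis using assms
    by (induction A rule: finite_induct) (auto simp: finsum_insert Pi_def)
qed

lemma polyring_minus: "x \<in> carrier (polyring V) \<Longrightarrow> \<ominus>\<^bsub>polyring V\<^esub> x = - (x :: ('v, 'k::field) mpol)"
proof -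
  interpret cring "polyring V :: ('v, 'k) mpol ring" by (rule polyring_cring)
  assume "x \<in> carrier (polyring V)"
  then show ?thesis by (intro minus_equality) auto
qed

lemma monid_zero [simp]: "0 \<in> monid V E" by (simp add: monid_def)

lemma monid_add: "p \<in> monid V E \<Longrightarrow> q \<in> monid V E \<Longrightarrow> p + q \<in> monid V E"
  using keys_add[of p q] unfolding monid_def by blast

lemma monid_sum: "(\<And>i. i \<in> A \<Longrightarrow> f i \<in> monid V E) \<Longrightarrow> sum f A \<in> monid V E"
  by (induction A rule: infinite_finite_induct) (auto intro: monid_add)

lemma monid_mult:
  assumes "p \<in> monid V E" "q \<in> monid V F"
  shows "p * q \<in> monid V {e + f | e f. e \<in> E \<and> f \<in> F}"
  unfolding monid_def
proof clarify
  fix x assume "x \<in> Poly_Mapping.keys (p * q)"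
  then obtain a b where ab: "a \<in> Poly_Mapping.keys p" "b \<in> Poly_Mapping.keys q" "x = a + b"
    using keys_mult[of p q] by auto
  then obtain e s f u where "a = e + s" "e \<in> E" "s \<in> exps V" "b = f + u" "f \<in> F" "u \<in> exps V"
    using assms by (fastforce simp: monid_def)
  then have "x = (e + f) + (s + u)" "s + u \<in> exps V" using ab by (auto simp: algebra_simps)
  then show "\<exists>e s. x = e + s \<and> e \<in> {e + f |e f. e \<in> E \<and> f \<in> F} \<and> s \<in> exps V"
    using \<open>e \<in> E\<close> \<open>f \<in> F\<close> by blast
qed

lemma monid_polyring: "E \<subseteq> exps V \<Longrightarrow> monid V E \<subseteq> carrier (polyring V)"
  by (fastforce simp: monid_def in_polyring_iff)

lemma monid_whole: "monid V {0} = carrier (polyring V)"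
  by (auto simp: monid_def in_polyring_iff)

lemma monid_mult_left:
  assumes "p \<in> monid V E" "q \<in> carrier (polyring V)"
  shows "q * p \<in> monid V E"
proof -
  have "q \<in> monid V {0}" using assms by (simp add: monid_whole)
  from monid_mult[OF this assms(1)] show ?thesis by simp
qed

lemma monid_uminus: "p \<in> monid V E \<Longrightarrow> - p \<in> monid V E"
  by (auto simp: monid_def in_keys_iff subset_iff)

lemma monid_single: "Poly_Mapping.single t c \<in> monid V E \<longleftrightarrow> c = 0 \<or> (\<exists>e\<in>E. \<exists>s\<in>exps V. t = e + s)"
  by (auto simp: monid_def)

lemma monid_ideal:
  assumes "E \<subseteq> exps V"
  shows "ideal (monid V E :: ('v, 'k::field) mpol set) (polyring V)"
proof -
  interpret cring "polyring V :: ('v, 'k) mpol ring" by (rule polyring_cring)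
  show ?thesis
  proof (rule idealI)
    show "ring (polyring V :: ('v, 'k) mpol ring)" by (rule ring_axioms)
    show "subgroup (monid V E :: ('v, 'k) mpol set) (add_monoid (polyring V))"
    proof (rule add.subgroupI)
      show "monid V E \<subseteq> carrier (polyring V)" by (rule monid_polyring[OF assms])
      show "monid V E \<noteq> {}" using monid_zero by blast
      fix a :: "('v, 'k) mpol" assume "a \<in> monid V E"
      moreover from this have "a \<in> carrier (polyring V)" using monid_polyring[OF assms] by blast
      ultimately show "\<ominus>\<^bsub>polyring V\<^esub> a \<in> monid V E" by (simp add: polyring_minus monid_uminus)
    qed (auto intro: monid_add)
    fix a x :: "('v, 'k) mpol" assume "a \<in> monid V E" "x \<in> carrier (polyring V)"
    then have "x * a \<in> monid V E" by (rule monid_mult_left)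
    then show "x \<otimes>\<^bsub>polyring V\<^esub> a \<in> monid V E" "a \<otimes>\<^bsub>polyring V\<^esub> x \<in> monid V E"
      by (simp_all add: mult.commute)
  qed
qed

lemma monid_genideal:
  assumes "E \<subseteq> exps V"
  shows "Idl\<^bsub>polyring V\<^esub> ((\<lambda>e. Poly_Mapping.single e 1) ` E) = (monid V E :: ('v, 'k::field) mpol set)"
    (is "Idl\<^bsub>_\<^esub> ?G = _")
proof -
  interpret cring "polyring V :: ('v, 'k) mpol ring" by (rule polyring_cring)
  have G: "?G \<subseteq> carrier (polyring V)" using assms by auto
  interpret J: ideal "Idl\<^bsub>polyring V\<^esub> ?G" "polyring V" by (rule genideal_ideal[OF G])
  show ?thesis
  proof
    have "?G \<subseteq> monid V E"
      using exps_zero[of V] by (force simp: monid_single)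
    then show "Idl\<^bsub>polyring V\<^esub> ?G \<subseteq> monid V E"
      by (rule genideal_minimal[OF monid_ideal[OF assms]])
    show "monid V E \<subseteq> Idl\<^bsub>polyring V\<^esub> ?G"
    proof
      fix p :: "('v, 'k) mpol" assume p: "p \<in> monid V E"
      have t: "Poly_Mapping.single t (Poly_Mapping.lookup p t) \<in> Idl\<^bsub>polyring V\<^esub> ?G" if tp: "t \<in> Poly_Mapping.keys p" for t
      proof -
        obtain e s where es: "t = e + s" "e \<in> E" "s \<in> exps V"
          using p tp unfolding monid_def by blast
        have "Poly_Mapping.single e 1 \<in> Idl\<^bsub>polyring V\<^esub> ?G"
          using genideal_self[OF G] es(2) by auto
        from J.I_l_closed[OF this, of "Poly_Mapping.single s (Poly_Mapping.lookup p t)"] es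
        show ?thesis by (simp add: mult_single add.commute)
      qed
      have "sum (\<lambda>t. Poly_Mapping.single t (Poly_Mapping.lookup p t)) A \<in> Idl\<^bsub>polyring V\<^esub> ?G"
        if "finite A" "A \<subseteq> Poly_Mapping.keys p" for A
        using that
      proof (induction A)
        case empty
        show ?case using J.zero_closed by simp
      next
        case (insert x F)
        then show ?case using J.a_closed[of "Poly_Mapping.single x (Poly_Mapping.lookup p x)"] t by simp
      qed
      from this[of "Poly_Mapping.keys p"] show "p \<in> Idl\<^bsub>polyring V\<^esub> ?G"
        by (simp add: sum_single_keys)
    qed
  qed
qed

text \<open>For the nontrivial inclusion, a product of two generating monomials lies in the product ideal, and
  such products generate the right hand side.\<close>

lemma monid_prod:
  assumes "E \<subseteq> exps V" "F \<subseteq> exps V"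
  shows "(monid V E :: ('v, 'k::field) mpol set) \<cdot>\<^bsub>polyring V\<^esub> monid V F
    = monid V {e + f | e f. e \<in> E \<and> f \<in> F}" (is "?L = ?R")
proof
  show "?L \<subseteq> ?R"
  proof
    fix p assume "p \<in> ?L"
    then show "p \<in> ?R"
      by induction (auto intro: monid_mult monid_add)
  qed
  interpret cring "polyring V :: ('v, 'k) mpol ring" by (rule polyring_cring)
  interpret J: ideal ?L "polyring V"
    by (intro ideal_prod_is_ideal monid_ideal assms)
  have "(\<lambda>e. Poly_Mapping.single e 1) ` {e + f | e f. e \<in> E \<and> f \<in> F} \<subseteq> ?L"
  proof clarify
    fix e f assume "e \<in> E" "f \<in> F"
    then have "Poly_Mapping.single e 1 \<in> monid V E" "Poly_Mapping.single f 1 \<in> monid V F"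
      using exps_zero[of V] by (force simp: monid_single)+
    from ideal_prod.prod[OF this, of "polyring V"]
    show "Poly_Mapping.single (e + f) 1 \<in> ?L" by (simp add: mult_single)
  qed
  from genideal_minimal[OF J.is_ideal this] show "?R \<subseteq> ?L"
    using assms by (subst (asm) monid_genideal) auto
qed

lemma ideal_power_0 [simp]: "ideal_power S J 0 = carrier S"
  by (simp add: ideal_power_def ideals_set_def nat_pow_def)

lemma ideal_power_Suc [simp]: "ideal_power S J (Suc n) = ideal_power S J n \<cdot>\<^bsub>S\<^esub> J"
  by (simp add: ideal_power_def ideals_set_def nat_pow_def)

lemma max_hom_ideal_monid:
  "max_hom_ideal V = (monid V ((\<lambda>v. Poly_Mapping.single v 1) ` V) :: ('v, 'k::field) mpol set)"
  unfolding max_hom_ideal_def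
  by (subst monid_genideal[symmetric]) (auto simp: pvar_def image_image)

section \<open>Linear quotients\<close>

text \<open>Elements of a free module are functions on the natural numbers that vanish from the rank on.
  So an element of \<open>S\<^sup>r\<close> is also an element of \<open>S\<^sup>r\<^sup>+\<^sup>1\<close>, and generators can be appended
  to a list without any change to the syzygies found before.\<close>

definition comb :: "(nat \<Rightarrow> 'r::comm_ring_1) list \<Rightarrow> (nat \<Rightarrow> 'r) \<Rightarrow> nat \<Rightarrow> 'r" where
  "comb gs y k = (\<Sum>i<length gs. y i * (gs ! i) k)"

definition spanned :: "'v set \<Rightarrow> (nat \<Rightarrow> ('v, 'k::field) mpol) list \<Rightarrow> (nat \<Rightarrow> ('v, 'k) mpol) set" where
  "spanned V gs = {comb gs y | y. \<forall>i. y i \<in> carrier (polyring V)}"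

definition syzygies :: "'v set \<Rightarrow> (nat \<Rightarrow> ('v, 'k::field) mpol) list \<Rightarrow> (nat \<Rightarrow> ('v, 'k) mpol) set" where
  "syzygies V gs = {y. (\<forall>i. y i \<in> carrier (polyring V)) \<and> (\<forall>i\<ge>length gs. y i = 0) \<and> (\<forall>k. comb gs y k = 0)}"

definition var_ideal :: "'v set \<Rightarrow> 'v set \<Rightarrow> ('v, 'k::field) mpol set" where
  "var_ideal V X = monid V ((\<lambda>v. Poly_Mapping.single v 1) ` X)"

text \<open>A list of homogeneous elements of degree \<open>d\<close> such that the colon ideal of the span of the earlier
  ones by the next one is always generated by a set \<open>X\<close> of variables.\<close>

inductive linear_quotients :: "'v set \<Rightarrow> nat \<Rightarrow> (nat \<Rightarrow> ('v, 'k::field) mpol) list \<Rightarrow> bool" for V d where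
  Nil: "linear_quotients V d []"
| snoc: "linear_quotients V d gs \<Longrightarrow> (\<And>k. homogeneous V d (g k)) \<Longrightarrow> X \<subseteq> V \<Longrightarrow>
     (\<And>f. f \<in> carrier (polyring V) \<Longrightarrow> (\<lambda>k. f * g k) \<in> spanned V gs \<longleftrightarrow> f \<in> var_ideal V X) \<Longrightarrow>
     linear_quotients V d (gs @ [g])"

lemma linear_quotients_homogeneous:
  "linear_quotients V d gs \<Longrightarrow> g \<in> set gs \<Longrightarrow> homogeneous V d (g k)"
  by (induction rule: linear_quotients.induct) auto

lemma homogeneous_carrier: "homogeneous V d p \<Longrightarrow> p \<in> carrier (polyring V)"
  by (simp add: homogeneous_def)

lemma comb_snoc: "comb (gs @ [g]) y k = comb gs y k + y (length gs) * g k"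
  by (simp add: comb_def nth_append)

lemma comb_cong: "(\<And>i. i < length gs \<Longrightarrow> y i = z i) \<Longrightarrow> comb gs y k = comb gs z k"
  unfolding comb_def by (rule sum.cong) auto

lemma comb_linear:
  "comb gs (\<lambda>i. a * y i + b * z i) k = a * comb gs y k + b * comb gs z k"
  by (simp add: comb_def sum.distrib sum_distrib_left algebra_simps)

lemma comb_diff: "comb gs (\<lambda>i. y i - a * z i) k = comb gs y k - a * comb gs z k"
  using comb_linear[of gs 1 y "-a" z k] by simp

lemma comb_uminus: "comb gs (\<lambda>i. - y i) k = - comb gs y k"
  by (simp add: comb_def sum_negf)

lemma spannedI: "(\<And>i. y i \<in> carrier (polyring V)) \<Longrightarrow> comb gs y \<in> spanned V gs"
  by (auto simp: spanned_def)

lemma spanned_snoc: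
  "h \<in> spanned V (gs @ [g]) \<longleftrightarrow>
     (\<exists>a\<in>carrier (polyring V). \<exists>w\<in>spanned V gs. h = (\<lambda>k. w k + a * g k))" (is "?L \<longleftrightarrow> ?R")
proof
  assume ?L
  then obtain y where y: "h = comb (gs @ [g]) y" "\<And>i. y i \<in> carrier (polyring V)"
    by (auto simp: spanned_def)
  show ?R
    by (rule bexI[of _ "y (length gs)"], rule bexI[of _ "comb gs y"])
      (auto simp: y comb_snoc fun_eq_iff intro: spannedI)
next
  assume ?R
  then obtain a y where a: "a \<in> carrier (polyring V)" "\<And>i. y i \<in> carrier (polyring V)"
    "h = (\<lambda>k. comb gs y k + a * g k)" by (auto simp: spanned_def)
  have "h = comb (gs @ [g]) (y(length gs := a))"
    unfolding a comb_snoc fun_eq_iff using comb_cong[of gs y "y(length gs := a)"] by simp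
  then show ?L using a by (auto intro!: spannedI)
qed

lemma spanned_Nil: "spanned V [] = {\<lambda>k. 0}"
proof -
  have "comb [] y = (\<lambda>k. 0)" for y :: "nat \<Rightarrow> ('a, 'b) mpol" by (auto simp: comb_def)
  then show ?thesis by (auto simp: spanned_def intro!: exI[of _ "\<lambda>_. 0"])
qed

text \<open>The homogeneous component of degree \<open>d\<close>.\<close>

definition hom_part :: "nat \<Rightarrow> ('v, 'k::field) mpol \<Rightarrow> ('v, 'k) mpol" where
  "hom_part d p = Poly_Mapping.mapp (\<lambda>t c. c when mdeg t = d) p"

lemma lookup_hom_part: "Poly_Mapping.lookup (hom_part d p) t = (Poly_Mapping.lookup p t when mdeg t = d)"
  by (simp add: hom_part_def lookup_mapp in_keys_iff when_def)

lemma hom_part_add: "hom_part d (p + q) = hom_part d p + hom_part d q"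
  by (rule poly_mapping_eqI) (simp add: lookup_hom_part lookup_add when_add_distrib)

lemma hom_part_zero [simp]: "hom_part d 0 = 0"
  by (rule poly_mapping_eqI) (simp add: lookup_hom_part)

lemma hom_part_sum: "hom_part d (sum f A) = (\<Sum>i\<in>A. hom_part d (f i))"
  by (induction A rule: infinite_finite_induct) (auto simp: hom_part_add)

lemma hom_part_carrier: "p \<in> carrier (polyring V) \<Longrightarrow> homogeneous V d (hom_part d p)"
  by (auto simp: homogeneous_def in_polyring_iff in_keys_iff lookup_hom_part)

lemma hom_part_homogeneous: "homogeneous V d p \<Longrightarrow> hom_part d p = p"
  by (rule poly_mapping_eqI) (auto simp: homogeneous_def lookup_hom_part in_keys_iff when_def)

lemma homogeneous_zero [simp]: "homogeneous V d 0"
  by (simp add: homogeneous_def)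

lemma homogeneous_uminus: "homogeneous V d p \<Longrightarrow> homogeneous V d (- p)"
  by (auto simp: homogeneous_def in_keys_iff)

lemma homogeneous_mult: 
  assumes "homogeneous V d p" "homogeneous V e q"
  shows "homogeneous V (d + e) (p * q)"
  using assms keys_mult[of p q] by (fastforce simp: homogeneous_def)

lemma hom_part_mult:
  assumes "homogeneous V d q"
  shows "hom_part (e + d) (p * q) = hom_part e p * q"
proof (induction p rule: poly_mapping_single_induct)
  case (single t c)
  have k: "mdeg s = mdeg t + d" if "s \<in> Poly_Mapping.keys (Poly_Mapping.single t c * q)" for s
    using that keys_mult[of "Poly_Mapping.single t c" q] assms
    by (auto simp: homogeneous_def split: if_splits)
  have "hom_part e (Poly_Mapping.single t c) = (Poly_Mapping.single t c when mdeg t = e)"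
    by (rule poly_mapping_eqI) (auto simp: lookup_hom_part lookup_single when_def)
  moreover have "hom_part (e + d) (Poly_Mapping.single t c * q) = (Poly_Mapping.single t c * q when mdeg t = e)"
    by (rule poly_mapping_eqI) (use k in \<open>force simp: lookup_hom_part when_def in_keys_iff\<close>)
  ultimately show ?case by (simp add: when_def)
qed (auto simp: hom_part_add distrib_right)

lemma pvar_homogeneous: "v \<in> V \<Longrightarrow> homogeneous V 1 (pvar v)"
  by (auto simp: homogeneous_def pvar_def)

text \<open>In a relation that expresses \<open>x g\<close> by elements of the same degree as \<open>g\<close>, all but the linear parts of
  the coefficients cancel.\<close>

lemma linear_relation:
  assumes hom: "\<And>g k. g \<in> set gs \<Longrightarrow> homogeneous V d (g k)" and g: "\<And>k. homogeneous V d (g k)"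
    and x: "x \<in> V" and sp: "(\<lambda>k. pvar x * g k) \<in> spanned V gs"
  shows "\<exists>h. (\<forall>i. homogeneous V 1 (h i)) \<and> comb gs h = (\<lambda>k. pvar x * g k)"
proof -
  obtain y where y: "\<And>i. y i \<in> carrier (polyring V)" "\<And>k. comb gs y k = pvar x * g k"
    using sp unfolding spanned_def fun_eq_iff by (smt (verit) mem_Collect_eq)
  have "comb gs (\<lambda>i. hom_part 1 (y i)) k = pvar x * g k" for k
  proof -
    have "pvar x * g k = hom_part (1 + d) (comb gs y k)"
      using homogeneous_mult[OF pvar_homogeneous[OF x] g[of k]] by (simp add: y hom_part_homogeneous)
    also have "\<dots> = comb gs (\<lambda>i. hom_part 1 (y i)) k"
      unfolding comb_def hom_part_sum
      by (intro sum.cong refl hom_part_mult[of V]) (auto intro: hom)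
    finally show ?thesis ..
  qed
  then show ?thesis by (intro exI[of _ "\<lambda>i. hom_part 1 (y i)"]) (auto intro: hom_part_carrier y(1))
qed

lemma var_ideal_empty [simp]: "var_ideal V {} = {0}"
  by (auto simp: var_ideal_def monid_def)

lemma var_ideal_iff:
  assumes "X \<subseteq> V"
  shows "p \<in> var_ideal V X \<longleftrightarrow> p \<in> carrier (polyring V) \<and> (\<forall>t\<in>Poly_Mapping.keys p. \<exists>v\<in>X. Poly_Mapping.lookup t v \<noteq> 0)"
proof -
  have "(\<exists>e s. t = e + s \<and> e \<in> (\<lambda>v. Poly_Mapping.single v 1) ` X \<and> s \<in> exps V) \<longleftrightarrow>
      t \<in> exps V \<and> (\<exists>v\<in>X. Poly_Mapping.lookup t v \<noteq> 0)" (is "?L \<longleftrightarrow> ?R") for t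
  proof
    assume ?L
    then obtain v s where "t = Poly_Mapping.single v 1 + s" "v \<in> X" "s \<in> exps V" by auto
    then show ?R using assms by (auto simp: lookup_add intro!: bexI[of _ v])
  next
    assume ?R
    then obtain v where v: "v \<in> X" "Poly_Mapping.lookup t v \<noteq> 0" "t \<in> exps V" by auto
    have eq: "t = Poly_Mapping.single v 1 + (t - Poly_Mapping.single v 1)"
      by (rule poly_mapping_eqI) (use v in \<open>auto simp: lookup_add lookup_minus lookup_single when_def\<close>)
    then have "t - Poly_Mapping.single v 1 \<in> exps V" using v(3) exps_add_iff by metis
    then show ?L using eq v by blast
  qed
  then show ?thesis by (auto simp: var_ideal_def monid_def in_polyring_iff)
qed

text \<open>Without collisions nothing is added up, so the coefficients are merely moved. For multiplication by a
  monomial, which shifts all exponents, this means that no cancellation occurs.\<close>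

lemma push_lookup_inj:
  assumes "inj h"
  shows "Poly_Mapping.lookup (push h f) (h t) = Poly_Mapping.lookup f t"
  using assms by (induction f rule: poly_mapping_single_induct)
    (auto simp: push_add lookup_add lookup_single when_def inj_eq)

lemma keys_times_monomial:
  fixes f :: "('v, 'k::field) mpol"
  shows "Poly_Mapping.keys (f * Poly_Mapping.single t 1) = (\<lambda>u. u + t) ` Poly_Mapping.keys f"
proof -
  have f: "f * Poly_Mapping.single t 1 = push (\<lambda>u. u + t) f"
    by (induction f rule: poly_mapping_single_induct) (auto simp: push_add distrib_right mult_single)
  have "inj (\<lambda>u. u + t)" by (simp add: inj_on_def)
  then show ?thesis
    unfolding f using keys_push[of "\<lambda>u. u + t" f] push_lookup_inj[of "\<lambda>u. u + t" f]
    by (force simp: in_keys_iff)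
qed

text \<open>Ideals generated by variables are prime and contain no further variable.\<close>

lemma var_ideal_pvar_mult:
  assumes "X \<subseteq> V" "x \<in> V" "x \<notin> X" "f \<in> carrier (polyring V)"
  shows "f * pvar x \<in> var_ideal V X \<longleftrightarrow> f \<in> var_ideal V X"
proof -
  have "Poly_Mapping.lookup (t + Poly_Mapping.single x 1) v = Poly_Mapping.lookup t v" if "v \<in> X" for v and t :: "'a \<Rightarrow>\<^sub>0 nat"
    using that assms(3) by (auto simp: lookup_add lookup_single when_def)
  moreover have "f * pvar x \<in> carrier (polyring V)" using assms by (auto simp: pvar_def)
  ultimately show ?thesis
    using assms(4) by (simp add: var_ideal_iff[OF assms(1)] pvar_def keys_times_monomial)
qed

text \<open>Split \<open>p\<close> into the monomials that are multiples of \<open>t\<close> and the others, which must be multiples of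
  elements of \<open>T\<close>.\<close>

lemma monid_insert:
  assumes "insert t T \<subseteq> exps V" "p \<in> monid V (insert t T)"
  shows "\<exists>a\<in>carrier (polyring V). \<exists>c\<in>monid V T. p = a * Poly_Mapping.single t 1 + c"
proof -
  define A where "A = {u \<in> Poly_Mapping.keys p. \<exists>s\<in>exps V. u = t + s}"
  define a where "a = (\<Sum>u\<in>A. Poly_Mapping.single (u - t) (Poly_Mapping.lookup p u))"
  define c where "c = (\<Sum>u\<in>Poly_Mapping.keys p - A. Poly_Mapping.single u (Poly_Mapping.lookup p u))"
  have "a * Poly_Mapping.single t 1 = (\<Sum>u\<in>A. Poly_Mapping.single u (Poly_Mapping.lookup p u))"
    unfolding a_def sum_distrib_right mult_single
    by (intro sum.cong refl) (auto simp: A_def add.commute)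
  moreover have "(\<Sum>u\<in>A. Poly_Mapping.single u (Poly_Mapping.lookup p u)) + c = p"
    unfolding c_def using sum.subset_diff[of A "Poly_Mapping.keys p" "\<lambda>u. Poly_Mapping.single u (Poly_Mapping.lookup p u)"]
    by (simp add: sum_single_keys A_def add.commute)
  ultimately have "p = a * Poly_Mapping.single t 1 + c" by simp
  moreover have "a \<in> carrier (polyring V)"
    unfolding a_def by (rule polyring_sum) (auto simp: A_def)
  moreover have "c \<in> monid V T"
    unfolding c_def
  proof (rule monid_sum)
    fix u assume "u \<in> Poly_Mapping.keys p - A"
    then have "u \<in> {e + s | e s. e \<in> insert t T \<and> s \<in> exps V}" "\<not> (\<exists>s\<in>exps V. u = t + s)"
      using assms(2) by (auto simp: A_def monid_def)
    then show "Poly_Mapping.single u (Poly_Mapping.lookup p u) \<in> monid V T" unfolding monid_single by blast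
  qed
  ultimately show ?thesis by blast
qed

lemma var_ideal_insert:
  assumes "insert x X \<subseteq> V" "p \<in> var_ideal V (insert x X)"
  shows "\<exists>a\<in>carrier (polyring V). \<exists>c\<in>var_ideal V X. p = a * pvar x + c"
  using assms monid_insert[of "Poly_Mapping.single x 1" "(\<lambda>v. Poly_Mapping.single v 1) ` X" V p]
  unfolding var_ideal_def pvar_def by (auto simp: image_subset_iff)

lemma var_ideal_carrier: "X \<subseteq> V \<Longrightarrow> p \<in> var_ideal V X \<Longrightarrow> p \<in> carrier (polyring V)"
  by (simp add: var_ideal_iff)

lemma pvar_in_var_ideal: "x \<in> X \<Longrightarrow> X \<subseteq> V \<Longrightarrow> pvar x \<in> var_ideal V X"
  by (auto simp: var_ideal_iff pvar_def lookup_single intro!: bexI[of _ x])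

text \<open>The induction follows the list of generators. Let \<open>g\<close> be the last of them, \<open>X\<close> the variables that
  generate the colon ideal at \<open>g\<close>, and \<open>r\<close> the position of \<open>g\<close>. A syzygy is determined modulo the syzygies of the
  earlier generators by its coordinate at \<open>r\<close>, which ranges over the ideal generated by \<open>X\<close>. Adding for
  each \<open>x \<in> X\<close> a syzygy with coordinate \<open>x\<close> at \<open>r\<close> therefore exhausts all of them. The colon ideal of
  the syzygies so far by the new one can be read off from the coordinate at \<open>r\<close>: it is the colon
  ideal of the previous variables by \<open>x\<close>, which is generated by these variables.\<close>

lemma syzygies_linear_quotients:
  assumes "finite V" "linear_quotients V d gs"
  shows "\<exists>hs. linear_quotients V 1 hs \<and> spanned V hs = syzygies V gs"
  using assms(2)
proof (induction rule: linear_quotients.induct)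
  case Nil
  have "syzygies V ([] :: (nat \<Rightarrow> ('a, 'b) mpol) list) = {\<lambda>_. 0}"
    by (auto simp: syzygies_def comb_def)
  then show ?case using linear_quotients.Nil spanned_Nil by blast
next
  case (snoc gs g X)
  obtain hs where hs: "linear_quotients V 1 hs" "spanned V hs = syzygies V gs" using snoc.IH by auto
  let ?r = "length gs" and ?P = "carrier (polyring V)"
  have XV: "X \<subseteq> V" by (rule snoc.hyps)
  have "\<exists>h. (\<forall>i. homogeneous V 1 (h i)) \<and> comb gs h = (\<lambda>k. pvar x * g k)" if "x \<in> X" for x
  proof (rule linear_relation)
    show "x \<in> V" using that XV by auto
    show "(\<lambda>k. pvar x * g k) \<in> spanned V gs"
      using snoc.hyps(4)[of "pvar x"] pvar_in_var_ideal[OF that XV] var_ideal_carrier[OF XV] by blast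
  qed (use snoc.hyps linear_quotients_homogeneous in auto)
  then obtain H where H: "\<And>x i. x \<in> X \<Longrightarrow> homogeneous V 1 (H x i)"
    "\<And>x. x \<in> X \<Longrightarrow> comb gs (H x) = (\<lambda>k. pvar x * g k)"
    by metis
  define s where "s x i = (if i < ?r then - H x i else if i = ?r then pvar x else 0)" for x i
  have s_hom: "homogeneous V 1 (s x i)" if "x \<in> X" for x i
    using that H(1) pvar_homogeneous[of x V] XV by (auto simp: s_def intro: homogeneous_uminus)
  have s_carrier: "s x i \<in> ?P" if "x \<in> X" for x i
    using homogeneous_carrier[OF s_hom[OF that]] .
  have s_syz: "comb (gs @ [g]) (s x) k = 0" if "x \<in> X" for x k
  proof -
    have "comb gs (s x) k = comb gs (\<lambda>i. - H x i) k"
      by (rule comb_cong) (simp add: s_def)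
    then show ?thesis using that by (simp add: comb_snoc comb_uminus H s_def)
  qed
  \<comment> \<open>The syzygies that are generated once the variables in \<open>Y\<close> have been treated.\<close>
  define W where "W Y = {y \<in> syzygies V (gs @ [g]). y ?r \<in> var_ideal V Y}" for Y
  have fin: "finite X" using XV assms(1) finite_subset by auto
  \<comment> \<open>The order in which the variables of \<open>X\<close> are added does not matter, so a set induction suffices.\<close>
  have "\<exists>ts. linear_quotients V 1 ts \<and> spanned V ts = W Y" if "finite Y" "Y \<subseteq> X" for Y
    using that
  proof (induction Y)
    case empty
    have "W {} = syzygies V gs"
    proof (intro equalityI subsetI)
      fix y assume y: "y \<in> W {}"
      have "y i = 0" if "i \<ge> ?r" for i
        using y that by (cases "i = ?r") (auto simp: W_def syzygies_def)
      then show "y \<in> syzygies V gs" using y by (auto simp: W_def syzygies_def comb_snoc)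
    qed (auto simp: W_def syzygies_def comb_snoc)
    then show ?case using hs by auto
  next
    case (insert x Y)
    then obtain ts where ts: "linear_quotients V 1 ts" "spanned V ts = W Y" by auto
    have x: "x \<in> X" "x \<in> V" "x \<notin> Y" and Y: "Y \<subseteq> V" "insert x Y \<subseteq> V"
      using insert XV by auto
    have "linear_quotients V 1 (ts @ [s x])"
    proof (rule linear_quotients.snoc[OF ts(1) s_hom[OF x(1)] Y(1)])
      fix f :: "('a, 'b) mpol" assume f: "f \<in> ?P"
      have "comb (gs @ [g]) (\<lambda>i. f * s x i) k = 0" for k
        using comb_linear[of "gs @ [g]" f "s x" 0 "s x" k] by (simp add: s_syz[OF x(1)])
      then have "(\<lambda>k. f * s x k) \<in> W Y \<longleftrightarrow> f * pvar x \<in> var_ideal V Y"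
        using f s_carrier[OF x(1)] by (auto simp: W_def syzygies_def s_def)
      then show "(\<lambda>k. f * s x k) \<in> spanned V ts \<longleftrightarrow> f \<in> var_ideal V Y"
        by (simp add: ts var_ideal_pvar_mult[OF Y(1) x(2,3) f])
    qed
    moreover have "spanned V (ts @ [s x]) = W (insert x Y)"
    proof (intro equalityI subsetI)
      fix y assume "y \<in> spanned V (ts @ [s x])"
      then obtain a w where a: "a \<in> ?P" "w \<in> W Y" "y = (\<lambda>k. w k + a * s x k)"
        by (auto simp: spanned_snoc ts)
      have "comb (gs @ [g]) y k = 0" for k
        using comb_linear[of "gs @ [g]" 1 w a "s x" k] a by (simp add: s_syz[OF x(1)] W_def syzygies_def)
      moreover have "y i \<in> ?P" for i using a s_carrier[OF x(1)] by (auto simp: W_def syzygies_def)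
      moreover have "y i = 0" if "i > ?r" for i using a that by (auto simp: W_def syzygies_def s_def)
      moreover have "var_ideal V Y \<subseteq> (var_ideal V (insert x Y) :: ('a, 'b) mpol set)"
        using var_ideal_iff[OF Y(1)] var_ideal_iff[OF Y(2)] by blast
      then have "w ?r \<in> var_ideal V (insert x Y)" using a by (auto simp: W_def)
      moreover have "a * pvar x \<in> var_ideal V (insert x Y)"
        using monid_mult_left[OF pvar_in_var_ideal[of x "insert x Y" V, unfolded var_ideal_def] a(1)] Y
        by (auto simp: var_ideal_def)
      ultimately show "y \<in> W (insert x Y)"
        by (auto simp: W_def syzygies_def a(3) s_def var_ideal_def intro: monid_add)
    next
      fix y assume y: "y \<in> W (insert x Y)"
      then have "y ?r \<in> var_ideal V (insert x Y)" by (simp add: W_def)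
      from var_ideal_insert[OF Y(2) this]
      obtain a c where a: "a \<in> ?P" "c \<in> var_ideal V Y" "y ?r = a * pvar x + c" by blast
      \<comment> \<open>Subtracting a multiple of the new syzygy leaves one whose coordinate at \<open>r\<close> involves only \<open>Y\<close>.\<close>
      define w where "w i = y i - a * s x i" for i
      have "comb (gs @ [g]) w k = 0" for k
        unfolding w_def comb_diff using y by (simp add: s_syz[OF x(1)] W_def syzygies_def)
      moreover have "w ?r = c" by (simp add: w_def a s_def)
      ultimately have "w \<in> W Y" using y a s_carrier[OF x(1)]
        by (auto simp: W_def syzygies_def w_def s_def)
      moreover have "y = (\<lambda>k. w k + a * s x k)" by (simp add: w_def)
      ultimately show "y \<in> spanned V (ts @ [s x])" using a unfolding spanned_snoc ts by blast
    qed
    ultimately show ?case by blast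
  qed
  from this[OF fin order_refl] obtain ts where ts: "linear_quotients V 1 ts" "spanned V ts = W X" by auto
  \<comment> \<open>The coordinate at \<open>r\<close> of any syzygy lies in the colon ideal, so \<open>W X\<close> is everything.\<close>
  have "y ?r \<in> var_ideal V X" if "y \<in> syzygies V (gs @ [g])" for y
  proof -
    have y: "y i \<in> ?P" "comb gs y k + y ?r * g k = 0" for i k
      using that by (auto simp: syzygies_def comb_snoc)
    have "(\<lambda>k. y ?r * g k) = comb gs (\<lambda>i. - y i)"
      using y(2) by (auto simp: comb_uminus fun_eq_iff eq_neg_iff_add_eq_0 add.commute)
    moreover have "\<dots> \<in> spanned V gs" using y(1) by (intro spannedI) auto
    ultimately show ?thesis using snoc.hyps(4)[OF y(1)[of ?r]] by simp
  qed
  then have "W X = syzygies V (gs @ [g])" by (auto simp: W_def)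
  then show ?case using ts by auto
qed

section \<open>Linear resolutions\<close>

lemma spanned_member:
  assumes "g \<in> set gs"
  shows "g \<in> spanned V gs"
proof -
  obtain j where j: "j < length gs" "g = gs ! j" using assms by (auto simp: in_set_conv_nth)
  have "comb gs (\<lambda>i. if i = j then 1 else 0) k = g k" for k
    using j by (simp add: comb_def if_distrib[of "\<lambda>a. a * _"] cong: if_cong)
  then have "g = comb gs (\<lambda>i. if i = j then 1 else 0)" by auto
  then show ?thesis using spannedI[of "\<lambda>i. if i = j then 1 else 0" V gs] by auto
qed

text \<open>This makes a resolution with linear differentials minimal.\<close>

lemma homogeneous_one_max_hom_ideal:
  assumes "homogeneous V 1 p"
  shows "p \<in> max_hom_ideal V"
proof -
  have "t \<in> exps V \<and> (\<exists>v\<in>V. Poly_Mapping.lookup t v \<noteq> 0)" if "t \<in> Poly_Mapping.keys p" for t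
  proof -
    have t: "Poly_Mapping.keys t \<subseteq> V" "mdeg t = 1"
      using assms that by (auto simp: homogeneous_def polyring_def)
    then have "t \<noteq> 0" by auto
    then obtain v where "v \<in> Poly_Mapping.keys t" by (metis keys_eq_empty equals0I)
    then show ?thesis using t by (auto simp: exps_def in_keys_iff intro!: bexI[of _ v])
  qed
  then have "p \<in> var_ideal V V" by (auto simp: var_ideal_iff in_polyring_iff)
  then show ?thesis by (simp add: max_hom_ideal_monid var_ideal_def)
qed

text \<open>The matrix with \<open>b\<close> rows whose columns are the given elements; it links the lists of generators to the
  matrices of a resolution.\<close>

definition columns_mat :: "nat \<Rightarrow> (nat \<Rightarrow> 'r) list \<Rightarrow> 'r mat" where
  "columns_mat b gs = mat b (length gs) (\<lambda>(r, c). (gs ! c) r)"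

lemma columns_mat_mult:
  fixes gs :: "(nat \<Rightarrow> 'r::comm_ring_1) list"
  assumes "x \<in> carrier_vec (length gs)"
  shows "columns_mat b gs *\<^sub>v x = vec b (comb gs (($) x))"
proof (rule eq_vecI)
  fix i assume i: "i < dim_vec (vec b (comb gs (($) x)))"
  then have "(columns_mat b gs *\<^sub>v x) $ i = (\<Sum>j<length gs. (gs ! j) i * x $ j)"
    using assms by (simp add: columns_mat_def scalar_prod_def atLeast0LessThan)
  then show "(columns_mat b gs *\<^sub>v x) $ i = vec b (comb gs (($) x)) $ i"
    using i by (simp add: comb_def mult.commute)
qed (simp add: columns_mat_def)

lemma free_module_vec:
  "(\<And>i. i < b \<Longrightarrow> y i \<in> carrier (polyring V)) \<Longrightarrow> vec b y \<in> free_module V b"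
  by (simp add: free_module_def)

lemma image_columns_mat:
  "(\<lambda>x. columns_mat b gs *\<^sub>v x) ` free_module V (length gs) = vec b ` spanned V gs"
proof (intro equalityI subsetI)
  fix z assume "z \<in> (\<lambda>x. columns_mat b gs *\<^sub>v x) ` free_module V (length gs)"
  then obtain x where x: "x \<in> free_module V (length gs)" "z = columns_mat b gs *\<^sub>v x" by auto
  let ?y = "\<lambda>i. if i < length gs then x $ i else 0"
  have "comb gs ?y = comb gs (($) x)" using comb_cong[of gs ?y] by (auto simp: fun_eq_iff)
  moreover have "comb gs ?y \<in> spanned V gs"
    using x(1) by (intro spannedI) (auto simp: free_module_def)
  ultimately show "z \<in> vec b ` spanned V gs"
    using x by (auto simp: columns_mat_mult free_module_def)
next
  fix z :: "('a, 'b) mpol vec" assume "z \<in> vec b ` spanned V gs"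
  then obtain y where y: "\<And>i. y i \<in> carrier (polyring V)" "z = vec b (comb gs y)"
    by (auto simp: spanned_def)
  have "comb gs (($) (vec (length gs) y)) = comb gs y" by (auto simp: fun_eq_iff intro: comb_cong)
  then have "z = columns_mat b gs *\<^sub>v vec (length gs) y" by (simp add: columns_mat_mult y)
  then show "z \<in> (\<lambda>x. columns_mat b gs *\<^sub>v x) ` free_module V (length gs)"
    using y by (auto intro: free_module_vec)
qed

lemma kernel_columns_mat:
  fixes gs :: "(nat \<Rightarrow> ('v, 'k::field) mpol) list"
  assumes "\<And>g r. g \<in> set gs \<Longrightarrow> r \<ge> b \<Longrightarrow> g r = 0"
  shows "{x \<in> free_module V (length gs). columns_mat b gs *\<^sub>v x = 0\<^sub>v b} = vec (length gs) ` syzygies V gs"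
proof (intro equalityI subsetI)
  fix x assume "x \<in> {x \<in> free_module V (length gs). columns_mat b gs *\<^sub>v x = 0\<^sub>v b}"
  then have x: "x \<in> free_module V (length gs)" "vec b (comb gs (($) x)) = 0\<^sub>v b" 
    by (auto simp: columns_mat_mult free_module_def)
  let ?y = "\<lambda>i. if i < length gs then x $ i else 0"
  have "comb gs ?y k = 0" for k
  proof (cases "k < b")
    case True
    have "comb gs ?y k = comb gs (($) x) k" by (rule comb_cong) simp
    also have "\<dots> = vec b (comb gs (($) x)) $ k" using True by simp
    also have "\<dots> = 0" using True by (simp add: x(2))
    finally show ?thesis .
  next
    case False
    then have "(gs ! i) k = 0" if "i < length gs" for i using that by (intro assms) auto
    then show ?thesis unfolding comb_def by (intro sum.neutral) auto
  qed
  then have "?y \<in> syzygies V gs" using x(1) by (auto simp: syzygies_def free_module_def)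
  moreover have "x = vec (length gs) ?y" using x(1) by (auto simp: free_module_def)
  ultimately show "x \<in> vec (length gs) ` syzygies V gs" by blast
next
  fix x assume "x \<in> vec (length gs) ` syzygies V gs"
  then obtain y where y: "y \<in> syzygies V gs" "x = vec (length gs) y" by auto
  have "comb gs (($) x) k = 0" for k
    using y comb_cong[of gs "($) x" y k] by (simp add: syzygies_def)
  then show "x \<in> {x \<in> free_module V (length gs). columns_mat b gs *\<^sub>v x = 0\<^sub>v b}"
    using y by (auto simp: columns_mat_mult free_module_def syzygies_def)
qed

text \<open>Starting from \<open>gs\<close>, choose for each list a list of generators of its syzygies with linear quotients.
  The exactness of the resulting complex is the fact that each list spans the syzygies of its
  predecessor. The elements of every list but the first have degree \<open>1\<close>, so the basis of the
  \<open>i\<close>-th free module is placed in degree \<open>d + i\<close>.\<close>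

theorem linear_resolution:
  fixes gs :: "(nat \<Rightarrow> ('v, 'k::field) mpol) list"
  assumes V: "finite V" and lq: "linear_quotients V d gs"
    and gs: "\<And>g r. g \<in> set gs \<Longrightarrow> r \<ge> 1 \<Longrightarrow> g r = 0"
  shows "m_regular V ((\<lambda>h. h 0) ` spanned V gs) d"
proof -
  define P where "P n hs \<longleftrightarrow> linear_quotients V (if n = 0 then d else 1) hs \<and> (n = 0 \<longrightarrow> hs = gs)"
    for n :: nat and hs
  have "\<exists>G. \<forall>n. P n (G n) \<and> spanned V (G (Suc n)) = syzygies V (G n)"
    using lq syzygies_linear_quotients[OF V] by (intro dependent_nat_choice) (auto simp: P_def)
  then obtain G where G: "\<And>n. P n (G n)" "\<And>n. spanned V (G (Suc n)) = syzygies V (G n)" by blast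
  have G0: "G 0 = gs" and lqG: "linear_quotients V 1 (G (Suc n))" for n
    using G(1)[of 0] G(1)[of "Suc n"] by (auto simp: P_def)
  \<comment> \<open>The number of rows of the \<open>i\<close>-th matrix; the augmentation has a single row.\<close>
  define b where "b i = (case i of 0 \<Rightarrow> 1 | Suc j \<Rightarrow> length (G j))" for i
  have b [simp]: "b 0 = 1" "b (Suc i) = length (G i)" for i by (simp_all add: b_def)
  have zero: "g r = 0" if "g \<in> set (G i)" "r \<ge> b i" for g r i
  proof (cases i)
    case 0
    then show ?thesis using that gs G0 by simp
  next
    case (Suc j)
    then have "g \<in> syzygies V (G j)" using that spanned_member[of g "G i" V] G(2) by auto
    then show ?thesis using that Suc by (simp add: syzygies_def)
  qed
  define e where "e i = replicate (length (G i)) (d + i)" for i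
  define D where "D i = columns_mat (b i) (G i)" for i
  have len [simp]: "length (e i) = length (G i)" for i by (simp add: e_def)
  have D0: "D 0 \<in> carrier_mat 1 (length (G 0))" 
    and DS: "D (Suc i) \<in> carrier_mat (length (G i)) (length (G (Suc i)))" for i
    by (simp_all add: D_def columns_mat_def)
  have hom: "homogeneous V 1 (D (Suc i) $$ (r, c))" if "r < length (G i)" "c < length (G (Suc i))" for i r c
    using that linear_quotients_homogeneous[OF lqG, of "G (Suc i) ! c" i] by (simp add: D_def columns_mat_def)
  have "min_graded_free_resolution V ((\<lambda>h. h 0) ` spanned V gs) e D"
    unfolding min_graded_free_resolution_def len
  proof (intro conjI allI impI D0 DS)
    fix c assume "c < length (G 0)"
    then show "homogeneous V (e 0 ! c) (D 0 $$ (0, c))"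
      using linear_quotients_homogeneous[OF lq, of "gs ! c"] by (simp add: e_def D_def columns_mat_def G0)
  next
    fix i r c assume "r < length (G i)" "c < length (G (Suc i))"
    then show "D (Suc i) $$ (r, c) = 0 \<or> e i ! r \<le> e (Suc i) ! c \<and>
        homogeneous V (e (Suc i) ! c - e i ! r) (D (Suc i) $$ (r, c))"
      using hom by (simp add: e_def)
  next
    fix i r c assume "r < length (G i)" "c < length (G (Suc i))"
    then show "D (Suc i) $$ (r, c) \<in> max_hom_ideal V"
      using hom by (intro homogeneous_one_max_hom_ideal)
  next
    have "(\<lambda>x. (D 0 *\<^sub>v x) $ 0) ` free_module V (length gs) =
        (\<lambda>v. v $ 0) ` ((\<lambda>x. columns_mat 1 gs *\<^sub>v x) ` free_module V (length gs))"
      by (simp add: image_image D_def G0)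
    also have "\<dots> = (\<lambda>h. h 0) ` spanned V gs"
      unfolding image_columns_mat by (simp add: image_image)
    finally show "(\<lambda>x. (D 0 *\<^sub>v x) $ 0) ` free_module V (length (G 0)) = (\<lambda>h. h 0) ` spanned V gs"
      by (simp add: G0)
  next
    fix i
    have "dim_row (D i) = b i" by (simp add: D_def columns_mat_def)
    then have "{x \<in> free_module V (length (G i)). D i *\<^sub>v x = 0\<^sub>v (dim_row (D i))} =
      vec (length (G i)) ` syzygies V (G i)"
      using kernel_columns_mat[of "G i" "b i" V] zero by (simp add: D_def)
    also have "\<dots> = (\<lambda>y. D (Suc i) *\<^sub>v y) ` free_module V (length (G (Suc i)))"
      unfolding D_def image_columns_mat G(2) by simp
    finally show "{x \<in> free_module V (length (G i)). D i *\<^sub>v x = 0\<^sub>v (dim_row (D i))} =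
      (\<lambda>y. D (Suc i) *\<^sub>v y) ` free_module V (length (G (Suc i)))" .
  qed
  moreover have "\<forall>i. \<forall>q\<in>set (e i). q \<le> d + i" by (simp add: e_def)
  ultimately show ?thesis unfolding m_regular_def by blast
qed

text \<open>If \<open>m < d\<close>, the generators of \<open>J\<close> provided by the resolution have degree less than \<open>d\<close>, so they all
  vanish.\<close>

lemma m_regular_lower:
  fixes J :: "('v, 'k::field) mpol set"
  assumes reg: "m_regular V J m" and deg: "\<And>p t. p \<in> J \<Longrightarrow> t \<in> Poly_Mapping.keys p \<Longrightarrow> d \<le> mdeg t"
    and ne: "p \<in> J" "p \<noteq> 0"
  shows "d \<le> m"
proof (rule ccontr)
  assume less: "\<not> d \<le> m"
  obtain e D where res: "min_graded_free_resolution V J e D" and e: "\<And>i q. q \<in> set (e i) \<Longrightarrow> q \<le> m + i"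
    using reg by (auto simp: m_regular_def)
  let ?n = "length (e 0)"
  have D: "D 0 \<in> carrier_mat 1 ?n"
    and hom: "\<And>c. c < ?n \<Longrightarrow> homogeneous V (e 0 ! c) (D 0 $$ (0, c))"
    and im: "(\<lambda>x. (D 0 *\<^sub>v x) $ 0) ` free_module V ?n = J"
    using res by (simp_all add: min_graded_free_resolution_def)
  have "D 0 $$ (0, c) = 0" if c: "c < ?n" for c
  proof -
    \<comment> \<open>The entry is the image of a basis element under the augmentation and therefore lies in \<open>J\<close>.\<close>
    have "unit_vec ?n c \<in> free_module V ?n" by (auto simp: free_module_def unit_vec_def)
    then have "(D 0 *\<^sub>v unit_vec ?n c) $ 0 \<in> J" using im by auto
    moreover have "(D 0 *\<^sub>v unit_vec ?n c) $ 0 = D 0 $$ (0, c)"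
      using D c by (simp add: scalar_prod_def unit_vec_def if_distrib[of "\<lambda>a. _ * a"] cong: if_cong)
    ultimately have "d \<le> mdeg t" if "t \<in> Poly_Mapping.keys (D 0 $$ (0, c))" for t using deg that by auto
    moreover have "mdeg t < d" if "t \<in> Poly_Mapping.keys (D 0 $$ (0, c))" for t
      using hom[OF c] that e[of "e 0 ! c" 0] c less by (auto simp: homogeneous_def)
    ultimately have "Poly_Mapping.keys (D 0 $$ (0, c)) = {}" by fastforce
    then show ?thesis by simp
  qed
  then have "(D 0 *\<^sub>v x) $ 0 = 0" if "x \<in> free_module V ?n" for x
    using that D by (auto simp: scalar_prod_def free_module_def)
  then show False using im ne by auto
qed

section \<open>Monomial ideals with linear quotients\<close>

text \<open>A polynomial as an element of the free module of rank one.\<close>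

definition embed :: "('v, 'k::field) mpol \<Rightarrow> nat \<Rightarrow> ('v, 'k) mpol" where
  "embed p = (\<lambda>k. if k = 0 then p else 0)"

definition monomial_columns :: "('v \<Rightarrow>\<^sub>0 nat) list \<Rightarrow> (nat \<Rightarrow> ('v, 'k::field) mpol) list" where
  "monomial_columns ts = map (\<lambda>t. embed (Poly_Mapping.single t 1)) ts"

lemma spanned_monomial_columns:
  assumes "set ts \<subseteq> exps V"
  shows "spanned V (monomial_columns ts) = (embed ` monid V (set ts) :: (nat \<Rightarrow> ('v, 'k::field) mpol) set)"
  using assms
proof (induction ts rule: rev_induct)
  case Nil
  have "monid V {} = ({0} :: ('v, 'k) mpol set)" by (auto simp: monid_def)
  then show ?case by (auto simp: spanned_Nil monomial_columns_def embed_def)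
next
  case (snoc t ts)
  have t: "insert t (set ts) \<subseteq> exps V" using snoc.prems by auto
  have mono: "monid V (set ts) \<subseteq> (monid V (insert t (set ts)) :: ('v, 'k) mpol set)"
    unfolding monid_def by blast
  have "h \<in> spanned V (monomial_columns (ts @ [t])) \<longleftrightarrow> h \<in> embed ` monid V (insert t (set ts))"
    (is "?L \<longleftrightarrow> ?R") for h :: "nat \<Rightarrow> ('v, 'k) mpol"
  proof -
    have "?L \<longleftrightarrow> (\<exists>a\<in>carrier (polyring V). \<exists>w\<in>monid V (set ts).
        h = (\<lambda>k. embed w k + a * embed (Poly_Mapping.single t 1) k))"
      using snoc by (simp add: monomial_columns_def spanned_snoc)
    also have "\<dots> \<longleftrightarrow> (\<exists>a\<in>carrier (polyring V). \<exists>w\<in>monid V (set ts).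
        h = embed (a * Poly_Mapping.single t 1 + w))"
      by (intro bex_cong refl) (auto simp: embed_def fun_eq_iff)
    also have "\<dots> \<longleftrightarrow> ?R"
    proof
      assume "\<exists>a\<in>carrier (polyring V). \<exists>w\<in>monid V (set ts). h = embed (a * Poly_Mapping.single t 1 + w)"
      then obtain a w where *: "a \<in> carrier (polyring V)" "w \<in> monid V (set ts)"
        "h = embed (a * Poly_Mapping.single t 1 + w)" by blast
      have "Poly_Mapping.single t 1 \<in> monid V (insert t (set ts))"
        using exps_zero[of V] by (force simp: monid_single)
      then show ?R using * mono by (auto intro!: imageI monid_add monid_mult_left)
    qed (use monid_insert[OF t] in blast)
    finally show ?thesis .
  qed
  then show ?case by auto
qed

lemma single_minus:
  assumes "Poly_Mapping.lookup t x \<noteq> (0::nat)"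
  obtains s where "t = s + Poly_Mapping.single x 1"
proof -
  have "t = (t - Poly_Mapping.single x 1) + Poly_Mapping.single x 1"
    by (rule poly_mapping_eqI) (use assms in \<open>auto simp: lookup_add lookup_minus lookup_single when_def\<close>)
  then show ?thesis by (rule that)
qed

text \<open>The combinatorial criterion for linear quotients of a monomial ideal. A monomial \<open>u\<close> lies in the colon
  ideal at \<open>t\<close> if and only if \<open>u + t\<close> is a multiple of some earlier \<open>e\<close>. Then \<open>u\<close> contains every variable \<open>x\<close>
  whose exponent in \<open>e\<close> exceeds that in \<open>t\<close>, and the assumption says that one of these variables lies
  itself in the colon ideal.\<close>

lemma monomial_linear_quotients:
  assumes "set ts \<subseteq> exps V" "\<And>t. t \<in> set ts \<Longrightarrow> mdeg t = d"
    and "\<And>ys t zs e. ts = ys @ t # zs \<Longrightarrow> e \<in> set ys \<Longrightarrow>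
      \<exists>x\<in>V. Poly_Mapping.lookup t x < Poly_Mapping.lookup e x \<and> (\<exists>k\<in>set ys. \<exists>s\<in>exps V. Poly_Mapping.single x 1 + t = k + s)"
  shows "linear_quotients V d (monomial_columns ts :: (nat \<Rightarrow> ('v, 'k::field) mpol) list)"
  using assms
proof (induction ts rule: rev_induct)
  case Nil
  then show ?case by (simp add: monomial_columns_def linear_quotients.Nil)
next
  case (snoc t ts)
  have IH: "linear_quotients V d (monomial_columns ts :: (nat \<Rightarrow> ('v, 'k) mpol) list)"
  proof (rule snoc.IH)
    fix ys u zs e assume "ts = ys @ u # zs" "e \<in> set ys"
    then show "\<exists>x\<in>V. Poly_Mapping.lookup u x < Poly_Mapping.lookup e x \<and> (\<exists>k\<in>set ys. \<exists>s\<in>exps V. Poly_Mapping.single x 1 + u = k + s)"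
      using snoc.prems(3)[of ys u "zs @ [t]" e] by simp
  qed (use snoc.prems in auto)
  define X where "X = {x \<in> V. \<exists>k\<in>set ts. \<exists>s\<in>exps V. Poly_Mapping.single x 1 + t = k + s}"
  have X: "X \<subseteq> V" by (auto simp: X_def)
  have ts: "set ts \<subseteq> exps V" and t: "t \<in> exps V" "mdeg t = d" using snoc.prems by auto
  have "linear_quotients V d (monomial_columns ts @ [embed (Poly_Mapping.single t 1) :: nat \<Rightarrow> ('v, 'k) mpol])"
  proof (rule linear_quotients.snoc[OF IH _ X])
    show "homogeneous V d (embed (Poly_Mapping.single t 1) k :: ('v, 'k) mpol)" for k
      using t by (simp add: embed_def homogeneous_def)
  next
    fix f :: "('v, 'k) mpol" assume f: "f \<in> carrier (polyring V)"
    have key: "(\<exists>e s. u + t = e + s \<and> e \<in> set ts \<and> s \<in> exps V) \<longleftrightarrow> (\<exists>x\<in>X. Poly_Mapping.lookup u x \<noteq> 0)"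
      (is "?L \<longleftrightarrow> ?R") if "u \<in> Poly_Mapping.keys f" for u
    proof
      assume ?L
      then obtain e s where es: "u + t = e + s" "e \<in> set ts" by blast
      obtain x where x: "x \<in> V" "Poly_Mapping.lookup t x < Poly_Mapping.lookup e x"
        "\<exists>k\<in>set ts. \<exists>s\<in>exps V. Poly_Mapping.single x 1 + t = k + s"
        using snoc.prems(3)[of ts t "[]" e] es by auto
      have "Poly_Mapping.lookup u x + Poly_Mapping.lookup t x = Poly_Mapping.lookup e x + Poly_Mapping.lookup s x"
        using arg_cong[OF es(1), of "\<lambda>p. Poly_Mapping.lookup p x"] by (simp add: lookup_add)
      then show ?R using x by (intro bexI[of _ x]) (auto simp: X_def)
    next
      assume ?R
      then obtain x k s where x: "x \<in> V" "k \<in> set ts" "s \<in> exps V" "Poly_Mapping.single x 1 + t = k + s" "Poly_Mapping.lookup u x \<noteq> 0"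
        by (auto simp: X_def)
      have u: "u \<in> exps V" using f that by (auto simp: in_polyring_iff)
      obtain w where w: "u = w + Poly_Mapping.single x 1" using single_minus[OF x(5)] .
      then have "w \<in> exps V" using u exps_add_iff by metis
      moreover have "u + t = (Poly_Mapping.single x 1 + t) + w" by (simp add: w ac_simps)
      then have "u + t = k + (s + w)" unfolding x(4) by (simp only: ac_simps)
      ultimately show ?L using x by blast
    qed
    have "(\<lambda>k. f * embed (Poly_Mapping.single t 1) k) = embed (f * Poly_Mapping.single t 1)"
      by (auto simp: embed_def)
    moreover have "inj (embed :: ('v, 'k) mpol \<Rightarrow> _)"
      by (auto simp: inj_on_def embed_def fun_eq_iff)
    ultimately have "(\<lambda>k. f * embed (Poly_Mapping.single t 1) k) \<in> spanned V (monomial_columns ts) \<longleftrightarrow>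
        f * Poly_Mapping.single t 1 \<in> monid V (set ts)"
      by (simp add: spanned_monomial_columns[OF ts] inj_image_mem_iff)
    also have "\<dots> \<longleftrightarrow> (\<forall>u\<in>Poly_Mapping.keys f. \<exists>e s. u + t = e + s \<and> e \<in> set ts \<and> s \<in> exps V)"
      by (simp add: monid_def keys_times_monomial image_subset_iff)
    also have "\<dots> \<longleftrightarrow> f \<in> var_ideal V X"
      using f key by (simp add: var_ideal_iff[OF X])
    finally show "(\<lambda>k. f * embed (Poly_Mapping.single t 1) k) \<in> spanned V (monomial_columns ts)
        \<longleftrightarrow> f \<in> var_ideal V X" .
  qed
  then show ?case by (simp add: monomial_columns_def)
qed

lemma monid_mdeg:
  assumes "\<And>e. e \<in> E \<Longrightarrow> mdeg e = d" "p \<in> monid V E" "t \<in> Poly_Mapping.keys p"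
  shows "d \<le> mdeg t"
proof -
  obtain e s where "t = e + s" "e \<in> E" using assms(2,3) unfolding monid_def by blast
  then show ?thesis using assms(1) by simp
qed

lemma regularity_linear_quotients:
  assumes V: "finite V" and ts: "set ts \<subseteq> exps V" "ts \<noteq> []" "\<And>t. t \<in> set ts \<Longrightarrow> mdeg t = d"
    and lq: "linear_quotients V d (monomial_columns ts :: (nat \<Rightarrow> ('v, 'k::field) mpol) list)"
  shows "regularity V (monid V (set ts) :: ('v, 'k) mpol set) = d"
  unfolding regularity_def
proof (rule Least_equality)
  have "(\<lambda>h. h 0) ` embed ` monid V (set ts) = (monid V (set ts) :: ('v, 'k) mpol set)"
    by (simp add: image_image embed_def)
  moreover have "m_regular V ((\<lambda>h. h 0) ` spanned V (monomial_columns ts :: (nat \<Rightarrow> ('v, 'k) mpol) list)) d"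
    by (rule linear_resolution[OF V lq]) (auto simp: monomial_columns_def embed_def)
  ultimately show "m_regular V (monid V (set ts) :: ('v, 'k) mpol set) d"
    by (simp add: spanned_monomial_columns[OF ts(1)])
next
  fix m assume m: "m_regular V (monid V (set ts) :: ('v, 'k) mpol set) m"
  obtain t where t: "t \<in> set ts" using ts(2) by (cases ts) auto
  have "(Poly_Mapping.single t 1 :: ('v, 'k) mpol) \<in> monid V (set ts)"
    using t exps_zero[of V] by (force simp: monid_single)
  moreover have "(Poly_Mapping.single t 1 :: ('v, 'k) mpol) \<noteq> 0"
    using lookup_single_eq[of t "1::'k"] by (metis lookup_zero zero_neq_one)
  ultimately show "d \<le> m"
    using m_regular_lower[OF m] monid_mdeg[OF ts(3)] by blast
qed

section \<open>Powers of the edge ideal of a complete multipartite graph\<close>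

definition multipartite :: "'v set \<Rightarrow> ('v \<Rightarrow> 'c) \<Rightarrow> 'v sgraph" where
  "multipartite V \<pi> = \<lparr>vertices = V, edges = {{u, v} | u v. u \<in> V \<and> v \<in> V \<and> \<pi> u \<noteq> \<pi> v}\<rparr>"

definition part_deg :: "'v set \<Rightarrow> ('v \<Rightarrow> 'c) \<Rightarrow> 'c \<Rightarrow> ('v \<Rightarrow>\<^sub>0 nat) \<Rightarrow> nat" where
  "part_deg V \<pi> c t = (\<Sum>v\<in>{v\<in>V. \<pi> v = c}. Poly_Mapping.lookup t v)"

text \<open>It turns out that these are the exponents of products of \<open>n\<close> edges: each edge meets two different
  parts, so it contributes at most one to the degree in each part.\<close>

definition power_exps :: "'v set \<Rightarrow> ('v \<Rightarrow> 'c) \<Rightarrow> nat \<Rightarrow> ('v \<Rightarrow>\<^sub>0 nat) set" where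
  "power_exps V \<pi> n = {t \<in> exps V. mdeg t = 2 * n \<and> (\<forall>c. part_deg V \<pi> c t \<le> n)}"

definition edge_exps :: "'v set \<Rightarrow> ('v \<Rightarrow> 'c) \<Rightarrow> ('v \<Rightarrow>\<^sub>0 nat) set" where
  "edge_exps V \<pi> = {Poly_Mapping.single u 1 + Poly_Mapping.single v 1 | u v. u \<in> V \<and> v \<in> V \<and> \<pi> u \<noteq> \<pi> v}"

lemma part_deg_add [simp]: "part_deg V \<pi> c (s + t) = part_deg V \<pi> c s + part_deg V \<pi> c t"
  by (simp add: part_deg_def lookup_add sum.distrib)

lemma part_deg_single [simp]:
  assumes "finite V" "v \<in> V"
  shows "part_deg V \<pi> c (Poly_Mapping.single v n) = (if \<pi> v = c then n else 0)"
proof -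
  have "part_deg V \<pi> c (Poly_Mapping.single v n) = (\<Sum>w\<in>{w\<in>V. \<pi> w = c}. if w = v then n else 0)"
    unfolding part_deg_def by (rule sum.cong) (auto simp: lookup_single when_def)
  then show ?thesis using assms by simp
qed

lemma mdeg_parts:
  assumes "finite V" "t \<in> exps V"
  shows "mdeg t = (\<Sum>c\<in>\<pi> ` V. part_deg V \<pi> c t)"
proof -
  have "mdeg t = (\<Sum>v\<in>V. Poly_Mapping.lookup t v)"
    using assms by (intro mdeg_superset) (auto simp: exps_def)
  then show ?thesis using sum.image_gen[OF assms(1), of "Poly_Mapping.lookup t" \<pi>] by (simp add: part_deg_def)
qed

lemma edge_exps_exps: "edge_exps V \<pi> \<subseteq> exps V"
  by (auto simp: edge_exps_def)

lemma power_exps_0: "power_exps V \<pi> 0 = {0}"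
  by (auto simp: power_exps_def part_deg_def)

lemma finite_attains_max:
  fixes f :: "'a \<Rightarrow> nat"
  assumes "finite A" "A \<noteq> {}"
  shows "\<exists>c\<in>A. \<forall>c'\<in>A. f c' \<le> f c"
proof -
  have "Max (f ` A) \<in> f ` A" using assms by simp
  then obtain c where "c \<in> A" "f c = Max (f ` A)" by auto
  then show ?thesis using assms by (intro bexI[of _ c]) auto
qed

text \<open>To split off an edge from an exponent of degree \<open>2n + 2\<close>, take its two endpoints in a part of largest degree
  and in a part of largest degree among the others. The degree bound forces these other parts to have total
  degree at least \<open>n + 1\<close>, so the second endpoint exists. After removal of the edge
  every part has degree at most \<open>n\<close>: otherwise a third part would have degree \<open>n + 1\<close>, and so would
  the two chosen ones, with a total of \<open>3n + 3 > 2n + 2\<close>.\<close>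

lemma power_exps_Suc:
  assumes V: "finite V"
  shows "power_exps V \<pi> (Suc n) = {a + b | a b. a \<in> power_exps V \<pi> n \<and> b \<in> edge_exps V \<pi>}"
proof (intro equalityI subsetI)
  fix t assume "t \<in> {a + b | a b. a \<in> power_exps V \<pi> n \<and> b \<in> edge_exps V \<pi>}"
  then obtain a u v where a: "a \<in> power_exps V \<pi> n" "u \<in> V" "v \<in> V" "\<pi> u \<noteq> \<pi> v"
    "t = a + (Poly_Mapping.single u 1 + Poly_Mapping.single v 1)" by (auto simp: edge_exps_def)
  have "part_deg V \<pi> c t \<le> Suc n" for c
  proof -
    have "part_deg V \<pi> c a \<le> n" using a(1) by (simp add: power_exps_def)
    then show ?thesis using a V by auto
  qed
  then show "t \<in> power_exps V \<pi> (Suc n)" using a by (auto simp: power_exps_def)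
next
  fix t assume t: "t \<in> power_exps V \<pi> (Suc n)"
  let ?D = "\<lambda>c. part_deg V \<pi> c t"
  have texp: "t \<in> exps V" and le: "\<And>c. ?D c \<le> Suc n" using t by (auto simp: power_exps_def)
  have fin: "finite (\<pi> ` V)" using V by simp
  have total: "(\<Sum>c\<in>\<pi> ` V. ?D c) = 2 * n + 2"
    using mdeg_parts[OF V texp, of \<pi>] t by (simp add: power_exps_def)
  then have "\<pi> ` V \<noteq> {}" by auto
  then obtain c where c: "c \<in> \<pi> ` V" "\<And>c'. c' \<in> \<pi> ` V \<Longrightarrow> ?D c' \<le> ?D c"
    using finite_attains_max[OF fin, of ?D] by blast
  have rest: "(\<Sum>c'\<in>\<pi> ` V - {c}. ?D c') = 2 * n + 2 - ?D c"
    using total c(1) fin by (simp add: sum.remove[of _ c])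
  then have rest_pos: "(\<Sum>c'\<in>\<pi> ` V - {c}. ?D c') > 0" using le[of c] by simp
  then have "\<pi> ` V - {c} \<noteq> {}" by (metis less_irrefl sum.empty)
  then obtain d where d: "d \<in> \<pi> ` V - {c}" "\<And>c'. c' \<in> \<pi> ` V - {c} \<Longrightarrow> ?D c' \<le> ?D d"
    using finite_attains_max[of "\<pi> ` V - {c}" ?D] fin by blast
  have "?D d \<noteq> 0"
  proof
    assume "?D d = 0"
    then have "(\<Sum>c'\<in>\<pi> ` V - {c}. ?D c') = 0" using d(2) by (intro sum.neutral) auto
    then show False using rest_pos by simp
  qed
  moreover from this have "?D c \<noteq> 0" using c(2)[of d] d(1) by auto
  moreover have "\<exists>u\<in>V. \<pi> u = c' \<and> Poly_Mapping.lookup t u \<noteq> 0" if "?D c' \<noteq> 0" for c'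
  proof (rule ccontr)
    assume "\<not> ?thesis"
    then have "?D c' = 0" unfolding part_deg_def by (intro sum.neutral) auto
    then show False using that by simp
  qed
  ultimately obtain u v where uv: "u \<in> V" "\<pi> u = c" "Poly_Mapping.lookup t u \<noteq> 0" "v \<in> V" "\<pi> v = d" "Poly_Mapping.lookup t v \<noteq> 0"
    by meson
  have uvpart: "\<pi> u \<noteq> \<pi> v" using d(1) uv by auto
  then have uvne: "u \<noteq> v" by auto
  obtain s where s: "t = s + Poly_Mapping.single u 1" using single_minus[OF uv(3)] .
  have "Poly_Mapping.lookup s v \<noteq> 0" using uv(6) uvne s by (auto simp: lookup_add lookup_single)
  then obtain a where "s = a + Poly_Mapping.single v 1" by (rule single_minus)
  then have a: "t = a + (Poly_Mapping.single u 1 + Poly_Mapping.single v 1)"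
    using s by (simp add: algebra_simps)
  have "part_deg V \<pi> c' a \<le> n" for c'
  proof -
    have Da: "?D c' = part_deg V \<pi> c' a + (if c' = c then 1 else 0) + (if c' = d then 1 else 0)" for c'
      using a uv V by auto
    \<comment> \<open>Only the fourth case, a third part, needs the maximality of the two chosen parts.\<close>
    consider "c' = c" | "c' = d" | "c' \<notin> \<pi> ` V" | "c' \<in> \<pi> ` V - {c, d}" by blast
    then show ?thesis
    proof cases
      case 3
      then have empty: "{v \<in> V. \<pi> v = c'} = {}" by auto
      show ?thesis unfolding part_deg_def empty by simp
    next
      case 4
      have "(\<Sum>x\<in>{c, d, c'}. ?D x) \<le> (\<Sum>x\<in>\<pi> ` V. ?D x)"
        using fin c(1) d(1) 4 by (intro sum_mono2) auto
      moreover have "(\<Sum>x\<in>{c, d, c'}. ?D x) = ?D c + ?D d + ?D c'" using d(1) 4 by auto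
      moreover have "?D c' \<le> ?D c" "?D c' \<le> ?D d" using c(2) d(2) 4 by auto
      ultimately have "3 * ?D c' \<le> 2 * n + 2" using total by simp
      then show ?thesis using Da[of c'] 4 by simp
    qed (use Da[of c'] le[of c'] d(1) in auto)
  qed
  moreover have "a \<in> exps V" using texp unfolding a exps_add_iff by simp
  moreover have "mdeg a = 2 * n" using t a by (simp add: power_exps_def)
  ultimately have "a \<in> power_exps V \<pi> n" by (simp add: power_exps_def)
  moreover have "Poly_Mapping.single u 1 + Poly_Mapping.single v 1 \<in> edge_exps V \<pi>"
    using uv uvpart unfolding edge_exps_def by blast
  ultimately show "t \<in> {a + b | a b. a \<in> power_exps V \<pi> n \<and> b \<in> edge_exps V \<pi>}" using a by blast
qed

lemma finite_power_exps:
  assumes "finite V"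
  shows "finite (power_exps V \<pi> n)"
proof (induction n)
  case 0
  then show ?case by (simp add: power_exps_0)
next
  case (Suc n)
  have "edge_exps V \<pi> \<subseteq> (\<lambda>(u, v). Poly_Mapping.single u 1 + Poly_Mapping.single v 1) ` (V \<times> V)"
    by (auto simp: edge_exps_def)
  then have "finite (edge_exps V \<pi>)" using assms by (meson finite_SigmaI finite_imageI finite_subset)
  moreover have "power_exps V \<pi> (Suc n) = (\<lambda>(a, b). a + b) ` (power_exps V \<pi> n \<times> edge_exps V \<pi>)"
    unfolding power_exps_Suc[OF assms] by auto
  ultimately show ?case using Suc by simp
qed

lemma power_exps_nonempty:
  assumes "finite V" "u \<in> V" "v \<in> V" "\<pi> u \<noteq> \<pi> v"
  shows "power_exps V \<pi> n \<noteq> {}"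
proof (induction n)
  case (Suc n)
  moreover have "Poly_Mapping.single u 1 + Poly_Mapping.single v 1 \<in> edge_exps V \<pi>"
    using assms unfolding edge_exps_def by blast
  ultimately show ?case unfolding power_exps_Suc[OF assms(1)] by blast
qed (simp add: power_exps_0)

lemma edge_ideal_multipartite:
  "edge_ideal (multipartite V \<pi>) = (monid V (edge_exps V \<pi>) :: ('v, 'k::field) mpol set)"
proof -
  have "{pvar u * pvar v | u v. {u, v} \<in> edges (multipartite V \<pi>)} =
      ((\<lambda>e. Poly_Mapping.single e 1) ` edge_exps V \<pi> :: ('v, 'k) mpol set)"
    by (auto simp: multipartite_def edge_exps_def pvar_def mult_single image_iff doubleton_eq_iff) 
      (metis add.commute)
  then show ?thesis
    by (simp add: edge_ideal_def monid_genideal[OF edge_exps_exps] multipartite_def)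
qed

text \<open>By induction, since products of monomial ideals correspond to sums of exponents.\<close>

lemma ideal_power_multipartite:
  assumes "finite V"
  shows "ideal_power (polyring V) (edge_ideal (multipartite V \<pi>)) n
    = (monid V (power_exps V \<pi> n) :: ('v, 'k::field) mpol set)"
proof (induction n)
  case 0
  then show ?case by (simp add: power_exps_0 monid_whole)
next
  case (Suc n)
  have "power_exps V \<pi> n \<subseteq> exps V" by (auto simp: power_exps_def)
  then show ?case
    unfolding ideal_power_Suc Suc
    by (simp add: edge_ideal_multipartite monid_prod[OF _ edge_exps_exps] power_exps_Suc[OF assms])
qed

lemma sum_exchange:
  fixes e t :: "'a \<Rightarrow> nat"
  assumes "finite C" "sum e C \<le> sum t C" "p \<in> C" "t p < e p"
  shows "\<exists>y\<in>C. e y < t y"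
proof (rule ccontr)
  assume "\<not> ?thesis"
  then have "sum t C < sum e C" using assms by (intro sum_strict_mono_ex1) (auto simp: not_less)
  then show False using assms(2) by simp
qed

text \<open>The degree of \<open>t\<close> is to be raised at \<open>p\<close> and lowered at some \<open>y\<close> where it exceeds \<open>e\<close>. If the part of \<open>p\<close> has already
  full degree in \<open>t\<close>, then \<open>y\<close> must be in the same part; it exists because the degree of \<open>e\<close>
  in that part is not larger. Otherwise any \<open>y\<close> will do, and equality of the total degrees provides one.\<close>

lemma power_exps_exchange:
  assumes V: "finite V" and e: "e \<in> power_exps V \<pi> n" and t: "t \<in> power_exps V \<pi> n"
    and p: "p \<in> V" "Poly_Mapping.lookup t p < Poly_Mapping.lookup e p"
  shows "\<exists>y\<in>V. \<exists>k\<in>power_exps V \<pi> n. Poly_Mapping.lookup e y < Poly_Mapping.lookup t y \<and>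
    Poly_Mapping.single p 1 + t = k + Poly_Mapping.single y 1"
proof -
  have exps: "e \<in> exps V" "t \<in> exps V" using e t by (auto simp: power_exps_def)
  have "\<exists>y\<in>V. Poly_Mapping.lookup e y < Poly_Mapping.lookup t y \<and> (part_deg V \<pi> (\<pi> p) t = n \<longrightarrow> \<pi> y = \<pi> p)"
  proof (cases "part_deg V \<pi> (\<pi> p) t = n")
    case True
    then have "part_deg V \<pi> (\<pi> p) e \<le> part_deg V \<pi> (\<pi> p) t" using e by (simp add: power_exps_def)
    then show ?thesis
      using sum_exchange[of "{v\<in>V. \<pi> v = \<pi> p}" "Poly_Mapping.lookup e" "Poly_Mapping.lookup t" p] V p by (auto simp: part_deg_def)
  next
    case False
    have "mdeg e = mdeg t" using e t by (simp add: power_exps_def)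
    then have "sum (Poly_Mapping.lookup e) V \<le> sum (Poly_Mapping.lookup t) V"
      using exps V by (simp add: mdeg_superset[of V] exps_def)
    then show ?thesis using sum_exchange[of V "Poly_Mapping.lookup e" "Poly_Mapping.lookup t" p] V p False by auto
  qed
  then obtain y where y: "y \<in> V" "Poly_Mapping.lookup e y < Poly_Mapping.lookup t y" "part_deg V \<pi> (\<pi> p) t = n \<longrightarrow> \<pi> y = \<pi> p" by blast
  have "Poly_Mapping.lookup (Poly_Mapping.single p 1 + t) y \<noteq> 0" using y(2) by (simp add: lookup_add)
  then obtain k where k: "Poly_Mapping.single p 1 + t = k + Poly_Mapping.single y 1" by (rule single_minus)
  have "part_deg V \<pi> c k \<le> n" for c
  proof -
    have "part_deg V \<pi> c t \<le> n" using t by (simp add: power_exps_def)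
    moreover have "(if \<pi> p = c then 1 else 0) + part_deg V \<pi> c t = part_deg V \<pi> c k + (if \<pi> y = c then 1 else 0)"
      using arg_cong[OF k, of "part_deg V \<pi> c"]
      unfolding part_deg_add part_deg_single[OF V p(1)] part_deg_single[OF V y(1)] .
    ultimately show ?thesis using y(3) by (auto split: if_splits)
  qed
  moreover have "k \<in> exps V"
    using exps p k exps_add_iff[of k "Poly_Mapping.single y 1" V] exps_add[of "Poly_Mapping.single p 1" V t] by simp
  moreover have "mdeg k = 2 * n" using arg_cong[OF k, of mdeg] t by (simp add: power_exps_def)
  ultimately show ?thesis using y k by (auto simp: power_exps_def)
qed

lemma map_lookup_less_iff:
  fixes s t :: "'v \<Rightarrow>\<^sub>0 nat"
  shows "map (Poly_Mapping.lookup s) vs < map (Poly_Mapping.lookup t) vs \<longleftrightarrow>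
    (\<exists>i<length vs. (\<forall>j<i. Poly_Mapping.lookup s (vs ! j) = Poly_Mapping.lookup t (vs ! j)) \<and> Poly_Mapping.lookup s (vs ! i) < Poly_Mapping.lookup t (vs ! i))"
proof -
  have "take i (map (Poly_Mapping.lookup s) vs) = take i (map (Poly_Mapping.lookup t) vs) \<longleftrightarrow>
      (\<forall>j<i. Poly_Mapping.lookup s (vs ! j) = Poly_Mapping.lookup t (vs ! j))" if "i < length vs" for i
    using that by (auto simp: list_eq_iff_nth_eq)
  then show ?thesis by (auto simp: list_less_def lexord_take_index_conv)
qed

text \<open>In lexicographically decreasing order, let \<open>e\<close> precede \<open>t\<close>, and let \<open>p\<close> be the first variable in which
  they differ; the exponent of \<open>p\<close> is larger in \<open>e\<close>. The exchange at \<open>p\<close> removes a variable \<open>y\<close> whose exponent is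
  larger in \<open>t\<close>, so \<open>y\<close> comes after \<open>p\<close>, and the new exponent is lexicographically larger
  than \<open>t\<close>. Thus \<open>p\<close> is a variable in the colon ideal at \<open>t\<close>, as the criterion requires.\<close>

lemma power_exps_linear_quotients:
  assumes V: "finite V"
  shows "\<exists>ts. set ts = power_exps V \<pi> n \<and>
    linear_quotients V (2 * n) (monomial_columns ts :: (nat \<Rightarrow> ('v, 'k::field) mpol) list)"
proof -
  obtain vs where vs: "set vs = V" "distinct vs" using finite_distinct_list[OF V] by blast
  obtain us where us: "set us = power_exps V \<pi> n" "distinct us"
    using finite_distinct_list[OF finite_power_exps[OF V]] by blast
  let ?key = "\<lambda>t. map (Poly_Mapping.lookup t) vs"
  define ts where "ts = rev (sort_key ?key us)"
  have set: "set ts = power_exps V \<pi> n" and dist: "distinct ts" by (simp_all add: ts_def us)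
  have sorted: "sorted_wrt (\<lambda>a b. ?key b \<le> ?key a) ts"
    using sorted_sort_key[of ?key us] by (simp add: ts_def sorted_wrt_rev sorted_map)
  have inj: "s = t" if "?key s = ?key t" "s \<in> exps V" "t \<in> exps V" for s t :: "'v \<Rightarrow>\<^sub>0 nat"
  proof (rule poly_mapping_eqI)
    show "Poly_Mapping.lookup s v = Poly_Mapping.lookup t v" for v
    proof (cases "v \<in> V")
      case False
      then have "v \<notin> Poly_Mapping.keys s" "v \<notin> Poly_Mapping.keys t" using that by (auto simp: exps_def)
      then show ?thesis by (simp add: in_keys_iff)
    qed (use that vs(1) in auto)
  qed
  have exps: "set ts \<subseteq> exps V" by (auto simp: set power_exps_def)
  have "linear_quotients V (2 * n) (monomial_columns ts :: (nat \<Rightarrow> ('v, 'k) mpol) list)"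
  proof (rule monomial_linear_quotients[OF exps])
    show "mdeg t = 2 * n" if "t \<in> set ts" for t using that by (simp add: set power_exps_def)
  next
    fix ys t zs e assume split: "ts = ys @ t # zs" and e: "e \<in> set ys"
    have mem: "e \<in> power_exps V \<pi> n" "t \<in> power_exps V \<pi> n" using split e set by auto
    have "?key t \<le> ?key e" using sorted e unfolding split by (simp add: sorted_wrt_append)
    moreover have "e \<noteq> t" using dist e unfolding split by auto
    then have "?key t \<noteq> ?key e" using inj[of t e] mem unfolding power_exps_def by blast
    ultimately have "?key t < ?key e" by (simp only: less_le simp_thms)
    then obtain i where i: "i < length vs" "\<And>j. j < i \<Longrightarrow> Poly_Mapping.lookup t (vs ! j) = Poly_Mapping.lookup e (vs ! j)"
      "Poly_Mapping.lookup t (vs ! i) < Poly_Mapping.lookup e (vs ! i)" unfolding map_lookup_less_iff by blast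
    let ?p = "vs ! i"
    have p: "?p \<in> V" using i(1) vs(1) by auto
    from power_exps_exchange[OF V mem p i(3)] obtain y k where
      y: "y \<in> V" "k \<in> power_exps V \<pi> n" "Poly_Mapping.lookup e y < Poly_Mapping.lookup t y"
        "Poly_Mapping.single ?p 1 + t = k + Poly_Mapping.single y 1" by blast
    \<comment> \<open>Up to and including position \<open>i\<close>, the exponents of \<open>t\<close> do not exceed those of \<open>e\<close>, so \<open>y\<close> comes later.\<close>
    have yp: "y \<noteq> ?p" using y(3) i(3) by auto
    have ybefore: "y \<noteq> vs ! j" if "j < i" for j using y(3) i(2)[OF that] by auto
    have other: "Poly_Mapping.lookup k v = Poly_Mapping.lookup t v" if "v \<noteq> y" "v \<noteq> ?p" for v
      using arg_cong[OF y(4), of "\<lambda>a. Poly_Mapping.lookup a v"] that by (simp add: lookup_add lookup_single)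
    have "Poly_Mapping.lookup k (vs ! j) = Poly_Mapping.lookup t (vs ! j)" if "j < i" for j
    proof (rule other)
      show "vs ! j \<noteq> y" using ybefore[OF that] by simp
      show "vs ! j \<noteq> ?p" using that i(1) vs(2) by (simp add: nth_eq_iff_index_eq)
    qed
    moreover have "Poly_Mapping.lookup t ?p < Poly_Mapping.lookup k ?p"
      using arg_cong[OF y(4), of "\<lambda>a. Poly_Mapping.lookup a ?p"] yp by (simp add: lookup_add lookup_single)
    ultimately have later: "?key t < ?key k"
      unfolding map_lookup_less_iff using i(1) by metis
    have "\<forall>z\<in>set zs. ?key z \<le> ?key t" using sorted unfolding split by (simp add: sorted_wrt_append)
    then have "k \<notin> set (t # zs)" using later by (metis leD order_less_irrefl set_ConsD)
    moreover have "k \<in> set ts" using y set by simp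
    ultimately have "k \<in> set ys" unfolding split by simp
    then show "\<exists>x\<in>V. Poly_Mapping.lookup t x < Poly_Mapping.lookup e x \<and> (\<exists>k\<in>set ys. \<exists>s\<in>exps V. Poly_Mapping.single x 1 + t = k + s)"
    proof (intro bexI conjI)
      show "Poly_Mapping.single y 1 \<in> exps V" using y(1) by simp
    qed (use p i(3) y(4) in auto)
  qed
  then show ?thesis using set by blast
qed

theorem regularity_multipartite:
  assumes "finite V" "u \<in> V" "v \<in> V" "\<pi> u \<noteq> \<pi> v"
  shows "regularity V (ideal_power (polyring V) (edge_ideal (multipartite V \<pi>) :: ('v, 'k::field) mpol set) n) = 2 * n"
proof -
  obtain ts where ts: "set ts = power_exps V \<pi> n"
    "linear_quotients V (2 * n) (monomial_columns ts :: (nat \<Rightarrow> ('v, 'k) mpol) list)"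
    using power_exps_linear_quotients[OF assms(1)] by blast
  have "ts \<noteq> []" using power_exps_nonempty[OF assms, of n] ts(1) by auto
  then have "regularity V (monid V (set ts) :: ('v, 'k) mpol set) = 2 * n"
    using ts by (intro regularity_linear_quotients assms) (auto simp: power_exps_def)
  then show ?thesis by (simp add: ideal_power_multipartite[OF assms(1)] ts)
qed

section \<open>Transport of ideal-theoretic notions along a ring isomorphism\<close>

lemma (in ring) ideal_power_ideal:
  assumes "ideal J R"
  shows "ideal (ideal_power R J n) R"
  by (induction n) (auto intro: oneideal ideal_prod_is_ideal assms)

text \<open>The hypotheses are symmetric: the inverse map satisfies them with the rings exchanged. So an inequality such as
  \<open>krull_dim_le\<close> gives an equality when it is applied in both directions.\<close>

locale ring_isomorphism = R: cring R + S: cring S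
  for R :: "('a, 'm) ring_scheme" and S :: "('b, 'n) ring_scheme" +
  fixes h
  assumes iso: "h \<in> ring_iso R S"
begin

abbreviation inv_h where "inv_h \<equiv> inv_into (carrier R) h"

lemma closed [simp]: "x \<in> carrier R \<Longrightarrow> h x \<in> carrier S"
  and mult [simp]: "x \<in> carrier R \<Longrightarrow> y \<in> carrier R \<Longrightarrow> h (x \<otimes>\<^bsub>R\<^esub> y) = h x \<otimes>\<^bsub>S\<^esub> h y"
  and add [simp]: "x \<in> carrier R \<Longrightarrow> y \<in> carrier R \<Longrightarrow> h (x \<oplus>\<^bsub>R\<^esub> y) = h x \<oplus>\<^bsub>S\<^esub> h y"
  and one [simp]: "h \<one>\<^bsub>R\<^esub> = \<one>\<^bsub>S\<^esub>"
  and bij: "bij_betw h (carrier R) (carrier S)"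
  using ring_iso_memE[OF iso] by auto

lemma hom: "ring_hom_ring R S h"
  using iso by (intro ring_hom_ringI2 R.ring_axioms S.ring_axioms) (simp add: ring_iso_def)

lemma zero [simp]: "h \<zero>\<^bsub>R\<^esub> = \<zero>\<^bsub>S\<^esub>"
  using ring_hom_zero[of h R S] iso R.ring_axioms S.ring_axioms by (auto simp: ring_iso_def)

lemma inj: "inj_on h (carrier R)" and image_carrier [simp]: "h ` carrier R = carrier S"
  using bij by (auto simp: bij_betw_def)

lemma inverse: "ring_isomorphism S R inv_h"
  by (intro ring_isomorphism.intro ring_isomorphism_axioms.intro S.cring_axioms R.cring_axioms
      ring_iso_set_sym[OF R.ring_axioms iso])

lemma inv_h_h [simp]: "x \<in> carrier R \<Longrightarrow> inv_h (h x) = x"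
  using inj by simp

lemma h_inv_h [simp]: "y \<in> carrier S \<Longrightarrow> h (inv_h y) = y"
  using image_carrier f_inv_into_f by metis

lemma inv_h_closed [simp]: "y \<in> carrier S \<Longrightarrow> inv_h y \<in> carrier R"
  by (rule ring_isomorphism.closed[OF inverse])

lemma image_inv_h [simp]: "J \<subseteq> carrier R \<Longrightarrow> inv_h ` h ` J = J"
  by (force simp: image_image)

lemma image_h_inv_h [simp]: "J \<subseteq> carrier S \<Longrightarrow> h ` inv_h ` J = J"
  by (force simp: image_image)

lemma image_closed: "J \<subseteq> carrier R \<Longrightarrow> h ` J \<subseteq> carrier S"
  by auto

lemma image_eq_vimage: "J \<subseteq> carrier R \<Longrightarrow> h ` J = {y \<in> carrier S. inv_h y \<in> J}"
  by (auto simp: image_iff) (metis h_inv_h)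

lemma image_inj: "X \<subseteq> carrier R \<Longrightarrow> Y \<subseteq> carrier R \<Longrightarrow> h ` X = h ` Y \<longleftrightarrow> X = Y"
  using inj_on_image_eq_iff[OF inj] by simp

lemma ideal_subset: "ideal J R \<Longrightarrow> J \<subseteq> carrier R"
  by (meson ideal.axioms(1) additive_subgroup.a_subset)

lemma image_ideal: assumes "ideal J R" shows "ideal (h ` J) S"
  using ring_hom_ring.ideal_vimage[OF ring_isomorphism.hom[OF inverse] assms]
  by (simp add: image_eq_vimage ideal_subset assms)

lemma image_primeideal: assumes "primeideal J R" shows "primeideal (h ` J) S"
proof -
  have "ideal J R" using assms by (rule primeideal.axioms(1))
  then show ?thesis
    using ring_hom_ring.primeideal_vimage[OF ring_isomorphism.hom[OF inverse] S.cring_axioms assms]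
    by (simp add: image_eq_vimage ideal_subset)
qed

text \<open>One inclusion holds because the preimage of an ideal is an ideal, the other because its image is one.\<close>

lemma image_genideal:
  assumes G: "G \<subseteq> carrier R"
  shows "h ` (Idl\<^bsub>R\<^esub> G) = Idl\<^bsub>S\<^esub> (h ` G)"
proof
  have G': "h ` G \<subseteq> carrier S" using G by auto
  have "G \<subseteq> {x \<in> carrier R. h x \<in> Idl\<^bsub>S\<^esub> (h ` G)}" using G S.genideal_self[OF G'] by auto
  then have "Idl\<^bsub>R\<^esub> G \<subseteq> {x \<in> carrier R. h x \<in> Idl\<^bsub>S\<^esub> (h ` G)}"
    by (intro R.genideal_minimal ring_hom_ring.ideal_vimage[OF hom] S.genideal_ideal[OF G'])
  then show "h ` (Idl\<^bsub>R\<^esub> G) \<subseteq> Idl\<^bsub>S\<^esub> (h ` G)" by auto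
  show "Idl\<^bsub>S\<^esub> (h ` G) \<subseteq> h ` (Idl\<^bsub>R\<^esub> G)"
    using R.genideal_self[OF G] by (intro S.genideal_minimal image_ideal R.genideal_ideal[OF G]) auto
qed

lemma image_ideal_prod:
  assumes "I \<subseteq> carrier R" "J \<subseteq> carrier R"
  shows "h ` (I \<cdot>\<^bsub>R\<^esub> J) = (h ` I) \<cdot>\<^bsub>S\<^esub> (h ` J)"
proof (intro equalityI subsetI)
  have "x \<in> carrier R \<and> h x \<in> (h ` I) \<cdot>\<^bsub>S\<^esub> (h ` J)" if "x \<in> I \<cdot>\<^bsub>R\<^esub> J" for x
    using that
  proof induction
    case (prod i j)
    moreover from this have "i \<in> carrier R" "j \<in> carrier R" using assms by auto
    ultimately show ?case using ideal_prod.prod[of "h i" "h ` I" "h j" "h ` J" S] by simp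
  qed (auto intro: ideal_prod.sum)
  then show "y \<in> (h ` I) \<cdot>\<^bsub>S\<^esub> (h ` J)" if "y \<in> h ` (I \<cdot>\<^bsub>R\<^esub> J)" for y using that by auto
  have sub: "x \<in> carrier R" if "x \<in> I \<cdot>\<^bsub>R\<^esub> J" for x
    using that by induction (use assms in auto)
  fix y assume "y \<in> (h ` I) \<cdot>\<^bsub>S\<^esub> (h ` J)"
  then show "y \<in> h ` (I \<cdot>\<^bsub>R\<^esub> J)"
  proof induction
    case (prod i j)
    then obtain a b where "a \<in> I" "b \<in> J" "i = h a" "j = h b" by auto
    moreover from this have "a \<in> carrier R" "b \<in> carrier R" using assms by auto
    ultimately show ?case by (intro image_eqI[of _ _ "a \<otimes>\<^bsub>R\<^esub> b"]) (auto intro: ideal_prod.prod)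
  next
    case (sum s1 s2)
    then obtain a b where "a \<in> I \<cdot>\<^bsub>R\<^esub> J" "b \<in> I \<cdot>\<^bsub>R\<^esub> J" "s1 = h a" "s2 = h b" by auto
    then show ?case using sub by (intro image_eqI[of _ _ "a \<oplus>\<^bsub>R\<^esub> b"]) (auto intro: ideal_prod.sum)
  qed
qed

lemma image_ideal_power:
  assumes "ideal J R"
  shows "h ` ideal_power R J n = ideal_power S (h ` J) n"
proof (induction n)
  case (Suc n)
  then show ?case
    by (simp add: image_ideal_prod ideal_subset R.ideal_power_ideal assms)
qed simp

lemma image_prime_chain:
  assumes "prime_chain R n Q"
  shows "prime_chain S n (\<lambda>i. h ` Q i)"
proof -
  have "Q i \<subseteq> carrier R" if "i \<le> n" for i
    using assms that by (intro ideal_subset primeideal.axioms(1)) (simp add: prime_chain_def)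
  then have "h ` Q i \<subset> h ` Q (Suc i)" if "i < n" for i
    using assms that image_mono[of "Q i" "Q (Suc i)" h]
    unfolding prime_chain_def psubset_eq by (simp add: image_inj)
  then show ?thesis using assms by (auto simp: prime_chain_def intro: image_primeideal)
qed

lemma krull_dim_le: "krull_dim R \<le> krull_dim S"
  unfolding krull_dim_def using image_prime_chain by (intro SUP_subset_mono) auto

lemma height_le: "height R P \<le> height S (h ` P)"
  unfolding height_def using image_prime_chain by (intro SUP_subset_mono) blast+

lemma krull_dim_eq: "krull_dim S = krull_dim R"
  using krull_dim_le ring_isomorphism.krull_dim_le[OF inverse] by (rule order_antisym[rotated])

lemma height_eq: "P \<subseteq> carrier R \<Longrightarrow> height S (h ` P) = height R P"
  using height_le[of P] ring_isomorphism.height_le[OF inverse, of "h ` P"] by simp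

lemma image_minimal_primes:
  assumes I: "I \<subseteq> carrier R" and Q: "Q \<in> minimal_primes R I"
  shows "h ` Q \<in> minimal_primes S (h ` I)"
  unfolding minimal_primes_def
proof (intro CollectI conjI allI impI)
  have prime: "primeideal Q R" and "I \<subseteq> Q"
    and min: "\<And>Q'. primeideal Q' R \<Longrightarrow> I \<subseteq> Q' \<Longrightarrow> Q' \<subseteq> Q \<Longrightarrow> Q' = Q"
    using Q by (auto simp: minimal_primes_def)
  show "primeideal (h ` Q) S" by (rule image_primeideal[OF prime])
  show "h ` I \<subseteq> h ` Q" using \<open>I \<subseteq> Q\<close> by auto
  fix Q' assume Q': "primeideal Q' S \<and> h ` I \<subseteq> Q' \<and> Q' \<subseteq> h ` Q"
  have sub: "Q \<subseteq> carrier R" by (intro ideal_subset primeideal.axioms(1) prime)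
  then have sub': "Q' \<subseteq> carrier S" using Q' image_closed[OF sub] by blast
  have "inv_h ` Q' = Q"
  proof (rule min)
    show "primeideal (inv_h ` Q') R" using ring_isomorphism.image_primeideal[OF inverse] Q' by blast
    show "I \<subseteq> inv_h ` Q'" using image_mono[of "h ` I" Q' inv_h] Q' I by simp
    show "inv_h ` Q' \<subseteq> Q" using image_mono[of Q' "h ` Q" inv_h] Q' sub by simp
  qed
  then have "h ` inv_h ` Q' = h ` Q" by simp
  then show "Q' = h ` Q" using sub' by simp
qed

lemma minimal_primes_subset: "Q \<in> minimal_primes R I \<Longrightarrow> Q \<subseteq> carrier R"
  unfolding minimal_primes_def by (blast dest: primeideal.axioms(1) ideal_subset)

lemma bij_minimal_primes:
  assumes "I \<subseteq> carrier R"
  shows "bij_betw (image h) (minimal_primes R I) (minimal_primes S (h ` I))"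
proof (rule bij_betwI[where g = "image inv_h"])
  show "image h \<in> minimal_primes R I \<rightarrow> minimal_primes S (h ` I)"
    using image_minimal_primes[OF assms] by auto
  show "image inv_h \<in> minimal_primes S (h ` I) \<rightarrow> minimal_primes R I"
    using ring_isomorphism.image_minimal_primes[OF inverse, of "h ` I"] assms image_closed[OF assms] by auto
  show "inv_h ` h ` Q = Q" if "Q \<in> minimal_primes R I" for Q
    using minimal_primes_subset[OF that] by simp
  show "h ` inv_h ` Q = Q" if "Q \<in> minimal_primes S (h ` I)" for Q
    using ring_isomorphism.minimal_primes_subset[OF inverse that] by simp
qed

lemma image_set_add:
  assumes "X \<subseteq> carrier R" "Y \<subseteq> carrier R"
  shows "h ` (X <+>\<^bsub>R\<^esub> Y) = h ` X <+>\<^bsub>S\<^esub> h ` Y"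
proof -
  have "h ` (X <+>\<^bsub>R\<^esub> Y) = (\<Union>x\<in>X. \<Union>y\<in>Y. {h (x \<oplus>\<^bsub>R\<^esub> y)})"
    unfolding set_add_def' by auto
  also have "\<dots> = (\<Union>x\<in>X. \<Union>y\<in>Y. {h x \<oplus>\<^bsub>S\<^esub> h y})"
    using assms by (intro SUP_cong refl) (simp add: subset_iff)
  also have "\<dots> = h ` X <+>\<^bsub>S\<^esub> h ` Y" unfolding set_add_def' by auto
  finally show ?thesis .
qed

lemma image_coset:
  assumes "X \<subseteq> carrier R" "a \<in> carrier R"
  shows "h ` (X +>\<^bsub>R\<^esub> a) = h ` X +>\<^bsub>S\<^esub> h a"
proof -
  have "h ` (X +>\<^bsub>R\<^esub> a) = (\<Union>x\<in>X. {h (x \<oplus>\<^bsub>R\<^esub> a)})"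
    unfolding a_r_coset_def' by auto
  also have "\<dots> = (\<Union>x\<in>X. {h x \<oplus>\<^bsub>S\<^esub> h a})"
    using assms by (intro SUP_cong refl) (simp add: subset_iff)
  also have "\<dots> = h ` X +>\<^bsub>S\<^esub> h a" unfolding a_r_coset_def' by auto
  finally show ?thesis .
qed

lemma image_line_extension:
  assumes "K \<subseteq> carrier R" "v \<in> carrier R" "E \<subseteq> carrier R"
  shows "h ` R.line_extension K v E = S.line_extension (h ` K) (h v) (h ` E)"
proof -
  have "K #>\<^bsub>R\<^esub> v \<subseteq> carrier R" using assms by (auto simp: r_coset_def)
  moreover have "h ` (K #>\<^bsub>R\<^esub> v) = h ` K #>\<^bsub>S\<^esub> h v"
  proof -
    have "h ` (K #>\<^bsub>R\<^esub> v) = (\<Union>k\<in>K. {h (k \<otimes>\<^bsub>R\<^esub> v)})" unfolding r_coset_def by auto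
    also have "\<dots> = (\<Union>k\<in>K. {h k \<otimes>\<^bsub>S\<^esub> h v})"
      using assms by (intro SUP_cong refl) (simp add: subset_iff)
    also have "\<dots> = h ` K #>\<^bsub>S\<^esub> h v" unfolding r_coset_def by auto
    finally show ?thesis .
  qed
  ultimately show ?thesis
    unfolding R.line_extension_def S.line_extension_def using assms by (simp add: image_set_add)
qed

lemma image_dimension:
  assumes "R.dimension n K E" "K \<subseteq> carrier R"
  shows "E \<subseteq> carrier R \<and> S.dimension n (h ` K) (h ` E)"
  using assms
proof (induction rule: R.dimension.induct)
  case (zero_dim K)
  then show ?case using S.zero_dim[of "h ` K"] by simp
next
  case (Suc_dim v E n K)
  then have E: "E \<subseteq> carrier R" and S: "S.dimension n (h ` K) (h ` E)" by auto
  have "h v \<notin> h ` E" using Suc_dim.hyps E inj by (auto simp: inj_on_def)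
  from S.Suc_dim[OF _ this S] show ?case
    using Suc_dim E R.line_extension_in_carrier by (simp add: image_line_extension)
qed

text \<open>The dimension is defined by means of a description operator, so equality of the two sets of possible values is
  what has to be shown.\<close>

lemma dim_eq:
  assumes "K \<subseteq> carrier R" "E \<subseteq> carrier R"
  shows "S.dim (h ` K) (h ` E) = R.dim K E"
proof -
  have "S.dimension n (h ` K) (h ` E) \<longleftrightarrow> R.dimension n K E" for n
    using image_dimension[of n K E] ring_isomorphism.image_dimension[OF inverse, of n "h ` K" "h ` E"] assms
      image_closed[OF assms(1)] image_inv_h[OF assms(1)] image_inv_h[OF assms(2)]
    by auto
  then show ?thesis by (simp add: R.dim_def S.dim_def)
qed

end

section \<open>The special fiber ring\<close>

lemma (in cring) ideal_power_add:
  assumes "ideal J R"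
  shows "ideal_power R J i \<cdot> ideal_power R J j = ideal_power R J (i + j)"
proof (induction j)
  case 0
  then show ?case by (simp add: ideal_prod_one ideal_power_ideal assms)
next
  case (Suc j)
  then show ?case
    by (simp add: ideal_prod_assoc[symmetric] ideal_power_ideal assms)
qed

lemma (in cring) fiber_zero_ideal:
  assumes "ideal M R" "ideal J R"
  shows "ideal (fiber_zero R M J n) R"
  unfolding fiber_zero_def by (intro ideal_prod_is_ideal ideal_power_ideal assms)

lemma (in cring) fiber_zero_subset:
  assumes "ideal M R" "ideal J R"
  shows "fiber_zero R M J n \<subseteq> ideal_power R J n"
  unfolding fiber_zero_def using ideal_prod_inter[OF assms(1) ideal_power_ideal[OF assms(2)]] by auto

lemma (in cring) fiber_zero_mult:
  assumes "ideal M R" "ideal J R" "x \<in> fiber_zero R M J i" "y \<in> ideal_power R J j"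
  shows "x \<otimes> y \<in> fiber_zero R M J (i + j)"
proof -
  have "x \<otimes> y \<in> (M \<cdot> ideal_power R J i) \<cdot> ideal_power R J j"
    using assms(3,4) unfolding fiber_zero_def by (rule ideal_prod.prod)
  then show ?thesis
    using assms(1,2) by (simp add: fiber_zero_def ideal_prod_assoc ideal_power_ideal ideal_power_add)
qed

lemma (in cring) ideal_power_mult:
  assumes "ideal J R" "x \<in> ideal_power R J i" "y \<in> ideal_power R J j"
  shows "x \<otimes> y \<in> ideal_power R J (i + j)"
  using ideal_prod.prod[OF assms(2,3), of R] by (simp add: ideal_power_add assms(1))

lemma special_fiber_ring_simps:
  "carrier (special_fiber_ring S M I) = {f. (\<forall>n. f n \<in> (\<lambda>a. fiber_zero S M I n +>\<^bsub>S\<^esub> a) ` ideal_power S I n) \<and>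
                    finite {n. f n \<noteq> fiber_zero S M I n}}"
  "f \<otimes>\<^bsub>special_fiber_ring S M I\<^esub> g = (\<lambda>n. \<Union>a\<in>(\<Pi> i\<in>{..n}. f i). \<Union>b\<in>(\<Pi> i\<in>{..n}. g i).
                fiber_zero S M I n +>\<^bsub>S\<^esub> (\<Oplus>\<^bsub>S\<^esub>i\<in>{..n}. a i \<otimes>\<^bsub>S\<^esub> b (n - i)))"
  "\<one>\<^bsub>special_fiber_ring S M I\<^esub> = fiber_scalar S M I \<one>\<^bsub>S\<^esub>"
  "\<zero>\<^bsub>special_fiber_ring S M I\<^esub> = fiber_zero S M I"
  "f \<oplus>\<^bsub>special_fiber_ring S M I\<^esub> g = (\<lambda>n. f n <+>\<^bsub>S\<^esub> g n)"
  by (simp_all add: special_fiber_ring_def)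

text \<open>The Rees ring \<open>\<Oplus>\<^sub>n J\<^sup>n t\<^sup>n\<close> as a ring of univariate polynomials over \<open>k[V]\<close>, whose multiplication is the
  convolution that defines the product of the special fiber ring.\<close>

definition rees :: "'v set \<Rightarrow> ('v, 'k::field) mpol set \<Rightarrow> ('v, 'k) mpol poly ring" where
  "rees V J = \<lparr>carrier = {p. \<forall>n. coeff p n \<in> ideal_power (polyring V) J n},
               monoid.mult = (*), one = 1, zero = 0, add = (+)\<rparr>"

text \<open>The canonical map \<open>\<Oplus>\<^sub>n J\<^sup>n \<rightarrow> \<Oplus>\<^sub>n J\<^sup>n / M J\<^sup>n\<close>.\<close>

definition rees_class :: "'v set \<Rightarrow> ('v, 'k::field) mpol set \<Rightarrow> ('v, 'k) mpol set \<Rightarrow> ('v, 'k) mpol poly \<Rightarrow> nat \<Rightarrow> ('v, 'k) mpol set" where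
  "rees_class V M J p = (\<lambda>n. fiber_zero (polyring V) M J n +>\<^bsub>polyring V\<^esub> coeff p n)"

locale polyring_fiber =
  fixes V :: "'v set" and M J :: "('v, 'k::field) mpol set"
  assumes M: "ideal M (polyring V)" and J: "ideal J (polyring V)"
begin

abbreviation "S \<equiv> polyring V :: ('v, 'k) mpol ring"
abbreviation "A n \<equiv> ideal_power S J n"
abbreviation "Z n \<equiv> fiber_zero S M J n"
abbreviation "F \<equiv> special_fiber_ring S M J"

sublocale S: cring S by (rule polyring_cring)

lemma A: "ideal (A n) S" by (rule S.ideal_power_ideal[OF J])
lemma Z: "ideal (Z n) S" by (rule S.fiber_zero_ideal[OF M J])

lemma A_carrier: "x \<in> A n \<Longrightarrow> x \<in> carrier S"
  using ideal.Icarr[OF A] .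

lemma A_mult: "x \<in> A i \<Longrightarrow> y \<in> A j \<Longrightarrow> x * y \<in> A (i + j)"
  using S.ideal_power_mult[OF J, of x i y j] by simp

lemma A_add: "x \<in> A n \<Longrightarrow> y \<in> A n \<Longrightarrow> x + y \<in> A n"
  using additive_subgroup.a_closed[OF ideal.axioms(1)[OF A], of x n y] by simp

lemma A_zero: "0 \<in> A n"
  using additive_subgroup.zero_closed[OF ideal.axioms(1)[OF A], of n] by simp

lemma A_sum: "(\<And>i. i \<in> X \<Longrightarrow> f i \<in> A n) \<Longrightarrow> sum f X \<in> A n"
  by (induction X rule: infinite_finite_induct) (auto intro: A_add A_zero)

lemma A_uminus: "x \<in> A n \<Longrightarrow> - x \<in> A n"
  using additive_subgroup.a_inv_closed[OF ideal.axioms(1)[OF A], of x n] A_carrier[of x n]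
  by (simp add: polyring_minus)

lemma Z_A: "x \<in> Z n \<Longrightarrow> x \<in> A n"
  using S.fiber_zero_subset[OF M J] by blast

lemma Z_mult: "x \<in> Z i \<Longrightarrow> y \<in> A j \<Longrightarrow> x * y \<in> Z (i + j)"
  using S.fiber_zero_mult[OF M J, of x i y j] by simp

lemma Z_mult': "x \<in> A i \<Longrightarrow> y \<in> Z j \<Longrightarrow> x * y \<in> Z (i + j)"
  using Z_mult[of y j x i] by (simp add: mult.commute add.commute)

lemma Z_add: "x \<in> Z n \<Longrightarrow> y \<in> Z n \<Longrightarrow> x + y \<in> Z n"
  using additive_subgroup.a_closed[OF ideal.axioms(1)[OF Z], of x n y] by simp

lemma Z_zero: "0 \<in> Z n"
  using additive_subgroup.zero_closed[OF ideal.axioms(1)[OF Z], of n] by simp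

lemma Z_sum: "(\<And>i. i \<in> X \<Longrightarrow> f i \<in> Z n) \<Longrightarrow> sum f X \<in> Z n"
  by (induction X rule: infinite_finite_induct) (auto intro: Z_add Z_zero)

lemma Z_uminus: "x \<in> Z n \<Longrightarrow> - x \<in> Z n"
  using additive_subgroup.a_inv_closed[OF ideal.axioms(1)[OF Z], of x n] A_carrier[OF Z_A, of x n]
  by (simp add: polyring_minus)

lemma coset: "Z n +>\<^bsub>S\<^esub> a = (\<lambda>z. z + a) ` Z n"
  unfolding a_r_coset_def' by auto

lemma coset_eqI:
  assumes "x - y \<in> Z n" shows "Z n +>\<^bsub>S\<^esub> x = Z n +>\<^bsub>S\<^esub> y"
  unfolding coset
proof (intro equalityI image_subsetI)
  fix z assume z: "z \<in> Z n"
  show "z + x \<in> (\<lambda>z. z + y) ` Z n"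
    by (rule image_eqI[of _ _ "z + (x - y)"]) (use z assms Z_add in auto)
  show "z + y \<in> (\<lambda>z. z + x) ` Z n"
    by (rule image_eqI[of _ _ "z + - (x - y)"]) (use Z_add[OF z Z_uminus[OF assms]] in simp_all)
qed

lemma coset_zero: "Z n +>\<^bsub>S\<^esub> 0 = Z n"
  by (simp add: coset)

lemma rees_ring: "cring (rees V J)"
proof (rule cringI)
  show "abelian_group (rees V J)"
  proof (rule abelian_groupI)
    fix x assume "x \<in> carrier (rees V J)"
    then show "\<exists>y\<in>carrier (rees V J). y \<oplus>\<^bsub>rees V J\<^esub> x = \<zero>\<^bsub>rees V J\<^esub>"
      by (intro bexI[of _ "-x"]) (auto simp: rees_def intro: A_uminus)
  qed (auto simp: rees_def algebra_simps intro: A_add A_zero)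
  show "comm_monoid (rees V J)"
  proof (rule comm_monoidI)
    fix x y assume "x \<in> carrier (rees V J)" "y \<in> carrier (rees V J)"
    then have "coeff x i * coeff y (n - i) \<in> A n" if "i \<le> n" for n i
      using A_mult[of "coeff x i" i "coeff y (n - i)" "n - i"] that by (simp add: rees_def)
    then show "x \<otimes>\<^bsub>rees V J\<^esub> y \<in> carrier (rees V J)"
      by (auto simp: rees_def coeff_mult intro!: A_sum)
  qed (auto simp: rees_def algebra_simps coeff_1 intro: A_zero)
qed (auto simp: rees_def algebra_simps)

text \<open>The product in the fiber ring is a union over all choices of representatives. It has to be shown that all of
  these give the same coset: changing a representative of degree \<open>i\<close> by an element of \<open>M J\<^sup>i\<close> changes the product with an
  element of \<open>J\<^sup>n\<^sup>-\<^sup>i\<close> by an element of \<open>M J\<^sup>n\<close>.\<close>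

lemma rees_class_mult:
  assumes "p \<in> carrier (rees V J)" "q \<in> carrier (rees V J)"
  shows "rees_class V M J (p * q) = rees_class V M J p \<otimes>\<^bsub>F\<^esub> rees_class V M J q"
proof
  fix n
  let ?P = "\<Pi> i\<in>{..n}. rees_class V M J p i" and ?Q = "\<Pi> i\<in>{..n}. rees_class V M J q i"
  have pA: "coeff p i \<in> A i" and qA: "coeff q i \<in> A i" for i
    using assms by (auto simp: rees_def)
  have rep: "x - coeff r i \<in> Z i" if "x \<in> rees_class V M J r i" for x r i
    using that by (auto simp: rees_class_def coset)
  have self: "coeff r i \<in> rees_class V M J r i" for r i
    unfolding rees_class_def coset by (rule image_eqI[OF _ Z_zero]) simp
  have eq: "Z n +>\<^bsub>S\<^esub> (\<Oplus>\<^bsub>S\<^esub>i\<in>{..n}. a i \<otimes>\<^bsub>S\<^esub> b (n - i)) = rees_class V M J (p * q) n"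
    if a: "a \<in> ?P" and b: "b \<in> ?Q" for a b
  proof -
    have az: "a i - coeff p i \<in> Z i" and bz: "b i - coeff q i \<in> Z i" if "i \<le> n" for i
      using a b that by (auto intro!: rep)
    have aA: "a i \<in> A i" and bA: "b i \<in> A i" if "i \<le> n" for i
      using A_add[OF Z_A[OF az[OF that]] pA[of i]] A_add[OF Z_A[OF bz[OF that]] qA[of i]] by simp_all
    have "(\<Oplus>\<^bsub>S\<^esub>i\<in>{..n}. a i \<otimes>\<^bsub>S\<^esub> b (n - i)) = (\<Sum>i\<le>n. a i * b (n - i))"
      using A_carrier[OF aA] A_carrier[OF bA] by (subst polyring_finsum) auto
    moreover have "a i * b (n - i) - coeff p i * coeff q (n - i) \<in> Z n" if "i \<le> n" for i
    proof -
      have "a i * b (n - i) - coeff p i * coeff q (n - i)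
          = (a i - coeff p i) * b (n - i) + coeff p i * (b (n - i) - coeff q (n - i))"
        by (simp add: algebra_simps)
      moreover have "(a i - coeff p i) * b (n - i) \<in> Z n"
        using Z_mult[OF az bA, of i "n - i"] that by simp
      moreover have "coeff p i * (b (n - i) - coeff q (n - i)) \<in> Z n"
        using Z_mult'[OF pA bz, of "n - i" i] that by simp
      ultimately show ?thesis using Z_add by simp
    qed
    then have "(\<Sum>i\<le>n. a i * b (n - i)) - coeff (p * q) n \<in> Z n"
      unfolding coeff_mult sum_subtractf[symmetric] by (intro Z_sum) auto
    ultimately show ?thesis by (simp add: rees_class_def coset_eqI)
  qed
  have "coeff p \<in> ?P" "coeff q \<in> ?Q" using self by auto
  then have "(\<Union>a\<in>?P. \<Union>b\<in>?Q. Z n +>\<^bsub>S\<^esub> (\<Oplus>\<^bsub>S\<^esub>i\<in>{..n}. a i \<otimes>\<^bsub>S\<^esub> b (n - i)))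
      = rees_class V M J (p * q) n"
    using eq by blast
  then show "rees_class V M J (p * q) n = (rees_class V M J p \<otimes>\<^bsub>F\<^esub> rees_class V M J q) n"
    by (simp add: special_fiber_ring_simps)
qed

lemma rees_class_carrier:
  assumes "p \<in> carrier (rees V J)"
  shows "rees_class V M J p \<in> carrier F"
proof -
  have "{n. rees_class V M J p n \<noteq> Z n} \<subseteq> {..degree p}"
    by (auto simp: rees_class_def coset_zero intro: le_degree)
  then have "finite {n. rees_class V M J p n \<noteq> Z n}" by (rule finite_subset) simp
  then show ?thesis using assms by (auto simp: special_fiber_ring_simps rees_def rees_class_def)
qed

lemma rees_class_surj:
  assumes "f \<in> carrier F"
  shows "\<exists>p\<in>carrier (rees V J). rees_class V M J p = f"
proof -
  have "\<exists>a. a \<in> A n \<and> f n = Z n +>\<^bsub>S\<^esub> a \<and> (f n = Z n \<longrightarrow> a = 0)" for n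
  proof (cases "f n = Z n")
    case True
    then show ?thesis using A_zero coset_zero by (intro exI[of _ 0]) auto
  next
    case False
    then show ?thesis using assms by (auto simp: special_fiber_ring_simps)
  qed
  then obtain a where a: "\<And>n. a n \<in> A n" "\<And>n. f n = Z n +>\<^bsub>S\<^esub> a n" "\<And>n. f n = Z n \<Longrightarrow> a n = 0"
    by metis
  have "finite {n. f n \<noteq> Z n}" using assms by (simp add: special_fiber_ring_simps)
  then obtain N where N: "\<And>n. f n \<noteq> Z n \<Longrightarrow> n \<le> N" by (auto simp: finite_nat_set_iff_bounded_le)
  have "coeff (Abs_poly a) = a" by (rule coeff_Abs_poly[of N]) (use a(3) N in force)
  then show ?thesis using a by (intro bexI[of _ "Abs_poly a"]) (auto simp: rees_def rees_class_def)
qed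

lemma rees_class_hom: "rees_class V M J \<in> Ring.ring_hom (rees V J) F"
proof (rule ring_hom_memI)
  fix p q assume pq: "p \<in> carrier (rees V J)" "q \<in> carrier (rees V J)"
  show "rees_class V M J (p \<otimes>\<^bsub>rees V J\<^esub> q) = rees_class V M J p \<otimes>\<^bsub>F\<^esub> rees_class V M J q"
    using rees_class_mult[OF pq] by (simp add: rees_def)
  have "coeff p n \<in> carrier S" "coeff q n \<in> carrier S" for n
    using pq A_carrier by (auto simp: rees_def)
  then show "rees_class V M J (p \<oplus>\<^bsub>rees V J\<^esub> q) = rees_class V M J p \<oplus>\<^bsub>F\<^esub> rees_class V M J q"
    by (simp add: special_fiber_ring_simps rees_class_def rees_def ideal.a_rcos_sum[OF Z])
next
  have "rees_class V M J 1 = (Z(0 := Z 0 +>\<^bsub>S\<^esub> 1))"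
    by (auto simp: rees_class_def coset_zero fun_eq_iff)
  then show "rees_class V M J \<one>\<^bsub>rees V J\<^esub> = \<one>\<^bsub>F\<^esub>"
    by (simp add: special_fiber_ring_simps fiber_scalar_def rees_def)
qed (rule rees_class_carrier)

text \<open>The ring laws hold in the Rees ring and pass to its homomorphic image.\<close>

lemma fiber_cring: "cring F"
proof -
  interpret rees: cring "rees V J" by (rule rees_ring)
  have zero: "rees_class V M J \<zero>\<^bsub>rees V J\<^esub> = \<zero>\<^bsub>F\<^esub>"
    by (auto simp: rees_class_def rees_def special_fiber_ring_simps coset_zero)
  have img: "rees_class V M J ` carrier (rees V J) = carrier F"
    using rees_class_carrier rees_class_surj by blast
  have "ring (F\<lparr>carrier := carrier F, zero := \<zero>\<^bsub>F\<^esub>\<rparr>)"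
    using rees.ring_hom_imp_img_ring[OF rees_class_hom] by (simp add: zero img)
  then interpret F: ring F by simp
  show ?thesis
  proof
    fix x y assume "x \<in> carrier F" "y \<in> carrier F"
    then obtain p q where pq: "p \<in> carrier (rees V J)" "q \<in> carrier (rees V J)"
      "x = rees_class V M J p" "y = rees_class V M J q" using img by blast
    then show "x \<otimes>\<^bsub>F\<^esub> y = y \<otimes>\<^bsub>F\<^esub> x"
      using rees_class_mult[of p q] rees_class_mult[of q p] by (simp add: mult.commute)
  qed
qed

end

context ring_isomorphism
begin

lemma image_fiber_zero:
  assumes "ideal M R" "ideal J R"
  shows "h ` fiber_zero R M J n = fiber_zero S (h ` M) (h ` J) n"
  unfolding fiber_zero_def
  by (simp add: image_ideal_prod image_ideal_power ideal_subset R.ideal_power_ideal assms)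

lemma fiber_value_subset:
  assumes "ideal M R" "ideal J R" "f \<in> carrier (special_fiber_ring R M J)"
  shows "f n \<subseteq> carrier R"
proof -
  obtain a where "a \<in> ideal_power R J n" "f n = fiber_zero R M J n +>\<^bsub>R\<^esub> a"
    using assms(3) unfolding special_fiber_ring_simps by blast
  then show ?thesis
    using R.a_r_coset_subset_G ideal_subset[OF R.fiber_zero_ideal[OF assms(1,2)]]
      ideal_subset[OF R.ideal_power_ideal[OF assms(2)]] by blast
qed

lemma fiber_map_carrier:
  assumes M: "ideal M R" and J: "ideal J R" and f: "f \<in> carrier (special_fiber_ring R M J)"
  shows "(\<lambda>n. h ` f n) \<in> carrier (special_fiber_ring S (h ` M) (h ` J))"
  unfolding special_fiber_ring_simps
proof (intro CollectI conjI allI)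
  fix n
  obtain a where a: "a \<in> ideal_power R J n" "f n = fiber_zero R M J n +>\<^bsub>R\<^esub> a"
    using f unfolding special_fiber_ring_simps by blast
  then have "h ` f n = fiber_zero S (h ` M) (h ` J) n +>\<^bsub>S\<^esub> h a"
    using ideal_subset[OF R.fiber_zero_ideal[OF M J]] ideal_subset[OF R.ideal_power_ideal[OF J]]
    by (simp add: image_coset image_fiber_zero[OF M J, symmetric] subset_iff)
  moreover have "h a \<in> ideal_power S (h ` J) n" using a(1) image_ideal_power[OF J] by blast
  ultimately show "h ` f n \<in> (\<lambda>a. fiber_zero S (h ` M) (h ` J) n +>\<^bsub>S\<^esub> a) ` ideal_power S (h ` J) n"
    by blast
next
  have "{n. h ` f n \<noteq> fiber_zero S (h ` M) (h ` J) n} \<subseteq> {n. f n \<noteq> fiber_zero R M J n}"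
    by (auto simp: image_fiber_zero[OF M J, symmetric])
  then show "finite {n. h ` f n \<noteq> fiber_zero S (h ` M) (h ` J) n}"
    using f finite_subset unfolding special_fiber_ring_simps by blast
qed

lemma image_finsum:
  assumes "finite X" "\<And>i. i \<in> X \<Longrightarrow> f i \<in> carrier R"
  shows "h (\<Oplus>\<^bsub>R\<^esub>i\<in>X. f i) = (\<Oplus>\<^bsub>S\<^esub>i\<in>X. h (f i))"
  using assms by (induction X rule: finite_induct) (auto simp: R.finsum_insert S.finsum_insert Pi_def)

text \<open>Both sides are unions of cosets over choices of representatives. The choices on the right are the images of those
  on the left, up to values at indices greater than \<open>n\<close>, which do not enter the sum.\<close>

lemma fiber_map_mult:
  assumes M: "ideal M R" and J: "ideal J R" 
    and f: "f \<in> carrier (special_fiber_ring R M J)" and g: "g \<in> carrier (special_fiber_ring R M J)"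
  shows "h ` (f \<otimes>\<^bsub>special_fiber_ring R M J\<^esub> g) n =
    ((\<lambda>n. h ` f n) \<otimes>\<^bsub>special_fiber_ring S (h ` M) (h ` J)\<^esub> (\<lambda>n. h ` g n)) n"
proof -
  let ?Z = "fiber_zero R M J n" and ?Z' = "fiber_zero S (h ` M) (h ` J) n"
  let ?P = "\<Pi> i\<in>{..n}. f i" and ?Q = "\<Pi> i\<in>{..n}. g i"
  let ?P' = "\<Pi> i\<in>{..n}. h ` f i" and ?Q' = "\<Pi> i\<in>{..n}. h ` g i"
  let ?s = "\<lambda>a b. \<Oplus>\<^bsub>R\<^esub>i\<in>{..n}. a i \<otimes>\<^bsub>R\<^esub> b (n - i)" and ?s' = "\<lambda>a b. \<Oplus>\<^bsub>S\<^esub>i\<in>{..n}. a i \<otimes>\<^bsub>S\<^esub> b (n - i)"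
  have coset: "h ` (?Z +>\<^bsub>R\<^esub> ?s a b) = ?Z' +>\<^bsub>S\<^esub> ?s' (\<lambda>i. h (a i)) (\<lambda>i. h (b i))"
    if a: "a \<in> ?P" and b: "b \<in> ?Q" for a b
  proof -
    have car: "a i \<in> carrier R" "b i \<in> carrier R" if "i \<le> n" for i
      using Pi_mem[OF a, of i] Pi_mem[OF b, of i] that
        fiber_value_subset[OF M J f, of i] fiber_value_subset[OF M J g, of i] by auto
    have "h (?s a b) = (\<Oplus>\<^bsub>S\<^esub>i\<in>{..n}. h (a i \<otimes>\<^bsub>R\<^esub> b (n - i)))"
      using car by (intro image_finsum) auto
    also have "\<dots> = ?s' (\<lambda>i. h (a i)) (\<lambda>i. h (b i))"
      using car by (intro S.finsum_cong') auto
    finally have "h (?s a b) = ?s' (\<lambda>i. h (a i)) (\<lambda>i. h (b i))" .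
    moreover have "?s a b \<in> carrier R" using car by (intro R.finsum_closed) auto
    ultimately show ?thesis
      using ideal_subset[OF R.fiber_zero_ideal[OF M J]] image_coset image_fiber_zero[OF M J] by simp
  qed
  \<comment> \<open>A choice of representatives of the images comes from a choice of representatives.\<close>
  have lift: "\<exists>a\<in>(\<Pi> i\<in>{..n}. u i). \<forall>i\<le>n. a' i = h (a i)" if "a' \<in> (\<Pi> i\<in>{..n}. h ` u i)" for a' u
  proof -
    have "\<exists>x. x \<in> u i \<and> a' i = h x" if "i \<le> n" for i
      using \<open>a' \<in> _\<close> that by (auto dest!: Pi_mem)
    then obtain a where "\<And>i. i \<le> n \<Longrightarrow> a i \<in> u i \<and> a' i = h (a i)" by metis
    then show ?thesis by (intro bexI[of _ a]) auto
  qed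
  have "h ` (\<Union>a\<in>?P. \<Union>b\<in>?Q. ?Z +>\<^bsub>R\<^esub> ?s a b) = (\<Union>a\<in>?P. \<Union>b\<in>?Q. ?Z' +>\<^bsub>S\<^esub> ?s' (\<lambda>i. h (a i)) (\<lambda>i. h (b i)))"
    unfolding image_UN using coset by (intro SUP_cong refl) auto
  also have "\<dots> = (\<Union>a\<in>?P'. \<Union>b\<in>?Q'. ?Z' +>\<^bsub>S\<^esub> ?s' a b)"
  proof (intro equalityI subsetI)
    fix z assume "z \<in> (\<Union>a\<in>?P. \<Union>b\<in>?Q. ?Z' +>\<^bsub>S\<^esub> ?s' (\<lambda>i. h (a i)) (\<lambda>i. h (b i)))"
    then obtain a b where "a \<in> ?P" "b \<in> ?Q" "z \<in> ?Z' +>\<^bsub>S\<^esub> ?s' (\<lambda>i. h (a i)) (\<lambda>i. h (b i))" by blast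
    moreover from this have "(\<lambda>i. h (a i)) \<in> ?P'" "(\<lambda>i. h (b i)) \<in> ?Q'" by auto
    ultimately show "z \<in> (\<Union>a\<in>?P'. \<Union>b\<in>?Q'. ?Z' +>\<^bsub>S\<^esub> ?s' a b)" by blast
  next
    fix z assume "z \<in> (\<Union>a\<in>?P'. \<Union>b\<in>?Q'. ?Z' +>\<^bsub>S\<^esub> ?s' a b)"
    then obtain a' b' where ab': "a' \<in> ?P'" "b' \<in> ?Q'" "z \<in> ?Z' +>\<^bsub>S\<^esub> ?s' a' b'" by blast
    obtain a where a: "a \<in> ?P" "\<forall>i\<le>n. a' i = h (a i)" using lift[OF ab'(1)] by blast
    obtain b where b: "b \<in> ?Q" "\<forall>i\<le>n. b' i = h (b i)" using lift[OF ab'(2)] by blast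
    have car: "h (a i) \<in> carrier S" "h (b i) \<in> carrier S" if "i \<le> n" for i
      using Pi_mem[OF a(1), of i] Pi_mem[OF b(1), of i] that
        fiber_value_subset[OF M J f, of i] fiber_value_subset[OF M J g, of i] by auto
    have "?s' a' b' = ?s' (\<lambda>i. h (a i)) (\<lambda>i. h (b i))"
      using a(2) b(2) car by (intro S.finsum_cong') auto
    then show "z \<in> (\<Union>a\<in>?P. \<Union>b\<in>?Q. ?Z' +>\<^bsub>S\<^esub> ?s' (\<lambda>i. h (a i)) (\<lambda>i. h (b i)))"
      using ab'(3) a(1) b(1) by force
  qed
  finally show ?thesis by (simp add: special_fiber_ring_simps)
qed

lemma image_fiber_scalar:
  assumes "ideal M R" "ideal J R" "a \<in> carrier R"
  shows "(\<lambda>n. h ` fiber_scalar R M J a n) = fiber_scalar S (h ` M) (h ` J) (h a)"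
  using assms by (auto simp: fiber_scalar_def fun_eq_iff image_coset ideal_subset R.fiber_zero_ideal image_fiber_zero)

lemma fiber_iso:
  assumes M: "ideal M R" and J: "ideal J R"
  shows "(\<lambda>f n. h ` f n) \<in> ring_iso (special_fiber_ring R M J) (special_fiber_ring S (h ` M) (h ` J))"
proof (rule ring_iso_memI)
  let ?F = "special_fiber_ring R M J" and ?F' = "special_fiber_ring S (h ` M) (h ` J)"
  fix f g assume f: "f \<in> carrier ?F" and g: "g \<in> carrier ?F"
  show "(\<lambda>n. h ` (f \<otimes>\<^bsub>?F\<^esub> g) n) = (\<lambda>n. h ` f n) \<otimes>\<^bsub>?F'\<^esub> (\<lambda>n. h ` g n)"
    using fiber_map_mult[OF M J f g] by blast
  show "(\<lambda>n. h ` (f \<oplus>\<^bsub>?F\<^esub> g) n) = (\<lambda>n. h ` f n) \<oplus>\<^bsub>?F'\<^esub> (\<lambda>n. h ` g n)"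
    using fiber_value_subset[OF M J f] fiber_value_subset[OF M J g]
    by (simp add: special_fiber_ring_simps image_set_add)
next
  show "(\<lambda>n. h ` \<one>\<^bsub>special_fiber_ring R M J\<^esub> n) = \<one>\<^bsub>special_fiber_ring S (h ` M) (h ` J)\<^esub>"
    unfolding special_fiber_ring_simps using image_fiber_scalar[OF M J, of "\<one>\<^bsub>R\<^esub>"] by simp
  show "bij_betw (\<lambda>f n. h ` f n) (carrier (special_fiber_ring R M J)) (carrier (special_fiber_ring S (h ` M) (h ` J)))"
  proof (rule bij_betwI[where g = "\<lambda>f n. inv_h ` f n"])
    show "(\<lambda>f n. h ` f n) \<in> carrier (special_fiber_ring R M J) \<rightarrow> carrier (special_fiber_ring S (h ` M) (h ` J))"
      using fiber_map_carrier[OF M J] by auto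
    have "(\<lambda>n. inv_h ` f n) \<in> carrier (special_fiber_ring R M J)"
      if "f \<in> carrier (special_fiber_ring S (h ` M) (h ` J))" for f
      using ring_isomorphism.fiber_map_carrier[OF inverse image_ideal[OF M] image_ideal[OF J] that]
      by (simp add: ideal_subset M J)
    then show "(\<lambda>f n. inv_h ` f n) \<in> carrier (special_fiber_ring S (h ` M) (h ` J)) \<rightarrow> carrier (special_fiber_ring R M J)"
      by auto
    show "(\<lambda>n. inv_h ` h ` f n) = f" if "f \<in> carrier (special_fiber_ring R M J)" for f
      using fiber_value_subset[OF M J that] by simp
    show "(\<lambda>n. h ` inv_h ` f n) = f" if "f \<in> carrier (special_fiber_ring S (h ` M) (h ` J))" for f
      using ring_isomorphism.fiber_value_subset[OF inverse image_ideal[OF M] image_ideal[OF J] that] by simp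
  qed
qed (use fiber_map_carrier[OF M J] in auto)

end

section \<open>Relabeling of variables\<close>

definition relabel :: "('v \<Rightarrow> 'w) \<Rightarrow> ('v, 'k::field) mpol \<Rightarrow> ('w, 'k) mpol" where
  "relabel \<sigma> = push (push \<sigma>)"

lemma relabel_single [simp]: "relabel \<sigma> (Poly_Mapping.single t c) = Poly_Mapping.single (push \<sigma> t) c"
  by (simp add: relabel_def)

lemma relabel_pconst [simp]: "relabel \<sigma> (pconst c) = pconst c"
  by (simp add: pconst_def)

lemma relabel_pvar [simp]: "relabel \<sigma> (pvar v) = pvar (\<sigma> v)"
  by (simp add: pvar_def)

lemma relabel_mult: "relabel \<sigma> (p * q) = relabel \<sigma> p * relabel \<sigma> q"
  by (simp add: relabel_def push_mult push_add)

lemma push_exps: "\<sigma> ` V \<subseteq> W \<Longrightarrow> t \<in> exps V \<Longrightarrow> push \<sigma> t \<in> exps W"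
  using keys_push[of \<sigma> t] unfolding exps_def by blast

lemma relabel_closed:
  assumes "\<sigma> ` V \<subseteq> W" "p \<in> carrier (polyring V)"
  shows "relabel \<sigma> p \<in> carrier (polyring W)"
  unfolding in_polyring_iff
proof
  fix t assume "t \<in> Poly_Mapping.keys (relabel \<sigma> p)"
  then have "t \<in> push \<sigma> ` Poly_Mapping.keys p" using keys_push[of "push \<sigma>" p] by (auto simp: relabel_def)
  then obtain s where s: "s \<in> Poly_Mapping.keys p" "t = push \<sigma> s" by blast
  then have "s \<in> exps V" using assms(2) by (auto simp: in_polyring_iff)
  then show "t \<in> exps W" using push_exps[OF assms(1)] s(2) by simp
qed

lemma push_inverse:
  assumes "\<And>v. v \<in> V \<Longrightarrow> \<tau> (\<sigma> v) = v" "t \<in> exps V"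
  shows "push \<tau> (push \<sigma> t) = t"
  unfolding push_push using assms by (intro push_ident) (auto simp: exps_def)

lemma relabel_inverse:
  assumes "\<And>v. v \<in> V \<Longrightarrow> \<tau> (\<sigma> v) = v" "p \<in> carrier (polyring V)"
  shows "relabel \<tau> (relabel \<sigma> p) = p"
proof -
  have "relabel \<tau> (relabel \<sigma> p) = push (\<lambda>t. push \<tau> (push \<sigma> t)) p"
    unfolding relabel_def by (rule push_push)
  also have "\<dots> = p"
    using assms(2) push_inverse[of V \<tau> \<sigma>, OF assms(1)] by (intro push_ident) (auto simp: in_polyring_iff)
  finally show ?thesis .
qed

lemma relabel_isomorphism:
  fixes V :: "'v set" and W :: "'w set"
  assumes "bij_betw \<sigma> V W"
  shows "ring_isomorphism (polyring V) (polyring W) (relabel \<sigma> :: ('v, 'k::field) mpol \<Rightarrow> ('w, 'k) mpol)"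
proof (intro ring_isomorphism.intro polyring_cring ring_isomorphism_axioms.intro ring_iso_memI)
  let ?\<tau> = "inv_into V \<sigma>"
  have im: "\<sigma> ` V = W" and im': "?\<tau> ` W = V" using assms by (auto simp: bij_betw_def inj_on_image_eq_iff)
  show "bij_betw (relabel \<sigma>) (carrier (polyring V)) (carrier (polyring W :: ('w, 'k) mpol ring))"
  proof (rule bij_betwI[where g = "relabel ?\<tau>"])
    show "relabel ?\<tau> (relabel \<sigma> p) = p" if "p \<in> carrier (polyring V)" for p :: "('v, 'k) mpol"
      using assms by (intro relabel_inverse[OF _ that]) (simp add: bij_betw_inv_into_left)
    show "relabel \<sigma> (relabel ?\<tau> p) = p" if "p \<in> carrier (polyring W)" for p :: "('w, 'k) mpol"
      using assms by (intro relabel_inverse[OF _ that]) (simp add: bij_betw_inv_into_right)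
  qed (intro Pi_I relabel_closed; simp add: im im')+
  show "relabel \<sigma> \<one>\<^bsub>polyring V\<^esub> = (\<one>\<^bsub>polyring W\<^esub> :: ('w, 'k) mpol)"
    using relabel_single[of \<sigma> 0 1] by simp
qed (use assms in \<open>auto simp: relabel_mult bij_betw_def intro: relabel_closed\<close>,
     simp add: relabel_def push_add)

lemma mdeg_push [simp]: "mdeg (push h t) = mdeg t"
  by (induction t rule: poly_mapping_single_induct) (auto simp: push_add)

lemma relabel_max_hom_ideal:
  fixes V :: "'v set" and W :: "'w set"
  assumes "bij_betw \<sigma> V W"
  shows "relabel \<sigma> ` max_hom_ideal V = (max_hom_ideal W :: ('w, 'k::field) mpol set)"
proof -
  interpret ring_isomorphism "polyring V :: ('v, 'k) mpol ring" "polyring W" "relabel \<sigma>"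
    by (rule relabel_isomorphism[OF assms])
  have "pvar ` V \<subseteq> carrier (polyring V :: ('v, 'k) mpol ring)" by (auto simp: pvar_def)
  moreover have "relabel \<sigma> ` pvar ` V = (pvar ` W :: ('w, 'k) mpol set)"
    using assms by (auto simp: bij_betw_def image_image)
  ultimately show ?thesis unfolding max_hom_ideal_def by (simp add: image_genideal)
qed

lemma relabel_monid:
  fixes V :: "'v set" and W :: "'w set"
  assumes "bij_betw \<sigma> V W" "E \<subseteq> exps V"
  shows "relabel \<sigma> ` monid V E = (monid W (push \<sigma> ` E) :: ('w, 'k::field) mpol set)"
proof -
  interpret ring_isomorphism "polyring V :: ('v, 'k) mpol ring" "polyring W" "relabel \<sigma>"
    by (rule relabel_isomorphism[OF assms(1)])
  have "(\<lambda>e. Poly_Mapping.single e 1) ` E \<subseteq> carrier (polyring V :: ('v, 'k) mpol ring)"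
    using assms by auto
  moreover have "push \<sigma> ` E \<subseteq> exps W" using assms push_exps[of \<sigma> V W] by (auto simp: bij_betw_def)
  ultimately show ?thesis
    using assms by (simp add: monid_genideal[symmetric] image_genideal image_image)
qed

section \<open>Minimal monomial generators in a single degree\<close>

text \<open>A generator \<open>e \<in> E\<close> is a multiple of some \<open>e' \<in> E'\<close>, which in turn is a multiple of some element of \<open>E\<close>.
  Since this element has the same degree as \<open>e\<close>, all three coincide.\<close>

lemma monid_eq_equigenerated:
  assumes "E \<subseteq> exps V" "E' \<subseteq> exps V" "\<And>e. e \<in> E \<Longrightarrow> mdeg e = d"
    and "monid V E = (monid V E' :: ('v, 'k::field) mpol set)"
  shows "E \<subseteq> E'"
proof
  fix e assume e: "e \<in> E"
  have mem: "(Poly_Mapping.single e 1 :: ('v, 'k) mpol) \<in> monid V X" if "e \<in> X" for e X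
    using that exps_zero[of V] by (force simp: monid_single)
  have "(Poly_Mapping.single e 1 :: ('v, 'k) mpol) \<in> monid V E'" using mem[OF e] assms(4) by simp
  then obtain e' s where e': "e' \<in> E'" "e = e' + s" by (auto simp: monid_single)
  have "(Poly_Mapping.single e' 1 :: ('v, 'k) mpol) \<in> monid V E" using mem[OF e'(1)] assms(4) by simp
  then obtain e'' s' where e'': "e'' \<in> E" "e' = e'' + s'" by (auto simp: monid_single)
  have "mdeg e = d" "mdeg e'' = d" using e e'' assms(3) by auto
  then have "mdeg s = 0" using e' e'' by simp
  then show "e \<in> E'" using e' by simp
qed

text \<open>Every set of monomial generators contains the monomials with exponents in \<open>E\<close>, and these already generate.\<close>

lemma min_mon_gens_equigenerated:
  assumes "E \<subseteq> exps V" "\<And>e. e \<in> E \<Longrightarrow> mdeg e = d"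
  shows "min_mon_gens V (monid V E :: ('v, 'k::field) mpol set) G \<longleftrightarrow> G = (\<lambda>e. Poly_Mapping.single e 1) ` E"
proof -
  let ?m = "\<lambda>e. Poly_Mapping.single e 1 :: ('v, 'k) mpol"
  have exps_of: "\<exists>E'\<subseteq>exps V. H = ?m ` E'" if "H \<subseteq> monomials V" for H
  proof -
    let ?E = "{t \<in> exps V. ?m t \<in> H}"
    have "H = ?m ` ?E" using that by (auto simp: monomials_def exps_def)
    moreover have "?E \<subseteq> exps V" by auto
    ultimately show ?thesis by (intro exI[of _ ?E] conjI)
  qed
  have mon: "?m ` E \<subseteq> monomials V" using assms(1) by (auto simp: monomials_def exps_def)
  show ?thesis
  proof
    assume G: "min_mon_gens V (monid V E) G"
    then have "G \<subseteq> monomials V" by (simp add: min_mon_gens_def)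
    from exps_of[OF this] obtain E' where E': "E' \<subseteq> exps V" "G = ?m ` E'" by (elim exE conjE)
    then have "monid V E = (monid V E' :: ('v, 'k) mpol set)"
      using G by (simp add: min_mon_gens_def monid_genideal)
    then have "?m ` E \<subseteq> G" using monid_eq_equigenerated[OF assms(1) E'(1) assms(2)] E'(2) by blast
    moreover have "\<not> ?m ` E \<subset> G"
    proof
      assume "?m ` E \<subset> G"
      moreover have "\<forall>H. H \<subset> G \<longrightarrow> Idl\<^bsub>polyring V\<^esub> H \<noteq> monid V E"
        using G unfolding min_mon_gens_def by (elim conjE)
      ultimately have "Idl\<^bsub>polyring V\<^esub> (?m ` E) \<noteq> monid V E" by (elim allE impE)
      then show False using monid_genideal[OF assms(1)] by (rule notE)
    qed
    ultimately show "G = ?m ` E" by blast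
  next
    assume G: "G = ?m ` E"
    have "Idl\<^bsub>polyring V\<^esub> H \<noteq> monid V E" if H: "H \<subset> ?m ` E" for H
    proof
      assume eq: "Idl\<^bsub>polyring V\<^esub> H = monid V E"
      have "H \<subseteq> monomials V" using H mon by auto
      from exps_of[OF this] obtain E' where E': "E' \<subseteq> exps V" "H = ?m ` E'" by (elim exE conjE)
      then have "monid V E = (monid V E' :: ('v, 'k) mpol set)" using eq by (simp add: monid_genideal)
      then have "?m ` E \<subseteq> H" using monid_eq_equigenerated[OF assms(1) E'(1) assms(2)] E'(2) by blast
      then show False using H by blast
    qed
    then show "min_mon_gens V (monid V E) G"
      unfolding min_mon_gens_def G by (intro conjI allI impI mon monid_genideal[OF assms(1)])
  qed
qed

lemma mu_equigenerated:
  assumes "E \<subseteq> exps V" "\<And>e. e \<in> E \<Longrightarrow> mdeg e = d"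
  shows "mu V (monid V E :: ('v, 'k::field) mpol set) = card E"
proof -
  have "inj_on (\<lambda>e. Poly_Mapping.single e (1::'k)) E"
  proof (rule inj_onI)
    fix s t assume "Poly_Mapping.single s (1::'k) = Poly_Mapping.single t 1"
    then have "Poly_Mapping.keys (Poly_Mapping.single s (1::'k)) = Poly_Mapping.keys (Poly_Mapping.single t (1::'k))" by simp
    then show "s = t" by simp
  qed
  then show ?thesis by (simp add: mu_def min_mon_gens_equigenerated[OF assms] card_image)
qed

lemma mu_relabel:
  fixes V :: "'v set" and W :: "'w set"
  assumes \<sigma>: "bij_betw \<sigma> V W" and E: "E \<subseteq> exps V" "\<And>e. e \<in> E \<Longrightarrow> mdeg e = d"
  shows "mu W (relabel \<sigma> ` monid V E :: ('w, 'k::field) mpol set) = mu V (monid V E :: ('v, 'k) mpol set)"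
proof -
  have W: "push \<sigma> ` E \<subseteq> exps W" using E(1) \<sigma> push_exps[of \<sigma> V W] by (auto simp: bij_betw_def)
  have "inj_on (push \<sigma>) E"
    using push_inverse[of V "inv_into V \<sigma>" \<sigma>] \<sigma> E(1)
    by (intro inj_on_inverseI[of _ "push (inv_into V \<sigma>)"]) (auto simp: bij_betw_inv_into_left)
  moreover have "mu W (monid W (push \<sigma> ` E) :: ('w, 'k) mpol set) = card (push \<sigma> ` E)"
    using E(2) by (intro mu_equigenerated[OF W, of d]) auto
  ultimately show ?thesis
    by (simp add: relabel_monid[OF \<sigma> E(1)] mu_equigenerated[OF E] card_image)
qed

section \<open>Relabeling of the special fiber ring\<close>

lemma max_hom_ideal_ideal: "ideal (max_hom_ideal V) (polyring V :: ('v, 'k::field) mpol ring)"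
  unfolding max_hom_ideal_monid by (rule monid_ideal) auto

text \<open>Besides the ideal, a relabeling of the variables respects the homogeneous maximal ideal.\<close>

lemma fiber_ring_isomorphism:
  assumes \<sigma>: "bij_betw \<sigma> V W" and I: "ideal I (polyring V :: ('v, 'k::field) mpol ring)"
  shows "ring_isomorphism (fiber_ring V I) (fiber_ring W (relabel \<sigma> ` I)) (\<lambda>f n. relabel \<sigma> ` f n)"
proof -
  interpret ring_isomorphism "polyring V :: ('v, 'k) mpol ring" "polyring W" "relabel \<sigma>"
    by (rule relabel_isomorphism[OF \<sigma>])
  show ?thesis
    unfolding fiber_ring_def
    using fiber_iso[OF max_hom_ideal_ideal I] max_hom_ideal_ideal[of V] max_hom_ideal_ideal[of W] image_ideal[OF I] I
    by (intro ring_isomorphism.intro ring_isomorphism_axioms.intro polyring_fiber.fiber_cring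
        polyring_fiber.intro) (auto simp: relabel_max_hom_ideal[OF \<sigma>])
qed

lemma analytic_spread_relabel:
  assumes "bij_betw \<sigma> V W" "ideal I (polyring V :: ('v, 'k::field) mpol ring)"
  shows "analytic_spread W (relabel \<sigma> ` I) = analytic_spread V I"
  unfolding analytic_spread_def by (rule ring_isomorphism.krull_dim_eq[OF fiber_ring_isomorphism[OF assms]])

lemma hilbert_function_relabel:
  assumes \<sigma>: "bij_betw \<sigma> V W" and I: "ideal I (polyring V :: ('v, 'k::field) mpol ring)"
  shows "hilbert_function W (relabel \<sigma> ` I) n = hilbert_function V I n"
proof -
  interpret poly: ring_isomorphism "polyring V :: ('v, 'k) mpol ring" "polyring W" "relabel \<sigma>"
    by (rule relabel_isomorphism[OF \<sigma>])
  let ?F = "\<lambda>f n. relabel \<sigma> ` f n"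
  interpret fib: ring_isomorphism "fiber_ring V I" "fiber_ring W (relabel \<sigma> ` I)" ?F
    by (rule fiber_ring_isomorphism[OF assms])
  have const: "pconst c \<in> carrier (polyring V :: ('v, 'k) mpol ring)" for c
    by (simp add: pconst_def)
  have scalar: "?F (fiber_scalar (polyring V) (max_hom_ideal V) I (pconst c)) =
      fiber_scalar (polyring W) (max_hom_ideal W) (relabel \<sigma> ` I) (pconst c)" for c
    using poly.image_fiber_scalar[OF max_hom_ideal_ideal I const] by (simp add: relabel_max_hom_ideal[OF \<sigma>])
  have field: "?F ` fiber_field V I = fiber_field W (relabel \<sigma> ` I)"
    unfolding fiber_field_def image_image scalar ..
  interpret fiber: polyring_fiber V "max_hom_ideal V" I
    by (intro polyring_fiber.intro max_hom_ideal_ideal I)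
  \<comment> \<open>Scalars are the classes of constant elements of the Rees ring.\<close>
  have field_carrier: "fiber_field V I \<subseteq> carrier (fiber_ring V I)"
  proof -
    have "fiber_scalar (polyring V) (max_hom_ideal V) I a = rees_class V (max_hom_ideal V) I [:a:]" for a
      by (auto simp: fiber_scalar_def rees_class_def fun_eq_iff coeff_pCons fiber.coset_zero split: nat.split)
    moreover have "[:pconst c:] \<in> carrier (rees V I)" for c
      using const by (auto simp: rees_def coeff_pCons fiber.A_zero simp del: ideal_power_Suc split: nat.split)
    ultimately show ?thesis
      unfolding fiber_field_def fiber_ring_def using fiber.rees_class_carrier by auto
  qed
  have zero: "\<zero>\<^bsub>fiber_ring W (relabel \<sigma> ` I)\<^esub> i = relabel \<sigma> ` \<zero>\<^bsub>fiber_ring V I\<^esub> i" for i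
    using fun_cong[OF fib.zero, of i] by simp
  have sub: "f i \<subseteq> carrier (polyring V)" if "f \<in> carrier (fiber_ring V I)" for f i
    using poly.fiber_value_subset[OF max_hom_ideal_ideal I] that by (simp add: fiber_ring_def)
  have "?F f \<in> fiber_component W (relabel \<sigma> ` I) n \<longleftrightarrow> f \<in> fiber_component V I n"
    if f: "f \<in> carrier (fiber_ring V I)" for f
  proof -
    have "relabel \<sigma> ` f i = relabel \<sigma> ` \<zero>\<^bsub>fiber_ring V I\<^esub> i \<longleftrightarrow> f i = \<zero>\<^bsub>fiber_ring V I\<^esub> i" for i
      by (rule poly.image_inj[OF sub[OF f] sub]) (rule fib.R.zero_closed)
    then show ?thesis using f fib.closed[OF f] by (simp add: fiber_component_def zero)
  qed
  moreover have "fiber_component W (relabel \<sigma> ` I) n \<subseteq> ?F ` carrier (fiber_ring V I)"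
    unfolding fib.image_carrier by (auto simp: fiber_component_def)
  moreover have comp_carrier: "fiber_component V I n \<subseteq> carrier (fiber_ring V I)"
    by (auto simp: fiber_component_def)
  ultimately have comp: "?F ` fiber_component V I n = fiber_component W (relabel \<sigma> ` I) n" by blast
  show ?thesis
    unfolding hilbert_function_def using fib.dim_eq[OF field_carrier comp_carrier]
    by (simp add: field comp)
qed

section \<open>Graph isomorphisms\<close>

text \<open>A graph is a record without restrictions on its edges; all graphs considered here satisfy this one.\<close>

definition edges_wf :: "'v sgraph \<Rightarrow> bool" where
  "edges_wf G \<longleftrightarrow> (\<forall>e\<in>edges G. \<exists>u\<in>vertices G. \<exists>v\<in>vertices G. e = {u, v})"

lemma sgraph_iso_inverse:
  assumes "sgraph_iso G H f"
  shows "sgraph_iso H G (inv_into (vertices G) f)"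
proof -
  let ?g = "inv_into (vertices G) f"
  have bij: "bij_betw f (vertices G) (vertices H)" using assms by (simp add: sgraph_iso_def)
  have "?g x \<in> vertices G" "f (?g x) = x" if "x \<in> vertices H" for x
    using that bij by (auto simp: bij_betw_def inv_into_into f_inv_into_f)
  then show ?thesis
    using assms bij_betw_inv_into[OF bij] unfolding sgraph_iso_def by simp
qed

lemma image_vertex_cover:
  assumes iso: "sgraph_iso G H f" and H: "edges_wf H" and C: "vertex_cover G C"
  shows "vertex_cover H (f ` C)"
  unfolding vertex_cover_def
proof (intro conjI ballI)
  have im: "f ` vertices G = vertices H" using iso by (simp add: sgraph_iso_def bij_betw_def)
  show "f ` C \<subseteq> vertices H" using C im by (auto simp: vertex_cover_def)
  fix e assume e: "e \<in> edges H"
  obtain x y where xy: "x \<in> f ` vertices G" "y \<in> f ` vertices G" "e = {x, y}"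
    using H e unfolding edges_wf_def im by blast
  obtain u v where "u \<in> vertices G" "v \<in> vertices G" "x = f u" "y = f v"
    using xy(1,2) by (elim imageE)
  then have uv: "u \<in> vertices G" "v \<in> vertices G" "e = {f u, f v}" using xy(3) by auto
  then have "{u, v} \<in> edges G" using iso e by (simp add: sgraph_iso_def)
  then have "{u, v} \<inter> C \<noteq> {}" using C unfolding vertex_cover_def by blast
  then show "e \<inter> f ` C \<noteq> {}" unfolding uv by auto
qed

lemma image_min_vertex_cover:
  assumes iso: "sgraph_iso G H f" and G: "edges_wf G" and H: "edges_wf H"
    and C: "C \<in> min_vertex_covers G"
  shows "f ` C \<in> min_vertex_covers H"
proof -
  let ?g = "inv_into (vertices G) f"
  have bij: "bij_betw f (vertices G) (vertices H)" using iso by (simp add: sgraph_iso_def)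
  have cov: "vertex_cover G C" and min: "\<And>C'. C' \<subset> C \<Longrightarrow> \<not> vertex_cover G C'"
    using C by (auto simp: min_vertex_covers_def)
  have CV: "C \<subseteq> vertices G" using cov by (simp add: vertex_cover_def)
  have gf: "?g ` f ` C = C" using CV bij by (simp add: bij_betw_def)
  have "\<not> vertex_cover H C'" if "C' \<subset> f ` C" for C'
  proof
    assume "vertex_cover H C'"
    then have "vertex_cover G (?g ` C')" by (rule image_vertex_cover[OF sgraph_iso_inverse[OF iso] G])
    moreover have "?g ` C' \<subset> C"
    proof -
      have "f ` C \<subseteq> vertices H" using CV bij by (auto simp: bij_betw_def)
      moreover have "inj_on ?g (vertices H)" using bij_betw_inv_into[OF bij] by (simp add: bij_betw_def)
      ultimately have "?g ` C' \<noteq> ?g ` f ` C"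
        using that inj_on_image_eq_iff[of ?g "vertices H" C' "f ` C"] by blast
      then show ?thesis using that gf by blast
    qed
    ultimately show False using min by blast
  qed
  then show ?thesis using image_vertex_cover[OF iso H cov] by (simp add: min_vertex_covers_def)
qed

lemma card_min_vertex_covers:
  assumes iso: "sgraph_iso G H f" and G: "edges_wf G" and H: "edges_wf H"
  shows "card (min_vertex_covers G) = card (min_vertex_covers H)"
proof (rule bij_betw_same_card[of "image f"], rule bij_betwI[where g = "image (inv_into (vertices G) f)"])
  let ?g = "inv_into (vertices G) f"
  have bij: "bij_betw f (vertices G) (vertices H)" using iso by (simp add: sgraph_iso_def)
  show "image f \<in> min_vertex_covers G \<rightarrow> min_vertex_covers H"
    using image_min_vertex_cover[OF iso G H] by auto
  show "image ?g \<in> min_vertex_covers H \<rightarrow> min_vertex_covers G"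
    using image_min_vertex_cover[OF sgraph_iso_inverse[OF iso] H G] by auto
  show "?g ` f ` C = C" if "C \<in> min_vertex_covers G" for C
    using that bij by (simp add: min_vertex_covers_def vertex_cover_def bij_betw_def)
  show "f ` ?g ` C = C" if "C \<in> min_vertex_covers H" for C
    using that bij by (intro image_inv_into_cancel) (auto simp: min_vertex_covers_def vertex_cover_def bij_betw_def)
qed

text \<open>The generators of the edge ideals are indexed by ordered pairs of adjacent vertices, which the isomorphism
  of graphs puts into correspondence.\<close>

lemma relabel_edge_ideal:
  fixes G :: "'v sgraph" and H :: "'w sgraph"
  assumes iso: "sgraph_iso G H \<sigma>" and G: "edges_wf G" and H: "edges_wf H"
  shows "relabel \<sigma> ` edge_ideal G = (edge_ideal H :: ('w, 'k::field) mpol set)"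
proof -
  have bij: "bij_betw \<sigma> (vertices G) (vertices H)" using iso by (simp add: sgraph_iso_def)
  interpret rel: ring_isomorphism "polyring (vertices G) :: ('v, 'k) mpol ring" "polyring (vertices H)" "relabel \<sigma>"
    by (rule relabel_isomorphism[OF bij])
  have vG: "u \<in> vertices G" "v \<in> vertices G" if "{u, v} \<in> edges G" for u v
    using G that unfolding edges_wf_def by (auto simp: doubleton_eq_iff)
  have vH: "u \<in> vertices H" "v \<in> vertices H" if "{u, v} \<in> edges H" for u v
    using H that unfolding edges_wf_def by (auto simp: doubleton_eq_iff)
  let ?GG = "{pvar u * pvar v | u v. {u, v} \<in> edges G} :: ('v, 'k) mpol set"
  have "?GG \<subseteq> carrier (polyring (vertices G))"
    using vG by (auto simp: pvar_def)
  moreover have "relabel \<sigma> ` ?GG = {pvar u * pvar v | u v. {u, v} \<in> edges H}"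
  proof (intro equalityI subsetI)
    fix p assume "p \<in> relabel \<sigma> ` ?GG"
    then obtain u v where uv: "{u, v} \<in> edges G" "p = pvar (\<sigma> u) * pvar (\<sigma> v)" by (auto simp: relabel_mult)
    then have "{\<sigma> u, \<sigma> v} \<in> edges H" using iso vG[OF uv(1)] by (simp add: sgraph_iso_def)
    then show "p \<in> {pvar u * pvar v | u v. {u, v} \<in> edges H}" using uv by blast
  next
    fix p :: "('w, 'k) mpol" assume "p \<in> {pvar u * pvar v | u v. {u, v} \<in> edges H}"
    then obtain x y where xy: "{x, y} \<in> edges H" "p = pvar x * pvar y" by blast
    have "x \<in> \<sigma> ` vertices G" "y \<in> \<sigma> ` vertices G"
      using vH[OF xy(1)] bij by (auto simp: bij_betw_def)
    then obtain u v where uv: "u \<in> vertices G" "v \<in> vertices G" "x = \<sigma> u" "y = \<sigma> v"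
      by (elim imageE)
    then have "{u, v} \<in> edges G" using iso xy(1) by (simp add: sgraph_iso_def)
    then show "p \<in> relabel \<sigma> ` ?GG" using uv xy(2)
      by (intro image_eqI[of _ _ "pvar u * pvar v"]) (auto simp: relabel_mult)
  qed
  ultimately show ?thesis unfolding edge_ideal_def by (simp add: rel.image_genideal)
qed

section \<open>Prime ideal graphs\<close>

text \<open>Each element of \<open>P\<close> is a part of its own, labeled by itself. The other elements form one
  part, which can be labeled by \<open>1\<close> since \<open>1 \<notin> P\<close>.\<close>

lemma prime_ideal_graph_multipartite:
  assumes "primeideal P R"
  shows "prime_ideal_graph R P = multipartite (carrier R - {\<zero>\<^bsub>R\<^esub>}) (\<lambda>x. if x \<in> P then x else \<one>\<^bsub>R\<^esub>)"
proof -
  interpret primeideal P R by fact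
  have one: "\<one>\<^bsub>R\<^esub> \<notin> P" using I_notcarr one_imp_carrier by blast
  have "x \<noteq> y \<and> x \<otimes>\<^bsub>R\<^esub> y \<in> P \<longleftrightarrow> (if x \<in> P then x else \<one>\<^bsub>R\<^esub>) \<noteq> (if y \<in> P then y else \<one>\<^bsub>R\<^esub>)"
    if "x \<in> carrier R" "y \<in> carrier R" for x y
    using that one I_prime[OF that] I_l_closed[of y x] I_r_closed[of x y] by auto
  then have "(x \<in> carrier R - {\<zero>\<^bsub>R\<^esub>} \<and> y \<in> carrier R - {\<zero>\<^bsub>R\<^esub>} \<and> x \<noteq> y \<and> x \<otimes>\<^bsub>R\<^esub> y \<in> P) \<longleftrightarrow>
      (x \<in> carrier R - {\<zero>\<^bsub>R\<^esub>} \<and> y \<in> carrier R - {\<zero>\<^bsub>R\<^esub>} \<and>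
        (if x \<in> P then x else \<one>\<^bsub>R\<^esub>) \<noteq> (if y \<in> P then y else \<one>\<^bsub>R\<^esub>))" for x y
    by blast
  then show ?thesis unfolding prime_ideal_graph_def multipartite_def by (simp only:)
qed

lemma multipartite_simps [simp]:
  "vertices (multipartite V \<pi>) = V"
  "{u, v} \<in> edges (multipartite V \<pi>) \<longleftrightarrow> u \<in> V \<and> v \<in> V \<and> \<pi> u \<noteq> \<pi> v"
  by (auto simp: multipartite_def doubleton_eq_iff)

lemma multipartite_wf: "edges_wf (multipartite V \<pi>)"
  by (auto simp: edges_wf_def multipartite_def)

lemma (in ideal) card_carrier_quotient:
  assumes "finite (carrier R)"
  shows "card (carrier R) = card (carrier (R Quot I)) * card I"
proof -
  have "card (rcosets\<^bsub>add_monoid R\<^esub> I) * card I = Coset.order (add_monoid R)"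
    using assms by (intro group.lagrange_finite additive_subgroup.a_subgroup) (auto intro: is_additive_subgroup add.is_group)
  then show ?thesis by (simp add: FactRing_def A_RCOSETS_def Coset.order_def)
qed

text \<open>Any two bijections \<open>P - {0} \<rightarrow> P' - {0}\<close> and \<open>R - P \<rightarrow> R' - P'\<close> combine to an isomorphism, because adjacency
  only depends on membership in the prime ideal. The second bijection exists since \<open>|R| = |R/P| |P|\<close>.\<close>

lemma prime_ideal_graph_iso:
  fixes R :: "('a, 'm) ring_scheme" and R' :: "('b, 'n) ring_scheme"
  assumes P: "primeideal P R" and P': "primeideal P' R'"
    and fin: "finite (carrier R)" "finite (carrier R')"
    and card: "card P = card P'" "card (carrier (R Quot P)) = card (carrier (R' Quot P'))"
  shows "\<exists>f. sgraph_iso (prime_ideal_graph R P) (prime_ideal_graph R' P') f"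
proof -
  interpret P: primeideal P R by fact
  interpret P': primeideal P' R' by fact
  have sub: "P \<subseteq> carrier R" "P' \<subseteq> carrier R'" by (rule P.a_subset, rule P'.a_subset)
  have finP: "finite P" "finite P'" using sub fin by (auto intro: finite_subset)
  have zero: "\<zero>\<^bsub>R\<^esub> \<in> P" "\<zero>\<^bsub>R'\<^esub> \<in> P'" by simp_all
  have one: "\<one>\<^bsub>R\<^esub> \<notin> P" "\<one>\<^bsub>R'\<^esub> \<notin> P'"
    using P.I_notcarr P.one_imp_carrier P'.I_notcarr P'.one_imp_carrier by blast+
  have "card (P - {\<zero>\<^bsub>R\<^esub>}) = card (P' - {\<zero>\<^bsub>R'\<^esub>})" using card(1) zero by simp
  from finite_same_card_bij[OF _ _ this] obtain f1 where f1: "bij_betw f1 (P - {\<zero>\<^bsub>R\<^esub>}) (P' - {\<zero>\<^bsub>R'\<^esub>})"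
    using finP by auto
  have "card (carrier R) = card (carrier R')"
    using P.card_carrier_quotient P'.card_carrier_quotient fin card by simp
  then have "card (carrier R - P) = card (carrier R' - P')"
    using sub finP card(1) by (simp add: card_Diff_subset)
  from finite_same_card_bij[OF _ _ this] obtain f2 where f2: "bij_betw f2 (carrier R - P) (carrier R' - P')"
    using fin by auto
  define f where "f x = (if x \<in> P then f1 x else f2 x)" for x
  have "bij_betw f (P - {\<zero>\<^bsub>R\<^esub>}) (P' - {\<zero>\<^bsub>R'\<^esub>})"
    using f1 by (subst bij_betw_cong[of _ f f1]) (auto simp: f_def)
  moreover have "bij_betw f (carrier R - P) (carrier R' - P')"
    using f2 by (subst bij_betw_cong[of _ f f2]) (auto simp: f_def)
  ultimately have "bij_betw f ((P - {\<zero>\<^bsub>R\<^esub>}) \<union> (carrier R - P)) ((P' - {\<zero>\<^bsub>R'\<^esub>}) \<union> (carrier R' - P'))"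
    by (rule bij_betw_combine) auto
  moreover have "(P - {\<zero>\<^bsub>R\<^esub>}) \<union> (carrier R - P) = carrier R - {\<zero>\<^bsub>R\<^esub>}"
    "(P' - {\<zero>\<^bsub>R'\<^esub>}) \<union> (carrier R' - P') = carrier R' - {\<zero>\<^bsub>R'\<^esub>}" using sub zero by auto
  ultimately have bij: "bij_betw f (carrier R - {\<zero>\<^bsub>R\<^esub>}) (carrier R' - {\<zero>\<^bsub>R'\<^esub>})" by simp
  have fP: "f x \<in> P' \<longleftrightarrow> x \<in> P" if "x \<in> carrier R - {\<zero>\<^bsub>R\<^esub>}" for x
    using that f1 f2 by (auto simp: f_def bij_betw_def)
  have inj: "f x = f y \<longleftrightarrow> x = y" if "x \<in> carrier R - {\<zero>\<^bsub>R\<^esub>}" "y \<in> carrier R - {\<zero>\<^bsub>R\<^esub>}" for x y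
    using bij that by (auto simp: bij_betw_def inj_on_def)
  have closed: "f x \<in> carrier R' - {\<zero>\<^bsub>R'\<^esub>}" if "x \<in> carrier R - {\<zero>\<^bsub>R\<^esub>}" for x
    using bij that by (auto simp: bij_betw_def)
  have "sgraph_iso (prime_ideal_graph R P) (prime_ideal_graph R' P') f"
    unfolding sgraph_iso_def prime_ideal_graph_multipartite[OF P] prime_ideal_graph_multipartite[OF P'] multipartite_simps
  proof (intro conjI ballI bij)
    fix u v assume uv: "u \<in> carrier R - {\<zero>\<^bsub>R\<^esub>}" "v \<in> carrier R - {\<zero>\<^bsub>R\<^esub>}"
    have "(if u \<in> P then u else \<one>\<^bsub>R\<^esub>) \<noteq> (if v \<in> P then v else \<one>\<^bsub>R\<^esub>) \<longleftrightarrow> u \<noteq> v \<and> (u \<in> P \<or> v \<in> P)"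
      using one by auto
    moreover have "(if f u \<in> P' then f u else \<one>\<^bsub>R'\<^esub>) \<noteq> (if f v \<in> P' then f v else \<one>\<^bsub>R'\<^esub>) \<longleftrightarrow>
        f u \<noteq> f v \<and> (f u \<in> P' \<or> f v \<in> P')"
      using one by auto
    ultimately show "(u \<in> carrier R - {\<zero>\<^bsub>R\<^esub>} \<and> v \<in> carrier R - {\<zero>\<^bsub>R\<^esub>} \<and>
        (if u \<in> P then u else \<one>\<^bsub>R\<^esub>) \<noteq> (if v \<in> P then v else \<one>\<^bsub>R\<^esub>)) \<longleftrightarrow>
        (f u \<in> carrier R' - {\<zero>\<^bsub>R'\<^esub>} \<and> f v \<in> carrier R' - {\<zero>\<^bsub>R'\<^esub>} \<and>
        (if f u \<in> P' then f u else \<one>\<^bsub>R'\<^esub>) \<noteq> (if f v \<in> P' then f v else \<one>\<^bsub>R'\<^esub>))"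
      using uv closed fP inj by simp
  qed
  then show ?thesis by (intro exI[of _ f])
qed

lemma monomial_ideal_multipartite:
  "monomial_ideal V (edge_ideal (multipartite V \<pi>) :: ('v, 'k::field) mpol set)"
proof -
  have "(\<lambda>e. Poly_Mapping.single e 1) ` edge_exps V \<pi> \<subseteq> (monomials V :: ('v, 'k) mpol set)"
    using edge_exps_exps[of V \<pi>] by (auto simp: monomials_def exps_def)
  then show ?thesis
    unfolding monomial_ideal_def edge_ideal_multipartite monid_genideal[OF edge_exps_exps, symmetric] by blast
qed

text \<open>Since \<open>|P| \<ge> 2\<close>, there is a nonzero element \<open>u\<close> of \<open>P\<close>. It is adjacent to \<open>1\<close>, so the edge ideal does not vanish.\<close>

lemma prime_ideal_graph_regularity:
  assumes "primeideal P R" "finite (carrier R)" "card P \<ge> 2"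
  shows "regularity (carrier R - {\<zero>\<^bsub>R\<^esub>}) (ideal_power (polyring (carrier R - {\<zero>\<^bsub>R\<^esub>}))
    (edge_ideal (prime_ideal_graph R P) :: ('a, 'k::field) mpol set) n) = 2 * n"
proof -
  interpret primeideal P R by fact
  have one: "\<one>\<^bsub>R\<^esub> \<notin> P" using I_notcarr one_imp_carrier by blast
  have "\<not> P \<subseteq> {\<zero>\<^bsub>R\<^esub>}" using assms(3) card_mono[of "{\<zero>\<^bsub>R\<^esub>}" P] by auto
  then obtain u where u: "u \<in> P" "u \<noteq> \<zero>\<^bsub>R\<^esub>" by auto
  have "\<one>\<^bsub>R\<^esub> \<noteq> \<zero>\<^bsub>R\<^esub>" using one additive_subgroup.zero_closed[OF is_additive_subgroup] by metis
  then show ?thesis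
    unfolding prime_ideal_graph_multipartite[OF assms(1)]
    using u one Icarr[OF u(1)] assms(2) by (intro regularity_multipartite[of _ u "\<one>\<^bsub>R\<^esub>"]) auto
qed

theorem proposition6p9:
  fixes R :: "('a, 'm) ring_scheme" and R' :: "('b, 'n) ring_scheme"
    and P :: "'a set" and P' :: "'b set"
    and \<Gamma> :: "'a sgraph" and \<Gamma>' :: "'b sgraph"
    and V :: "'a set" and V' :: "'b set"
    and I :: "('a, 'k::field) mpol set" and I' :: "('b, 'k) mpol set"
  assumes "cring R" and "finite (carrier R)" and "primeideal P R"
    and "cring R'" and "finite (carrier R')" and "primeideal P' R'"
    and "card P \<ge> 2"
    and "card P = card P'"
    and "card (carrier (R Quot P)) = card (carrier (R' Quot P'))"
    and "\<Gamma> = prime_ideal_graph R P" and "\<Gamma>' = prime_ideal_graph R' P'"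
    and "V = vertices \<Gamma>" and "V' = vertices \<Gamma>'"
    and "I = edge_ideal \<Gamma>" and "I' = edge_ideal \<Gamma>'"
  shows "(\<exists>f. sgraph_iso \<Gamma> \<Gamma>' f) \<and>
    monomial_ideal V I \<and> monomial_ideal V' I' \<and>
    (\<exists>\<sigma>. relabeling_iso V I V' I' \<sigma>) \<and>
    card (min_vertex_covers \<Gamma>) = card (min_vertex_covers \<Gamma>') \<and>
    card (minimal_primes (polyring V) I) = card (minimal_primes (polyring V') I') \<and>
    (\<exists>\<beta>. bij_betw \<beta> (minimal_primes (polyring V) I) (minimal_primes (polyring V') I') \<and>
         (\<forall>Q\<in>minimal_primes (polyring V) I.
            height (polyring V') (\<beta> Q) = height (polyring V) Q)) \<and>
    (\<forall>n\<ge>1. mu V (ideal_power (polyring V) I n) = mu V' (ideal_power (polyring V') I' n)) \<and>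
    (\<forall>n. hilbert_function V I n = hilbert_function V' I' n) \<and>
    analytic_spread V I = analytic_spread V' I' \<and>
    (\<forall>n\<ge>1. regularity V (ideal_power (polyring V) I n) = 2 * n \<and>
           regularity V' (ideal_power (polyring V') I' n) = 2 * n)"
proof -
  define \<pi> where "\<pi> = (\<lambda>x. if x \<in> P then x else \<one>\<^bsub>R\<^esub>)"
  define \<pi>' where "\<pi>' = (\<lambda>x. if x \<in> P' then x else \<one>\<^bsub>R'\<^esub>)"
  have V: "V = carrier R - {\<zero>\<^bsub>R\<^esub>}" "V' = carrier R' - {\<zero>\<^bsub>R'\<^esub>}"
    using assms by (simp_all add: prime_ideal_graph_def)
  have \<Gamma>: "\<Gamma> = multipartite V \<pi>" and \<Gamma>': "\<Gamma>' = multipartite V' \<pi>'"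
    using assms(10,11) prime_ideal_graph_multipartite[OF assms(3)] prime_ideal_graph_multipartite[OF assms(6)]
    by (simp_all add: V \<pi>_def \<pi>'_def)
  have fin: "finite V" "finite V'" unfolding V using assms(2,5) by auto
  have wf: "edges_wf \<Gamma>" "edges_wf \<Gamma>'" unfolding \<Gamma> \<Gamma>' by (rule multipartite_wf)+
  obtain \<sigma> where iso: "sgraph_iso \<Gamma> \<Gamma>' \<sigma>"
    using prime_ideal_graph_iso[OF assms(3,6,2,5,8,9)] assms(10,11) by blast
  have bij: "bij_betw \<sigma> V V'" using iso assms(12,13) by (simp add: sgraph_iso_def)
  interpret rel: ring_isomorphism "polyring V :: ('a, 'k) mpol ring" "polyring V'" "relabel \<sigma>"
    by (rule relabel_isomorphism[OF bij])
  have I': "relabel \<sigma> ` I = I'" using relabel_edge_ideal[OF iso wf] assms(14,15) by simp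
  have I: "ideal I (polyring V)"
    unfolding assms(14) \<Gamma> edge_ideal_multipartite by (rule monid_ideal[OF edge_exps_exps])
  have Icar: "I \<subseteq> carrier (polyring V)" by (rule rel.ideal_subset[OF I])
  have relab: "relabeling_iso V I V' I' \<sigma>"
    unfolding relabeling_iso_def using bij iso I'
    by (intro conjI bexI[of _ "relabel \<sigma>"]) (auto intro: ring_isomorphism.iso[OF relabel_isomorphism])
  have primes: "bij_betw (image (relabel \<sigma>)) (minimal_primes (polyring V) I) (minimal_primes (polyring V') I')"
    using rel.bij_minimal_primes[OF Icar] by (simp add: I')
  have heights: "height (polyring V') (relabel \<sigma> ` Q) = height (polyring V) Q"
    if "Q \<in> minimal_primes (polyring V) I" for Q
    using rel.height_eq rel.minimal_primes_subset[OF that] by blast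
  have mu: "mu V (ideal_power (polyring V) I n) = mu V' (ideal_power (polyring V') I' n)" for n
  proof -
    have pow: "ideal_power (polyring V) I n = monid V (power_exps V \<pi> n)"
      unfolding assms(14) \<Gamma> by (rule ideal_power_multipartite[OF fin(1)])
    have "mu V' (relabel \<sigma> ` ideal_power (polyring V) I n) = mu V (ideal_power (polyring V) I n)"
      unfolding pow by (rule mu_relabel[OF bij, of _ "2 * n"]) (auto simp: power_exps_def)
    then show ?thesis by (simp add: rel.image_ideal_power[OF I] I')
  qed
  have reg: "regularity V (ideal_power (polyring V) I n) = 2 * n"
    "regularity V' (ideal_power (polyring V') I' n) = 2 * n" for n
    using prime_ideal_graph_regularity[OF assms(3,2,7)] prime_ideal_graph_regularity[OF assms(6,5)] assms(7,8)
    by (simp_all add: assms(10,11,14,15) V)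
  have spread: "analytic_spread V I = analytic_spread V' I'"
    using analytic_spread_relabel[OF bij I] by (simp add: I')
  have hilb: "hilbert_function V I n = hilbert_function V' I' n" for n
    using hilbert_function_relabel[OF bij I] by (simp add: I')
  show ?thesis
  proof (intro conjI allI impI)
    show "\<exists>f. sgraph_iso \<Gamma> \<Gamma>' f" using iso by (intro exI[of _ \<sigma>])
    show "monomial_ideal V I" "monomial_ideal V' I'"
      unfolding assms(14,15) \<Gamma> \<Gamma>' by (rule monomial_ideal_multipartite)+
    show "\<exists>\<sigma>. relabeling_iso V I V' I' \<sigma>" using relab by (intro exI[of _ \<sigma>])
    show "card (min_vertex_covers \<Gamma>) = card (min_vertex_covers \<Gamma>')"
      by (rule card_min_vertex_covers[OF iso wf])
    show "card (minimal_primes (polyring V) I) = card (minimal_primes (polyring V') I')"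
      by (rule bij_betw_same_card[OF primes])
    show "\<exists>\<beta>. bij_betw \<beta> (minimal_primes (polyring V) I) (minimal_primes (polyring V') I') \<and>
         (\<forall>Q\<in>minimal_primes (polyring V) I. height (polyring V') (\<beta> Q) = height (polyring V) Q)"
      using primes heights by blast
  qed (use mu hilb spread reg in auto)
qed

end
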